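(* Let $\lambda>0$, $\alpha>0$, $|\beta|<\alpha$, $\gamma=\sqrt{\alpha^2-\beta^2}$, and let $Q(u)=Q(u;\lambda,\alpha,\beta,0)$ be the quantile function of the variance gamma distribution with parameters $(\lambda,\alpha,\beta,\mu)$, $\mu=0$. Put $$v=\frac{(2\alpha)^\lambda\,\Gamma(\lambda)}{\gamma^{2\lambda}}(1-u),\qquad y=-\frac{\ln v}{\alpha-\beta}.$$ Then $$Q(u)\sim y+\sum_{n=0}^\infty\frac{P_n(\ln y)}{y^n}\quad\text{as }u\to1,$$ where $P_0(\xi)$ is a polynomial of degree $1$ and $P_n(\xi)$ are polynomials of degree $n$ for $n\ge1$, determined up to the constants $c_0,\dots,c_n$ by $$P_0(\xi)=\frac{\lambda-1}{\alpha-\beta}\xi+c_0,$$ $$P_n(\xi)=\frac{\lambda-1}{\alpha-\beta}\left(P_{n-1}(\xi)-P_{n-1}(0)\right)-\frac{\lambda-1}{\alpha-\beta}(n-1)\int_0^\xi P_{n-1}(t)\,dt+c_n,\quad n\ge1.$$ The constants $c_0,\dots,c_n$ are obtained as follows: starting with $u_0(t)=\log(b_0)$, compute $$u_k(t)=\frac{\lambda-1}{\alpha-\beta}\log\left(1+tu_{k-1}(t)\right)+\frac{1}{\alpha-\beta}\log D\left(\frac{t}{1+tu_{k-1}(t)}\right),\quad k=1,\dots,n+1,$$ and set $c_k=[t^k]u_{n+1}(t)$ for $k=0,\dots,n$, where $D(z)=\sum_{k=0}^\infty b_kz^k$ is the formal power series with $$b_k=\sum_{j=0}^k(\alpha-\beta)^{-(j+1)}\alpha^{-(k-j)}\left(\prod_{i=0}^{j-1}(\lambda-k+i)\right)a_{k-j}\left(\lambda-\tfrac12\right),\qquad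 a_k(\nu)=\frac{1}{k!\,8^k}\prod_{j=1}^k\left(4\nu^2-(2j-1)^2\right).$$ The first few terms are $$Q(u)\sim y+\frac{(\lambda-1)\log y-\log(\alpha-\beta)}{\alpha-\beta}+\frac{(\lambda-1)\left(2\alpha+\alpha\lambda-\beta\lambda+2\alpha(\lambda-1)\log y-2\alpha\log(\alpha-\beta)\right)}{2y\alpha(\alpha-\beta)^2}+\cdots\quad\text{as }u\to1.$$ The behaviour as $u\to0$ follows from $Q(u;\lambda,\alpha,\beta,0)=-Q(1-u;\lambda,\alpha,-\beta,0)$.
   Context: $K_\nu$ denotes the modified Bessel function of the second kind. The variance gamma distribution with parameters $(\lambda,\alpha,\beta,0)$ has density $$f(x)=\frac{\gamma^{2\lambda}}{(2\alpha)^{\lambda-1/2}\sqrt\pi\,\Gamma(\lambda)}|x|^{\lambda-\frac12}K_{\lambda-\frac12}(\alpha|x|)e^{\beta x},\qquad\gamma=\sqrt{\alpha^2-\beta^2}.$$ Its distribution function is $F(x)=\int_{-\infty}^xf(t)\,dt$ and its quantile function is $Q=F^{-1}:(0,1)\to\mathbb{R}$. The $u_k(t)$ are formal power series in $t$, the logarithms being of formal power series with positive constant term ($b_0=1/(\alpha-\beta)>0$); $[t^k]$ denotes extraction of the coefficient of $t^k$. As $u\to1$, $y\to\infty$, and $\sim$ denotes an asymptotic expansion. Empty products equal $1$. The expansion is derived formally, under the assumption that the asymptotic series for the density may be integrated term-wise and its terms rearranged.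
   Formalization: For λ=1 every P_n is the constant c_n, so "degree 1" and "degree n" fail; the exact degrees are stated for λ≠1, and only degree at most 1 (for P_0) and at most n (for P_n, n≥1) for all λ>0. The expansion itself is for all λ>0. *)

theory Defs
  imports
    "HOL-Analysis.Analysis"
    "HOL-Computational_Algebra.Formal_Power_Series"
    "HOL-Library.Landau_Symbols"
begin

text \<open>
  The modified Bessel function of the second kind, of real order and for real \<open>x > 0\<close>, by the
  integral \<open>K\<^sub>\<nu>(x) = \<integral>\<^sub>0\<^sup>\<infinity> exp (-x cosh t) cosh (\<nu> t) dt\<close>. For \<open>x \<le> 0\<close> the integral diverges and
  the value is the junk value 0; below this affects the density only at the single point 0.
\<close>
definition bessel_K :: "real \<Rightarrow> real \<Rightarrow> real" where
  "bessel_K \<nu> x = (LBINT t:{0..}. exp (- x * cosh t) * cosh (\<nu> * t))"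

text \<open>Throughout, the location parameter \<open>\<mu>\<close> of the variance gamma distribution is 0.\<close>

definition vg_gamma :: "real \<Rightarrow> real \<Rightarrow> real" where
  "vg_gamma \<alpha> \<beta> = sqrt (\<alpha>\<^sup>2 - \<beta>\<^sup>2)"

definition vg_density :: "real \<Rightarrow> real \<Rightarrow> real \<Rightarrow> real \<Rightarrow> real" where
  "vg_density lam \<alpha> \<beta> x =
     vg_gamma \<alpha> \<beta> powr (2 * lam) / ((2 * \<alpha>) powr (lam - 1/2) * sqrt pi * Gamma lam)
     * \<bar>x\<bar> powr (lam - 1/2) * bessel_K (lam - 1/2) (\<alpha> * \<bar>x\<bar>) * exp (\<beta> * x)"

definition vg_cdf :: "real \<Rightarrow> real \<Rightarrow> real \<Rightarrow> real \<Rightarrow> real" where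
  "vg_cdf lam \<alpha> \<beta> x = (LBINT t:{..x}. vg_density lam \<alpha> \<beta> t)"

text \<open>Only meaningful on the open unit interval, the range of the distribution function.\<close>
definition vg_quantile :: "real \<Rightarrow> real \<Rightarrow> real \<Rightarrow> real \<Rightarrow> real" where
  "vg_quantile lam \<alpha> \<beta> = inv (vg_cdf lam \<alpha> \<beta>)"

definition vg_v :: "real \<Rightarrow> real \<Rightarrow> real \<Rightarrow> real \<Rightarrow> real" where
  "vg_v lam \<alpha> \<beta> u =
     (2 * \<alpha>) powr lam * Gamma lam / vg_gamma \<alpha> \<beta> powr (2 * lam) * (1 - u)"

definition vg_y :: "real \<Rightarrow> real \<Rightarrow> real \<Rightarrow> real \<Rightarrow> real" where
  "vg_y lam \<alpha> \<beta> u = - ln (vg_v lam \<alpha> \<beta> u) / (\<alpha> - \<beta>)"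

definition hankel_a :: "nat \<Rightarrow> real \<Rightarrow> real" where
  "hankel_a k \<nu> = (\<Prod>j=1..k. 4 * \<nu>\<^sup>2 - (2 * real j - 1)\<^sup>2) / (fact k * 8 ^ k)"

definition vg_b :: "real \<Rightarrow> real \<Rightarrow> real \<Rightarrow> nat \<Rightarrow> real" where
  "vg_b lam \<alpha> \<beta> k =
     (\<Sum>j=0..k. 1 / (\<alpha> - \<beta>) ^ (j + 1) * (1 / \<alpha> ^ (k - j))
        * (\<Prod>i<j. lam - real k + real i) * hankel_a (k - j) (lam - 1/2))"

definition vg_D :: "real \<Rightarrow> real \<Rightarrow> real \<Rightarrow> real fps" where
  "vg_D lam \<alpha> \<beta> = Abs_fps (vg_b lam \<alpha> \<beta>)"

text \<open>
  Logarithm of a formal power series with positive constant term: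
  \<open>log f = ln f\<^sub>0 + log (1 + (f / f\<^sub>0 - 1))\<close>, where \<^term>\<open>fps_ln 1\<close> is the series of \<open>log (1 + X)\<close>.
\<close>
definition fps_log :: "real fps \<Rightarrow> real fps" where
  "fps_log f = fps_const (ln (fps_nth f 0))
     + (fps_ln 1 oo (fps_const (1 / fps_nth f 0) * f - 1))"

primrec vg_u :: "real \<Rightarrow> real \<Rightarrow> real \<Rightarrow> nat \<Rightarrow> real fps" where
  "vg_u lam \<alpha> \<beta> 0 = fps_const (ln (vg_b lam \<alpha> \<beta> 0))"
| "vg_u lam \<alpha> \<beta> (Suc k) =
     fps_const ((lam - 1) / (\<alpha> - \<beta>)) * fps_log (1 + fps_X * vg_u lam \<alpha> \<beta> k)
     + fps_const (1 / (\<alpha> - \<beta>))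
       * fps_log (vg_D lam \<alpha> \<beta> oo (fps_X / (1 + fps_X * vg_u lam \<alpha> \<beta> k)))"

text \<open>
  The coefficient of \<open>t\<^sup>k\<close> may equally be read off from any later iterate; that it
  does not depend on this choice is a claim about \<^const>\<open>vg_u\<close>, not part of the definition.
\<close>
definition vg_c :: "real \<Rightarrow> real \<Rightarrow> real \<Rightarrow> nat \<Rightarrow> real" where
  "vg_c lam \<alpha> \<beta> k = fps_nth (vg_u lam \<alpha> \<beta> (k + 1)) k"

text \<open>The interval integral is oriented, so the recursion is also meaningful for \<open>\<xi> < 0\<close>.\<close>
primrec vg_P :: "real \<Rightarrow> real \<Rightarrow> real \<Rightarrow> nat \<Rightarrow> real \<Rightarrow> real" where
  "vg_P lam \<alpha> \<beta> 0 = (\<lambda>\<xi>. (lam - 1) / (\<alpha> - \<beta>) * \<xi> + vg_c lam \<alpha> \<beta> 0)"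
| "vg_P lam \<alpha> \<beta> (Suc m) = (\<lambda>\<xi>.
     (lam - 1) / (\<alpha> - \<beta>) * (vg_P lam \<alpha> \<beta> m \<xi> - vg_P lam \<alpha> \<beta> m 0)
     - (lam - 1) / (\<alpha> - \<beta>) * (real (Suc m) - 1) * (LBINT t=0..\<xi>. vg_P lam \<alpha> \<beta> m t)
     + vg_c lam \<alpha> \<beta> (Suc m))"

text \<open>
  Asymptotic expansion \<open>f \<sim> \<Sum>\<^sub>n g\<^sub>n\<close> with respect to an asymptotic sequence \<open>\<phi>\<close> (in the generalised
  sense of Erdelyi): the terms need not be constant multiples of the \<open>\<phi>\<^sub>n\<close>, which accommodates
  coefficients that are polynomials in a logarithm.
\<close>
definition has_asymp_expansion ::
  "('a \<Rightarrow> real) \<Rightarrow> (nat \<Rightarrow> 'a \<Rightarrow> real) \<Rightarrow> (nat \<Rightarrow> 'a \<Rightarrow> real) \<Rightarrow> 'a filter \<Rightarrow> bool" where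
  "has_asymp_expansion f g \<phi> F \<longleftrightarrow>
     (\<forall>N. \<phi> (Suc N) \<in> o[F](\<phi> N)) \<and>
     (\<forall>N. (\<lambda>u. f u - (\<Sum>n\<le>N. g n u)) \<in> o[F](\<phi> N))"

end

(* For x > 0 the density is that of the difference of two Gamma variables; inserting a Gaussian
   representation of exp (-z t) / t into its Laplace integral and exchanging integrals turns this
   into the Bessel integral. Watson's lemma then gives the expansion of the density, and comparison
   of derivatives that of the tail: v = x^(lam-1) exp (-(alpha-beta) x) D(1/x) asymptotically.
   Taking logarithms, w = x - y satisfies w = m ln x + phi(1/x) with m = (lam-1)/(alpha-beta).

   Formally, with t = 1/y and xi = ln y, this is W = m xi + m log(1 + t W) + phi(t / (1 + t W)). The
   recursion for the P_n says that W = sum P_n(xi) t^n solves W_xi = m + m t W_xi - m t^2 W_t; the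
   residual of the fixed point equation then solves the homogeneous linear equation, and it vanishes
   at xi = 0 because the c_k are the fixed point there. Finally an expansion of w to order N gives
   one of q = w / y to order N + 1, and the equation for w turns it back into one of w. *)
theory Submission
  imports Defs "HOL-Probability.Probability" "HOL-Real_Asymp.Real_Asymp"
begin

section \<open>The formal fixed point equation\<close>

text \<open>No term-wise integration is assumed; every expansion carries a proved remainder. Powers
  of ln y are not power series in 1/y, so \<xi> and t are kept as independent variables and the
  formal part takes place in \<open>real poly fps\<close>. One factor 1/y absorbs any polynomial in
  ln y, so errors o(1/y^N) suffice throughout and no degrees have to be tracked in the analysis. An
  asymptotic expansion may not be differentiated. The tail is therefore compared with its candidate
  through bounds on derivatives that hold for every x > 0 and are integrated from x to infinity. The
  relation between x and y is exact: y = -ln V(x) / (\<alpha> - \<beta>) with V the scaled tail. All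
  expansions are thus taken as x tends to infinity, and the quantile function is inserted only at
  the end. The Bessel function enters through its integral alone, in nonnegative integrals, so that
  Fubini needs no integrability. The Gamma representation also shows that the density has total mass
  1, without which 1 - F would not be the integral of the density over the tail.\<close>

definition fps_map :: "('a::zero \<Rightarrow> 'b::zero) \<Rightarrow> 'a fps \<Rightarrow> 'b fps" where
  "fps_map h f = Abs_fps (\<lambda>n. h (fps_nth f n))"

lemma fps_map_nth [simp]: "fps_nth (fps_map h f) n = h (fps_nth f n)"
  by (simp add: fps_map_def)

text \<open>Two instances are used: real numbers as constant polynomials, and evaluation of a
  polynomial at a point. The first carries identities of real series over to series with polynomial
  coefficients, the second restricts the fixed point equation to \<xi> = 0.\<close>

locale comm_ring_hom_fun =
  fixes h :: "'a::comm_ring_1 \<Rightarrow> 'b::comm_ring_1"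
  assumes h_add: "h (x + y) = h x + h y" and h_mult: "h (x * y) = h x * h y" and h_1: "h 1 = 1"
begin

lemma h_0: "h 0 = 0"
  using h_add[of 0 0] by simp

lemma h_uminus: "h (- x) = - h x"
  using h_add[of "-x" x] by (simp add: h_0 eq_neg_iff_add_eq_0)

lemma h_sum: "h (sum f A) = (\<Sum>x\<in>A. h (f x))"
  by (induction A rule: infinite_finite_induct) (auto simp: h_add h_0)

lemma fps_map_add: "fps_map h (f + g) = fps_map h f + fps_map h g"
  by (rule fps_ext) (simp add: h_add)

lemma fps_map_uminus: "fps_map h (- f) = - fps_map h f"
  by (rule fps_ext) (simp add: h_uminus)

lemma fps_map_mult: "fps_map h (f * g) = fps_map h f * fps_map h g"
  by (rule fps_ext) (simp add: fps_mult_nth h_sum h_mult)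

lemma fps_map_1: "fps_map h 1 = 1"
  by (rule fps_ext) (auto simp: h_1 h_0)

lemma fps_map_X: "fps_map h fps_X = fps_X"
  by (rule fps_ext) (auto simp: fps_X_def h_1 h_0)

lemma fps_map_const: "fps_map h (fps_const c) = fps_const (h c)"
  by (rule fps_ext) (auto simp: h_0)

lemma fps_map_power: "fps_map h (f ^ n) = fps_map h f ^ n"
  by (induction n) (auto simp: fps_map_1 fps_map_mult)

lemma fps_map_compose: "fps_map h (f oo g) = fps_map h f oo fps_map h g"
  by (rule fps_ext) (simp add: fps_compose_nth h_sum h_mult flip: fps_map_power)

lemma fps_map_deriv: "fps_map h (fps_deriv f) = fps_deriv (fps_map h f)"
proof -
  have of_nat: "h (of_nat n) = of_nat n" for n
    by (induction n) (auto simp: h_add h_0 h_1)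
  have "h (1 + of_nat n) = 1 + of_nat n" for n
    by (simp add: h_add h_1 of_nat)
  then show ?thesis
    by (intro fps_ext) (simp add: h_mult)
qed

end

abbreviation coeff_lift :: "real fps \<Rightarrow> real poly fps" where
  "coeff_lift \<equiv> fps_map (\<lambda>c. [:c:])"

interpretation lift: comm_ring_hom_fun "\<lambda>c::real. [:c:]"
  by standard (auto simp: one_pCons)

interpretation at_point: comm_ring_hom_fun "\<lambda>p::real poly. poly p x" for x
  by standard auto

lemma coeff_lift_at_point: "fps_map (\<lambda>p. poly p x) (coeff_lift f) = f"
  by (rule fps_ext) simp

text \<open>The derivative in \<xi> with t held fixed; \<open>fps_deriv\<close> is the one in t. It
  is a derivation and not a homomorphism, so its rules are proved separately.\<close>

abbreviation coeff_deriv :: "real poly fps \<Rightarrow> real poly fps" where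
  "coeff_deriv \<equiv> fps_map pderiv"

lemma pderiv_sum: "pderiv (sum f A) = (\<Sum>x\<in>A. pderiv (f x))"
  by (induction A rule: infinite_finite_induct) (auto simp: pderiv_add)

lemma coeff_deriv_mult: "coeff_deriv (f * g) = coeff_deriv f * g + f * coeff_deriv g"
  by (rule fps_ext, simp add: fps_mult_nth pderiv_sum pderiv_mult sum.distrib)
     (simp add: add.commute mult.commute)

lemma coeff_deriv_diff: "coeff_deriv (f - g) = coeff_deriv f - coeff_deriv g"
  by (rule fps_ext) (simp add: pderiv_diff)

lemma coeff_deriv_const: "coeff_deriv (fps_const p) = fps_const (pderiv p)"
  by (rule fps_ext) simp

lemma coeff_deriv_X: "coeff_deriv fps_X = 0"
  by (rule fps_ext) (simp add: fps_X_def pderiv_1)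

lemma coeff_deriv_power: "coeff_deriv (f ^ n) = of_nat n * f ^ (n - 1) * coeff_deriv f"
proof (induction n)
  case 0
  then show ?case by (intro fps_ext) (auto simp: pderiv_1)
next
  case (Suc n)
  show ?case
  proof (cases n)
    case (Suc k)
    with Suc.IH show ?thesis
      by (simp add: coeff_deriv_mult algebra_simps)
  qed simp
qed

text \<open>The coefficients of a lifted series do not depend on \<xi>, so only the powers of
  \<open>A\<close> are differentiated. As \<open>A\<close> has no constant term, each coefficient
  involves finitely many powers and the power rule may be applied to each of them.\<close>

lemma coeff_deriv_compose:
  assumes "fps_nth A 0 = 0"
  shows "coeff_deriv (coeff_lift f oo A) = (coeff_lift (fps_deriv f) oo A) * coeff_deriv A"
proof (rule fps_ext)
  fix n
  have low: "fps_nth (A ^ i) j = 0" if "j < i" for i j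
    using startsby_zero_power_prefix[OF assms] that by blast
  have "fps_nth (coeff_deriv (coeff_lift f oo A)) n
      = (\<Sum>i=0..n. [:fps_nth f i:] * fps_nth (coeff_deriv (A ^ i)) n)"
    by (simp add: fps_compose_nth pderiv_sum pderiv_smult)
  also have "\<dots> = (\<Sum>i=0..n. [:real i * fps_nth f i:] * fps_nth (A ^ (i - 1) * coeff_deriv A) n)"
    by (intro sum.cong refl)
       (simp add: coeff_deriv_power mult.assoc fps_of_nat[symmetric] of_nat_poly del: fps_map_nth)
  \<comment> \<open>The term i = 0 has the factor 0. The new term i = n + 1 vanishes because
    \<open>A ^ n\<close> starts at t^n while the \<xi>-derivative of \<open>A\<close> has no
    constant term.\<close>
  also have "\<dots> = (\<Sum>i\<in>{1..Suc n}. [:real i * fps_nth f i:] * fps_nth (A ^ (i - 1) * coeff_deriv A) n)"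
  proof -
    have top: "fps_nth (A ^ n * coeff_deriv A) n = 0"
      unfolding fps_mult_nth
    proof (rule sum.neutral, rule ballI)
      fix i assume "i \<in> {0..n}"
      then show "fps_nth (A ^ n) i * fps_nth (coeff_deriv A) (n - i) = 0"
        using low[of i n] assms by (cases "i = n") auto
    qed
    have "(\<Sum>i\<in>{1..Suc n}. [:real i * fps_nth f i:] * fps_nth (A ^ (i - 1) * coeff_deriv A) n)
      = (\<Sum>i\<in>{1..n}. [:real i * fps_nth f i:] * fps_nth (A ^ (i - 1) * coeff_deriv A) n)"
      using top by simp
    also have "\<dots> = (\<Sum>i=0..n. [:real i * fps_nth f i:] * fps_nth (A ^ (i - 1) * coeff_deriv A) n)"
      by (rule sum.mono_neutral_left) auto
    finally show ?thesis by simp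
  qed
  also have "\<dots> = (\<Sum>i=0..n. [:fps_nth (fps_deriv f) i:] * fps_nth (A ^ i * coeff_deriv A) n)"
    by (rule sum.reindex_bij_witness[of _ Suc "\<lambda>i. i - 1"]) auto
  also have "\<dots> = (\<Sum>i=0..n. \<Sum>j=0..n. [:fps_nth (fps_deriv f) i:] * (fps_nth (A ^ i) j * fps_nth (coeff_deriv A) (n - j)))"
    by (simp add: fps_mult_nth sum_distrib_left del: fps_map_nth)
  also have "\<dots> = (\<Sum>j=0..n. \<Sum>i=0..n. [:fps_nth (fps_deriv f) i:] * (fps_nth (A ^ i) j * fps_nth (coeff_deriv A) (n - j)))"
    by (rule sum.swap)
  also have "\<dots> = (\<Sum>j=0..n. \<Sum>i=0..j. [:fps_nth (fps_deriv f) i:] * (fps_nth (A ^ i) j * fps_nth (coeff_deriv A) (n - j)))"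
    by (intro sum.cong refl sum.mono_neutral_right) (auto simp: low)
  also have "\<dots> = fps_nth ((coeff_lift (fps_deriv f) oo A) * coeff_deriv A) n"
    by (simp add: fps_mult_nth fps_compose_nth sum_distrib_right mult.assoc del: fps_deriv_nth)
  finally show "fps_nth (coeff_deriv (coeff_lift f oo A)) n
    = fps_nth ((coeff_lift (fps_deriv f) oo A) * coeff_deriv A) n" .
qed

text \<open>It occurs in two roles: as the derivative of \<open>fps_ln 1\<close>, and as the factor
  that turns t into t / (1 + t W).\<close>

abbreviation geo :: "real fps" where "geo \<equiv> inverse (1 + fps_X)"

lemma geo_mult: "geo * (1 + fps_X) = 1"
  by (rule inverse_mult_eq_1) simp

lemma geo_deriv: "fps_deriv geo = - (geo * geo)"
  by (simp add: fps_inverse_deriv power2_eq_square)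

lemma lift_geo_compose:
  assumes "fps_nth A 0 = 0"
  shows "(coeff_lift geo oo A) * (1 + A) = 1"
proof -
  have "coeff_lift geo * (1 + fps_X) = 1"
    using geo_mult by (metis lift.fps_map_1 lift.fps_map_X lift.fps_map_add lift.fps_map_mult)
  then have "(coeff_lift geo * (1 + fps_X)) oo A = 1"
    by simp
  then show ?thesis
    using assms by (simp add: fps_compose_mult_distrib fps_compose_add_distrib)
qed

text \<open>In \<^typ>\<open>real poly fps\<close> the series variable is \<open>t = 1 / y\<close> and the polynomial variable is \<open>\<xi> = ln y\<close>.\<close>
definition fix_map :: "real \<Rightarrow> real fps \<Rightarrow> real poly fps \<Rightarrow> real poly fps" where
  "fix_map m \<phi> W = fps_const [:0, m:] + fps_const [:m:] * (coeff_lift (fps_ln 1) oo (fps_X * W))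
     + (coeff_lift \<phi> oo (fps_X * (coeff_lift geo oo (fps_X * W))))"

text \<open>Dictionary: x is t, w is W, a and b are W_\<xi> and W_t, g is 1 / (1 + t W), and \<psi>
  is \<phi>' at t g. The two large brackets are the derivatives of the residual in \<xi> and in t.
  The claim is then pure ideal membership: the proof exhibits the cofactors of the two
  hypotheses.\<close>

lemma residual_pde:
  fixes a b g x m w \<psi> :: "'a::comm_ring_1"
  assumes "a * (1 - m * x) + m * x ^ 2 * b = m" and "g * (1 + x * w) = 1"
  shows "(a - m - m * (g * (x * a)) - \<psi> * (x * (- (g * g) * (x * a)))) * (1 - m * x)
    + m * x ^ 2 * (b - m * (g * (w + x * b)) - \<psi> * (g + x * (- (g * g) * (w + x * b)))) = 0"
    (is "?T = 0")
proof -
  have "?T = (a * (1 - m * x) + m * x ^ 2 * b - m) * (1 - m * g * x + \<psi> * g ^ 2 * x ^ 2)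
      + (g * (1 + x * w) - 1) * (\<psi> * m * x ^ 2 * g - m ^ 2 * x)"
    by (simp add: algebra_simps power2_eq_square)
  then show ?thesis using assms by simp
qed

text \<open>The recursion makes the residual \<open>R\<close> of the fixed point equation solve the homogeneous linear
  equation \<open>R\<^sub>\<xi> (1 - m t) + m t\<^sup>2 R\<^sub>t = 0\<close>, which determines it by its values at \<open>\<xi> = 0\<close>.\<close>
lemma fixed_point_of_recursion:
  fixes p :: "nat \<Rightarrow> real poly"
  assumes p0: "pderiv (p 0) = [:m:]"
    and pSuc: "\<And>n. pderiv (p (Suc n)) = smult m (pderiv (p n)) - smult (m * real n) (p n)"
    and at0: "\<And>n. poly (fps_nth (fix_map m \<phi> (Abs_fps p)) n) 0 = poly (p n) 0"
  shows "fix_map m \<phi> (Abs_fps p) = Abs_fps p"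
proof -
  define W where "W = Abs_fps p"
  define q where "q = fps_X * W"
  define g where "g = coeff_lift geo oo q"
  define s where "s = fps_X * g"
  define R where "R = W - fix_map m \<phi> W"
  define \<psi> where "\<psi> = coeff_lift (fps_deriv \<phi>) oo s"
  let ?m = "fps_const [:m:] :: real poly fps"
  have q0: "fps_nth q 0 = 0" and s0: "fps_nth s 0 = 0"
    by (simp_all add: q_def s_def)
  have g: "g * (1 + fps_X * W) = 1"
    using lift_geo_compose[OF q0] by (simp add: g_def q_def)
  have R: "R = W - fps_const [:0, m:] - ?m * (coeff_lift (fps_ln 1) oo q) - (coeff_lift \<phi> oo s)"
    by (simp add: R_def fix_map_def q_def s_def g_def)
  \<comment> \<open>At order 0 this is \<open>p0\<close>. At order k + 1 it is \<open>pSuc\<close>,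
    since t^2 W_t has the coefficient k p_k there.\<close>
  have W_pde: "coeff_deriv W * (1 - ?m * fps_X) + ?m * fps_X ^ 2 * fps_deriv W = ?m"
  proof (rule fps_ext)
    fix n
    show "fps_nth (coeff_deriv W * (1 - ?m * fps_X) + ?m * fps_X ^ 2 * fps_deriv W) n = fps_nth ?m n"
    proof (cases n)
      case 0
      then show ?thesis by (simp add: W_def p0 fps_mult_nth)
    next
      case (Suc k)
      have 1: "fps_nth (coeff_deriv W * (1 - ?m * fps_X)) n = pderiv (p n) - smult m (pderiv (p k))"
      proof -
        have "coeff_deriv W * (1 - ?m * fps_X) = coeff_deriv W - ?m * (fps_X * coeff_deriv W)"
          by (simp add: algebra_simps)
        then show ?thesis using Suc by (simp add: W_def)
      qed
      have 2: "fps_nth (?m * fps_X ^ 2 * fps_deriv W) n = smult (m * real k) (p k)"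
        using Suc by (cases k) (auto simp: W_def mult.assoc power2_eq_square of_nat_poly algebra_simps)
      show ?thesis using Suc 1 2 pSuc[of k] by simp
    qed
  qed
  have Lq: "fps_deriv (fps_ln (1::real)) = geo"
    by (simp add: fps_ln_deriv)
  have R\<xi>: "coeff_deriv R = coeff_deriv W - ?m - ?m * (g * (fps_X * coeff_deriv W))
      - \<psi> * (fps_X * (- (g * g) * (fps_X * coeff_deriv W)))"
  proof -
    have "coeff_deriv g = - (g * g) * (fps_X * coeff_deriv W)"
      unfolding g_def using q0
      by (subst coeff_deriv_compose)
         (auto simp: geo_deriv q_def coeff_deriv_mult coeff_deriv_X lift.fps_map_mult
            fps_compose_mult_distrib lift.fps_map_uminus fps_compose_uminus)
    moreover have "coeff_deriv (?m * (coeff_lift (fps_ln 1) oo q)) = ?m * (g * (fps_X * coeff_deriv W))"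
      using q0 by (simp add: coeff_deriv_mult coeff_deriv_const coeff_deriv_compose Lq)
        (simp add: g_def q_def coeff_deriv_mult coeff_deriv_X)
    moreover have "coeff_deriv (coeff_lift \<phi> oo s) = \<psi> * (fps_X * coeff_deriv g)"
      using s0 by (simp add: coeff_deriv_compose \<psi>_def)
        (simp add: s_def coeff_deriv_mult coeff_deriv_X)
    moreover have "coeff_deriv (fps_const [:0, m:]) = ?m"
      by (simp add: coeff_deriv_const pderiv_pCons)
    ultimately show ?thesis
      unfolding R by (simp add: coeff_deriv_diff)
  qed
  have Rt: "fps_deriv R = fps_deriv W - ?m * (g * (W + fps_X * fps_deriv W))
      - \<psi> * (g + fps_X * (- (g * g) * (W + fps_X * fps_deriv W)))"
  proof -
    have dq: "fps_deriv q = W + fps_X * fps_deriv W"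
      by (simp add: q_def)
    have dg: "fps_deriv g = - (g * g) * (W + fps_X * fps_deriv W)"
      unfolding g_def using q0
      by (subst fps_compose_deriv)
         (auto simp: dq geo_deriv lift.fps_map_mult lift.fps_map_deriv[symmetric]
            fps_compose_mult_distrib lift.fps_map_uminus fps_compose_uminus)
    have "fps_deriv (?m * (coeff_lift (fps_ln 1) oo q)) = ?m * (g * (W + fps_X * fps_deriv W))"
      using q0 by (simp add: fps_compose_deriv dq lift.fps_map_deriv[symmetric] Lq flip: g_def)
    moreover have "fps_deriv (coeff_lift \<phi> oo s) = \<psi> * (g + fps_X * fps_deriv g)"
      using s0 by (simp add: fps_compose_deriv \<psi>_def lift.fps_map_deriv[symmetric])
        (simp add: s_def)
    ultimately show ?thesis
      unfolding R dg by simp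
  qed
  have R_pde: "coeff_deriv R * (1 - ?m * fps_X) + ?m * fps_X ^ 2 * fps_deriv R = 0"
    unfolding R\<xi> Rt using W_pde g by (rule residual_pde)
  have "fps_nth R n = 0" for n
  proof (induction n)
    case 0
    have "pderiv (fps_nth R 0) = 0"
      using arg_cong[OF R_pde, of "\<lambda>f. fps_nth f 0"] by (simp add: fps_mult_nth)
    moreover have "poly (fps_nth R 0) 0 = 0"
      using at0[of 0] by (simp add: R_def W_def)
    ultimately show ?case
      by (auto simp: pderiv_eq_0_iff elim!: degree_eq_zeroE)
  next
    case (Suc n)
    have "coeff_deriv R * (1 - ?m * fps_X) = coeff_deriv R - ?m * (fps_X * coeff_deriv R)"
      by (simp add: algebra_simps)
    \<comment> \<open>Every term on the right has a factor t, so the coefficient at order n + 1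
      depends only on the coefficient of \<open>R\<close> at order n. That one is 0 by induction,
      which leaves a constant polynomial, and its value at 0 is 0 by \<open>at0\<close>.\<close>
    with R_pde have "coeff_deriv R = ?m * (fps_X * coeff_deriv R) - ?m * (fps_X * (fps_X * fps_deriv R))"
      by (simp add: algebra_simps power2_eq_square)
    from arg_cong[OF this, of "\<lambda>f. fps_nth f (Suc n)"]
    have "pderiv (fps_nth R (Suc n)) = 0"
      using Suc by (cases n) auto
    moreover have "poly (fps_nth R (Suc n)) 0 = 0"
      using at0[of "Suc n"] by (simp add: R_def W_def)
    ultimately show ?case
      by (auto simp: pderiv_eq_0_iff elim!: degree_eq_zeroE)
  qed
  then have "R = 0" by (intro fps_ext) simp
  then show ?thesis by (simp add: R_def W_def)
qed

section \<open>Congruence of power series modulo a power of t\<close>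

definition fps_agree :: "nat \<Rightarrow> 'a::zero fps \<Rightarrow> 'a fps \<Rightarrow> bool" where
  "fps_agree n f g \<longleftrightarrow> (\<forall>k\<le>n. fps_nth f k = fps_nth g k)"

lemma fps_agree_refl: "fps_agree n f f"
  by (simp add: fps_agree_def)

lemma fps_agree_add: "fps_agree n f f' \<Longrightarrow> fps_agree n g g' \<Longrightarrow> fps_agree n (f + g) (f' + (g' :: 'a::comm_ring_1 fps))"
  by (simp add: fps_agree_def)

lemma fps_agree_mult: "fps_agree n f f' \<Longrightarrow> fps_agree n g g' \<Longrightarrow> fps_agree n (f * g) (f' * (g' :: 'a::comm_ring_1 fps))"
  by (auto simp: fps_agree_def fps_mult_nth intro!: sum.cong)

lemma fps_agree_power: "fps_agree n f g \<Longrightarrow> fps_agree n (f ^ k) ((g :: 'a::comm_ring_1 fps) ^ k)"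
  by (induction k) (auto simp: fps_agree_mult fps_agree_def[of _ 1 1])

lemma fps_agree_compose:
  assumes "fps_agree n f (g :: 'a::comm_ring_1 fps)"
  shows "fps_agree n (h oo f) (h oo g)"
  using fps_agree_power[OF assms] by (auto simp: fps_agree_def fps_compose_nth intro!: sum.cong)

lemma fps_agree_X_mult_Suc:
  "fps_agree (Suc n) (fps_X * f) (fps_X * g) \<longleftrightarrow> fps_agree n f (g :: 'a::comm_ring_1 fps)"
proof
  assume *: "fps_agree (Suc n) (fps_X * f) (fps_X * g)"
  show "fps_agree n f g"
    unfolding fps_agree_def
  proof (intro allI impI)
    fix k assume "k \<le> n"
    then show "fps_nth f k = fps_nth g k"
      using *[unfolded fps_agree_def, rule_format, of "Suc k"] by simp
  qed
qed (auto simp: fps_agree_def)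

lemma fps_agree_X_mult_0: "fps_agree 0 (fps_X * f) (fps_X * (g :: 'a::comm_ring_1 fps))"
  by (simp add: fps_agree_def)

text \<open>Substituting a series without constant term keeps the constant term of \<open>f\<close>,
  so the normalisation inside \<open>fps_log\<close> is the same on both sides.\<close>

lemma fps_log_compose:
  assumes g: "fps_nth g 0 = 0" and f: "fps_nth f 0 \<noteq> 0"
  shows "fps_log (f oo g) = fps_log f oo g"
  using assms
  by (simp add: fps_log_def fps_compose_add_distrib fps_compose_sub_distrib
        fps_compose_mult_distrib flip: fps_compose_assoc)

lemma fps_log_nth_0 [simp]: "fps_nth f 0 \<noteq> 0 \<Longrightarrow> fps_nth (fps_log f) 0 = ln (fps_nth f 0)"
  by (simp add: fps_log_def)

lemma fps_log_nth_1: "fps_nth f 0 \<noteq> 0 \<Longrightarrow> fps_nth (fps_log f) 1 = fps_nth f 1 / fps_nth f 0"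
  by (simp add: fps_log_def fps_compose_nth fps_ln_nth)

section \<open>Recurrences for the coefficients of the tail and of the density\<close>

lemma vg_b_0: "vg_b lam \<alpha> \<beta> 0 = 1 / (\<alpha> - \<beta>)"
  by (simp add: vg_b_def hankel_a_def)

text \<open>The term j = 0 is split off; all others share the factor
  \<open>(lam - real (Suc k)) / (\<alpha> - \<beta>)\<close>, namely the first factor of the product
  and one power of \<alpha> - \<beta>. This is the relation that integration by parts imposes
  between the coefficients of the tail and those of the density.\<close>

lemma vg_b_Suc:
  assumes "\<beta> < \<alpha>"
  shows "(\<alpha> - \<beta>) * vg_b lam \<alpha> \<beta> (Suc k)
    = hankel_a (Suc k) (lam - 1/2) / \<alpha> ^ Suc k + (lam - real (Suc k)) * vg_b lam \<alpha> \<beta> k"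
proof -
  have "vg_b lam \<alpha> \<beta> (Suc k) = 1 / (\<alpha> - \<beta>) * (1 / \<alpha> ^ Suc k) * hankel_a (Suc k) (lam - 1/2)
      + (\<Sum>j=0..k. 1 / (\<alpha> - \<beta>) ^ (Suc j + 1) * (1 / \<alpha> ^ (Suc k - Suc j))
        * (\<Prod>i<Suc j. lam - real (Suc k) + real i) * hankel_a (Suc k - Suc j) (lam - 1/2))"
    unfolding vg_b_def
    by (subst sum.atLeast0_atMost_Suc_shift) (simp add: atLeast0AtMost)
  also have "(\<Sum>j=0..k. 1 / (\<alpha> - \<beta>) ^ (Suc j + 1) * (1 / \<alpha> ^ (Suc k - Suc j))
        * (\<Prod>i<Suc j. lam - real (Suc k) + real i) * hankel_a (Suc k - Suc j) (lam - 1/2))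
      = (lam - real (Suc k)) / (\<alpha> - \<beta>) * vg_b lam \<alpha> \<beta> k"
    unfolding vg_b_def sum_distrib_left
  proof (intro sum.cong refl)
    fix j assume "j \<in> {0..k}"
    have "(\<Prod>i<Suc j. lam - real (Suc k) + real i) = (lam - real (Suc k)) * (\<Prod>i<j. lam - real k + real i)"
      by (subst prod.lessThan_Suc_shift) (auto intro!: prod.cong simp: algebra_simps)
    then show "1 / (\<alpha> - \<beta>) ^ (Suc j + 1) * (1 / \<alpha> ^ (Suc k - Suc j)) *
         (\<Prod>i<Suc j. lam - real (Suc k) + real i) * hankel_a (Suc k - Suc j) (lam - 1 / 2) =
         (lam - real (Suc k)) / (\<alpha> - \<beta>) *
         (1 / (\<alpha> - \<beta>) ^ (j + 1) * (1 / \<alpha> ^ (k - j)) * (\<Prod>i<j. lam - real k + real i) *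
          hankel_a (k - j) (lam - 1 / 2))"
      by simp
  qed
  finally have "vg_b lam \<alpha> \<beta> (Suc k) = 1 / (\<alpha> - \<beta>) * (1 / \<alpha> ^ Suc k) * hankel_a (Suc k) (lam - 1/2)
      + (lam - real (Suc k)) / (\<alpha> - \<beta>) * vg_b lam \<alpha> \<beta> k" .
  moreover have "d * (1 / d * (1 / a) * h + c / d * b) = h / a + c * b" if "d \<noteq> 0" for a b c d h :: real
    using that by (simp add: distrib_left)
  ultimately show ?thesis
    using assms by simp
qed

text \<open>A difference of two squares factors as 4 (lam - 1 - k)(lam + k). The first factor is the
  step of a binomial coefficient, the second that of a Gamma value.\<close>

lemma hankel_a_Suc:
  "hankel_a (Suc k) (lam - 1/2)
     = hankel_a k (lam - 1/2) * ((lam - 1 - real k) * (lam + real k)) / (2 * real (Suc k))"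
proof -
  have "4 * (lam - 1/2)\<^sup>2 - (2 * real (Suc k) - 1)\<^sup>2 = 4 * ((lam - 1 - real k) * (lam + real k))"
    by (simp add: algebra_simps power2_eq_square)
  then have "hankel_a (Suc k) (lam - 1/2) = (\<Prod>j=1..k. 4 * (lam - 1/2)\<^sup>2 - (2 * real j - 1)\<^sup>2)
      * (4 * ((lam - 1 - real k) * (lam + real k))) / (real (Suc k) * fact k * (8 * 8 ^ k))"
    by (simp add: hankel_a_def del: of_nat_Suc)
  moreover have "P * (4 * A) / (S * f * (8 * E)) = P / (f * E) * A / (2 * S)" for P A S f E :: real
    by (simp add: mult_ac)
  ultimately show ?thesis
    by (simp only: hankel_a_def[of k])
qed

section \<open>The iteration that defines the constants\<close>

definition vg_phi :: "real \<Rightarrow> real \<Rightarrow> real \<Rightarrow> real fps" where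
  "vg_phi lam \<alpha> \<beta> = fps_const (1 / (\<alpha> - \<beta>)) * fps_log (vg_D lam \<alpha> \<beta>)"

text \<open>The right side of the recursion for \<open>vg_u\<close>, written with substitutions
  instead of quotients. It is \<open>fix_map\<close> specialised to \<xi> = 0.\<close>

definition vg_step :: "real \<Rightarrow> real \<Rightarrow> real \<Rightarrow> real fps \<Rightarrow> real fps" where
  "vg_step lam \<alpha> \<beta> u = fps_const ((lam - 1) / (\<alpha> - \<beta>)) * (fps_ln 1 oo (fps_X * u))
     + (vg_phi lam \<alpha> \<beta> oo (fps_X * (geo oo (fps_X * u))))"

lemma vg_u_Suc:
  assumes "\<beta> < \<alpha>"
  shows "vg_u lam \<alpha> \<beta> (Suc k) = vg_step lam \<alpha> \<beta> (vg_u lam \<alpha> \<beta> k)"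
proof -
  define u where "u = vg_u lam \<alpha> \<beta> k"
  have 1: "fps_log (1 + fps_X * u) = fps_ln 1 oo (fps_X * u)"
    by (simp add: fps_log_def)
  have "fps_X / (1 + fps_X * u) = fps_X * inverse (1 + fps_X * u)"
    by (simp add: fps_divide_unit)
  also have "inverse (1 + fps_X * u) = geo oo (fps_X * u)"
    by (simp add: fps_inverse_compose fps_compose_add_distrib)
  finally have 2: "fps_X / (1 + fps_X * u) = fps_X * (geo oo (fps_X * u))" .
  have "fps_nth (vg_D lam \<alpha> \<beta>) 0 \<noteq> 0"
    using assms by (simp add: vg_D_def vg_b_0)
  then have "fps_log (vg_D lam \<alpha> \<beta> oo (fps_X * (geo oo (fps_X * u))))
      = fps_log (vg_D lam \<alpha> \<beta>) oo (fps_X * (geo oo (fps_X * u)))"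
    by (intro fps_log_compose) auto
  then show ?thesis
    by (simp add: vg_step_def vg_phi_def 1 2 fps_compose_mult_distrib flip: u_def)
qed

lemma vg_step_agree_0: "fps_agree 0 (vg_step lam \<alpha> \<beta> u) (vg_step lam \<alpha> \<beta> u')"
  unfolding vg_step_def
  by (intro fps_agree_add fps_agree_mult[OF fps_agree_refl] fps_agree_compose fps_agree_X_mult_0)

text \<open>The unknown enters only through t u, so every application gains one order. This
  contraction property is what makes the iterates stabilise.\<close>

lemma vg_step_agree_Suc:
  assumes "fps_agree n u u'"
  shows "fps_agree (Suc n) (vg_step lam \<alpha> \<beta> u) (vg_step lam \<alpha> \<beta> u')"
proof -
  have *: "fps_agree (Suc n) (fps_X * u) (fps_X * u')"
    using assms by (simp add: fps_agree_X_mult_Suc)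
  have "fps_agree (Suc n) (fps_X * (geo oo (fps_X * u))) (fps_X * (geo oo (fps_X * u')))"
    by (intro fps_agree_mult fps_agree_refl fps_agree_compose *)
  then show ?thesis
    unfolding vg_step_def
    by (intro fps_agree_add fps_agree_mult[OF fps_agree_refl] fps_agree_compose *)
qed

lemma vg_u_agree:
  assumes "\<beta> < \<alpha>" and "n \<le> l"
  shows "fps_agree n (vg_u lam \<alpha> \<beta> (Suc n)) (vg_u lam \<alpha> \<beta> (Suc l))"
  using assms(2)
proof (induction n arbitrary: l)
  case 0
  then show ?case by (simp only: vg_u_Suc[OF assms(1)] vg_step_agree_0)
next
  case (Suc n)
  then obtain l' where "l = Suc l'" "n \<le> l'" by (cases l) auto
  then show ?case
    using Suc.IH[of l'] by (subst (1 2) vg_u_Suc[OF assms(1)]) (simp only: vg_step_agree_Suc)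
qed

text \<open>Reconciles the two ways of reading off the constants: all of c_0, ..., c_n from the one
  iterate u_(n+1), or each c_k from u_(k+1) as in \<open>vg_c\<close>.\<close>

lemma vg_u_nth:
  assumes "\<beta> < \<alpha>" and "k \<le> n"
  shows "fps_nth (vg_u lam \<alpha> \<beta> (Suc n)) k = vg_c lam \<alpha> \<beta> k"
  using vg_u_agree[OF assms, of lam] by (simp add: fps_agree_def vg_c_def)

text \<open>The series of the c_k agrees with u_(n+1) up to order n; one more step leads to u_(n+2),
  whose coefficient at n is c_n again.\<close>

lemma vg_c_fixed_point:
  assumes "\<beta> < \<alpha>"
  shows "vg_step lam \<alpha> \<beta> (Abs_fps (vg_c lam \<alpha> \<beta>)) = Abs_fps (vg_c lam \<alpha> \<beta>)"
proof (rule fps_ext)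
  fix n
  have "fps_agree n (vg_u lam \<alpha> \<beta> (Suc n)) (Abs_fps (vg_c lam \<alpha> \<beta>))"
    by (simp add: fps_agree_def vg_u_nth[OF assms] del: vg_u.simps)
  from vg_step_agree_Suc[OF this, of lam \<alpha> \<beta>]
  have "fps_nth (vg_step lam \<alpha> \<beta> (Abs_fps (vg_c lam \<alpha> \<beta>))) n = fps_nth (vg_u lam \<alpha> \<beta> (Suc (Suc n))) n"
    by (simp add: fps_agree_def vg_u_Suc[OF assms] del: vg_u.simps)
  then show "fps_nth (vg_step lam \<alpha> \<beta> (Abs_fps (vg_c lam \<alpha> \<beta>))) n = fps_nth (Abs_fps (vg_c lam \<alpha> \<beta>)) n"
    by (simp add: vg_u_nth[OF assms] del: vg_u.simps)
qed

lemma vg_phi_nth_0: "\<beta> < \<alpha> \<Longrightarrow> fps_nth (vg_phi lam \<alpha> \<beta>) 0 = - ln (\<alpha> - \<beta>) / (\<alpha> - \<beta>)"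
  by (simp add: vg_phi_def vg_D_def vg_b_0 ln_div)

lemma vg_c_0: "\<beta> < \<alpha> \<Longrightarrow> vg_c lam \<alpha> \<beta> 0 = - ln (\<alpha> - \<beta>) / (\<alpha> - \<beta>)"
  by (simp add: vg_c_def vg_u_Suc vg_step_def vg_phi_nth_0 del: vg_u.simps)

lemma vg_c_1:
  assumes "\<beta> < \<alpha>" and "\<alpha> > 0"
  shows "vg_c lam \<alpha> \<beta> 1
    = (lam - 1) * (2 * \<alpha> + \<alpha> * lam - \<beta> * lam - 2 * \<alpha> * ln (\<alpha> - \<beta>)) / (2 * \<alpha> * (\<alpha> - \<beta>)\<^sup>2)"
proof -
  define \<delta> where "\<delta> = \<alpha> - \<beta>"
  have \<delta>: "\<delta> > 0" using assms by (simp add: \<delta>_def)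
  have "\<delta> * vg_b lam \<alpha> \<beta> 1 = lam * (lam - 1) / (2 * \<alpha>) + (lam - 1) / \<delta>"
    using vg_b_Suc[OF assms(1), of lam 0] hankel_a_Suc[of 0 lam]
    by (simp add: vg_b_0 hankel_a_def[of 0] \<delta>_def)
  then have "fps_nth (fps_log (vg_D lam \<alpha> \<beta>)) 1 = lam * (lam - 1) / (2 * \<alpha>) + (lam - 1) / \<delta>"
    using \<delta> by (subst fps_log_nth_1) (simp_all add: vg_D_def vg_b_0 \<delta>_def mult.commute)
  \<comment> \<open>The fixed point equation at order t: log (1 + t u) contributes c_0, and t / (1 +
    t u) equals t modulo t^2.\<close>
  moreover have "vg_c lam \<alpha> \<beta> 1 = (lam - 1) / \<delta> * vg_c lam \<alpha> \<beta> 0 + fps_nth (vg_phi lam \<alpha> \<beta>) 1"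
  proof -
    have "vg_c lam \<alpha> \<beta> 1 = fps_nth (vg_step lam \<alpha> \<beta> (Abs_fps (vg_c lam \<alpha> \<beta>))) 1"
      by (simp add: vg_c_fixed_point[OF assms(1)])
    then show ?thesis
      by (simp add: vg_step_def fps_compose_nth fps_ln_nth \<delta>_def)
  qed
  ultimately have "vg_c lam \<alpha> \<beta> 1 = (lam - 1) / \<delta> * (- ln \<delta> / \<delta>)
      + 1 / \<delta> * (lam * (lam - 1) / (2 * \<alpha>) + (lam - 1) / \<delta>)"
    by (simp add: vg_phi_def vg_c_0[OF assms(1)] \<delta>_def)
  moreover have "2 * \<alpha> + \<alpha> * lam - \<beta> * lam = 2 * \<alpha> + \<delta> * lam"
    by (simp add: \<delta>_def algebra_simps)
  moreover have "(lam - 1) / \<delta> * (- ln \<delta> / \<delta>) + 1 / \<delta> * (lam * (lam - 1) / (2 * \<alpha>) + (lam - 1) / \<delta>)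
      = (lam - 1) * (2 * \<alpha> + \<delta> * lam - 2 * \<alpha> * ln \<delta>) / (2 * \<alpha> * \<delta>\<^sup>2)"
    using \<delta> assms(2) by (simp add: divide_simps power2_eq_square) (simp add: algebra_simps)
  ultimately show ?thesis
    by (simp only: \<delta>_def)
qed

section \<open>The functions P_n as polynomials\<close>

definition poly_integral :: "real poly \<Rightarrow> real poly" where
  "poly_integral p = (\<Sum>i\<le>degree p. monom (coeff p i / real (Suc i)) (Suc i))"

lemma pderiv_poly_integral [simp]: "pderiv (poly_integral p) = p"
proof -
  have "pderiv (poly_integral p) = (\<Sum>i\<le>degree p. monom (coeff p i) i)"
    by (simp add: poly_integral_def pderiv_sum pderiv_monom del: of_nat_Suc)
  then show ?thesis by (simp add: poly_as_sum_of_monoms)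
qed

lemma poly_poly_integral_0 [simp]: "poly (poly_integral p) 0 = 0"
  by (simp add: poly_integral_def poly_sum poly_monom)

lemma degree_poly_integral_le: "degree (poly_integral p) \<le> Suc (degree p)"
  using degree_pderiv[of "poly_integral p"] by simp

lemma degree_poly_integral: "p \<noteq> 0 \<Longrightarrow> degree (poly_integral p) = Suc (degree p)"
proof -
  assume "p \<noteq> 0"
  then have "degree (poly_integral p) \<noteq> 0"
    by (metis pderiv_poly_integral pderiv_eq_0_iff)
  then show ?thesis
    using degree_pderiv[of "poly_integral p"] by simp
qed

lemma interval_integral_poly: "(LBINT t=0..x. poly p t) = poly (poly_integral p) x"
proof -
  have "(LBINT t=ereal 0..ereal x. poly p t) = poly (poly_integral p) x - poly (poly_integral p) 0"
  proof (rule interval_integral_FTC_finite)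
    fix t
    show "(poly (poly_integral p) has_vector_derivative poly p t) (at t within {min 0 x..max 0 x})"
      using poly_DERIV[of "poly_integral p" t]
      by (simp add: has_real_derivative_iff_has_vector_derivative[symmetric] has_field_derivative_at_within)
  qed (auto intro!: continuous_intros)
  then show ?thesis by (simp add: zero_ereal_def)
qed

text \<open>Formal polynomials are needed because degrees and \<open>pderiv\<close> refer to
  \<open>real poly\<close>; the oriented integral from 0 becomes
  \<open>poly_integral\<close>.\<close>

primrec vg_poly :: "real \<Rightarrow> real \<Rightarrow> real \<Rightarrow> nat \<Rightarrow> real poly" where
  "vg_poly lam \<alpha> \<beta> 0 = [:vg_c lam \<alpha> \<beta> 0, (lam - 1) / (\<alpha> - \<beta>):]"
| "vg_poly lam \<alpha> \<beta> (Suc n) =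
     smult ((lam - 1) / (\<alpha> - \<beta>)) (vg_poly lam \<alpha> \<beta> n - [:poly (vg_poly lam \<alpha> \<beta> n) 0:])
     - smult ((lam - 1) / (\<alpha> - \<beta>) * real n) (poly_integral (vg_poly lam \<alpha> \<beta> n))
     + [:vg_c lam \<alpha> \<beta> (Suc n):]"

lemma vg_P_eq_poly: "vg_P lam \<alpha> \<beta> n = poly (vg_poly lam \<alpha> \<beta> n)"
  by (induction n) (auto simp: fun_eq_iff interval_integral_poly)

lemma poly_vg_poly_0: "poly (vg_poly lam \<alpha> \<beta> n) 0 = vg_c lam \<alpha> \<beta> n"
  by (induction n) auto

text \<open>The integral carries the factor n, which is 0 in the step from P_0 to P_1: the degree
  stays at most 1 there, and grows by at most one in each later step.\<close>

lemma degree_vg_poly_Suc_le: "degree (vg_poly lam \<alpha> \<beta> (Suc n)) \<le> Suc n"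
proof (induction n)
  case 0
  then show ?case
    by (auto intro!: degree_add_le degree_diff_le order.trans[OF degree_smult_le])
next
  case (Suc n)
  have "degree (poly_integral (vg_poly lam \<alpha> \<beta> (Suc n))) \<le> Suc (Suc n)"
    using Suc degree_poly_integral_le order.trans by (meson Suc_le_mono)
  then show ?case
    using Suc by (subst vg_poly.simps(2), intro degree_add_le degree_diff_le order.trans[OF degree_smult_le])
      (auto simp del: vg_poly.simps)
qed

text \<open>From P_1 on the factor of the integral is nonzero, so the integral has strictly larger
  degree than everything else and cannot be cancelled.\<close>

lemma degree_vg_poly_Suc:
  assumes "lam \<noteq> 1" "\<beta> < \<alpha>"
  shows "degree (vg_poly lam \<alpha> \<beta> (Suc n)) = Suc n"
proof (induction n)
  case 0
  then show ?case using assms by simp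
next
  case (Suc n)
  let ?p = "vg_poly lam \<alpha> \<beta> (Suc n)"
  let ?m = "(lam - 1) / (\<alpha> - \<beta>)"
  have "?p \<noteq> 0" using Suc by (metis degree_0 nat.distinct(1))
  then have "degree (smult (?m * real (Suc n)) (poly_integral ?p)) = Suc (Suc n)"
    using Suc assms degree_poly_integral[of ?p] by (simp del: vg_poly.simps)
  moreover have "degree (smult ?m (?p - [:poly ?p 0:]) + [:vg_c lam \<alpha> \<beta> (Suc (Suc n)):]) < Suc (Suc n)"
    using Suc by (intro le_less_trans[OF _ lessI] degree_add_le degree_diff_le order.trans[OF degree_smult_le])
      (auto simp del: vg_poly.simps)
  moreover have "vg_poly lam \<alpha> \<beta> (Suc (Suc n)) = - smult (?m * real (Suc n)) (poly_integral ?p)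
      + (smult ?m (?p - [:poly ?p 0:]) + [:vg_c lam \<alpha> \<beta> (Suc (Suc n)):])"
    by (subst vg_poly.simps(2)) (simp del: vg_poly.simps)
  ultimately show ?case
    by (simp only: degree_add_eq_left degree_minus)
qed

text \<open>Evaluation at \<xi> = 0 commutes with products and compositions. It sends
  \<open>fix_map\<close> to \<open>vg_step\<close> and the series of the P_n to that of the c_k, so
  the initial condition is \<open>vg_c_fixed_point\<close>; the recursion of the P_n supplies the
  conditions on derivatives.\<close>

lemma vg_poly_fixed_point:
  assumes "\<beta> < \<alpha>"
  shows "fix_map ((lam - 1) / (\<alpha> - \<beta>)) (vg_phi lam \<alpha> \<beta>) (Abs_fps (vg_poly lam \<alpha> \<beta>))
    = Abs_fps (vg_poly lam \<alpha> \<beta>)"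
proof (rule fixed_point_of_recursion)
  fix n
  let ?W = "Abs_fps (vg_poly lam \<alpha> \<beta>)"
  let ?ev = "fps_map (\<lambda>p::real poly. poly p 0)"
  have W: "?ev ?W = Abs_fps (vg_c lam \<alpha> \<beta>)"
    by (rule fps_ext) (simp add: poly_vg_poly_0)
  have "?ev (fix_map ((lam - 1) / (\<alpha> - \<beta>)) (vg_phi lam \<alpha> \<beta>) ?W)
      = vg_step lam \<alpha> \<beta> (Abs_fps (vg_c lam \<alpha> \<beta>))"
    by (simp add: fix_map_def vg_step_def at_point.fps_map_add at_point.fps_map_mult at_point.fps_map_compose
        at_point.fps_map_const at_point.fps_map_X coeff_lift_at_point W)
  then have "?ev (fix_map ((lam - 1) / (\<alpha> - \<beta>)) (vg_phi lam \<alpha> \<beta>) ?W) = ?ev ?W"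
    by (simp only: W vg_c_fixed_point[OF assms])
  from arg_cong[OF this, of "\<lambda>f. fps_nth f n"]
  show "poly (fps_nth (fix_map ((lam - 1) / (\<alpha> - \<beta>)) (vg_phi lam \<alpha> \<beta>) ?W) n) 0
      = poly (vg_poly lam \<alpha> \<beta> n) 0"
    by simp
qed (auto simp: pderiv_pCons pderiv_add pderiv_diff pderiv_smult)

section \<open>Expansions in powers of \<open>1 / y\<close> and \<open>ln y\<close>\<close>

text \<open>One notion for two purposes: with y = x and constant coefficients it covers the
  expansions in powers of 1/x of the tail and its logarithm, with general y that of x - y.\<close>

definition expands :: "'a filter \<Rightarrow> ('a \<Rightarrow> real) \<Rightarrow> nat \<Rightarrow> ('a \<Rightarrow> real) \<Rightarrow> real poly fps \<Rightarrow> bool" where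
  "expands F y N g A \<longleftrightarrow>
     (\<lambda>u. g u - (\<Sum>n\<le>N. poly (fps_nth A n) (ln (y u)) / y u ^ n)) \<in> o[F](\<lambda>u. 1 / y u ^ N)"

lemma expands_agree: "fps_agree N A B \<Longrightarrow> expands F y N g A \<longleftrightarrow> expands F y N g B"
  unfolding expands_def fps_agree_def by (simp cong: sum.cong_simp)

lemma expands_add:
  assumes "expands F y N f A" "expands F y N g B"
  shows "expands F y N (\<lambda>u. f u + g u) (A + B)"
  using sum_in_smallo(1)[OF assms[unfolded expands_def]]
  by (simp add: expands_def sum.distrib add_divide_distrib algebra_simps)

lemma expands_cmult:
  assumes "expands F y N f A"
  shows "expands F y N (\<lambda>u. c * f u) (fps_const [:c:] * A)"
proof (cases "c = 0")
  case False
  have "(\<lambda>u. c * (f u - (\<Sum>n\<le>N. poly (fps_nth A n) (ln (y u)) / y u ^ n))) \<in> o[F](\<lambda>u. 1 / y u ^ N)"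
    using assms False by (simp add: expands_def)
  then show ?thesis
    by (simp add: expands_def sum_distrib_left algebra_simps)
qed (simp add: expands_def)

lemma expands_sum:
  assumes "\<And>i. i \<in> I \<Longrightarrow> expands F y N (f i) (A i)"
  shows "expands F y N (\<lambda>u. \<Sum>i\<in>I. f i u) (\<Sum>i\<in>I. A i)"
  using assms
proof (induction I rule: infinite_finite_induct)
  case (insert i I)
  then show ?case using expands_add[of F y N "f i" "A i"] by simp
qed (simp_all add: expands_def)

lemma expands_poly_ln: "expands F y N (\<lambda>u. poly p (ln (y u))) (fps_const p)"
proof -
  have "(\<Sum>n\<le>N. poly (fps_nth (fps_const p) n) (ln (y u)) / y u ^ n) = poly p (ln (y u))" for u
    by (subst sum.remove[of _ 0]) auto
  then show ?thesis by (simp add: expands_def)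
qed

lemma expands_const: "expands F y N (\<lambda>u. c) (fps_const [:c:])"
  using expands_poly_ln[of F y N "[:c:]"] by simp

context
  fixes F :: "'a filter" and y :: "'a \<Rightarrow> real"
  assumes y: "filterlim y at_top F"
begin

lemma eventually_y_gt: "eventually (\<lambda>u. y u > c) F"
  using y by (simp add: filterlim_at_top_dense)

lemma poly_ln_over_y: "(\<lambda>u. poly p (ln (y u)) / y u) \<in> o[F](\<lambda>_. 1)"
proof -
  have "((\<lambda>x. poly p (ln x) / x) \<longlongrightarrow> 0) at_top"
  proof -
    have "((\<lambda>z. \<Sum>i\<le>degree p. coeff p i * (z ^ i / exp z)) \<longlongrightarrow> (\<Sum>i\<le>degree p. coeff p i * 0)) at_top"
      by (intro tendsto_sum tendsto_mult tendsto_const tendsto_power_div_exp_0)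
    then have "((\<lambda>z. poly p z / exp z) \<longlongrightarrow> 0) at_top"
      by (simp add: poly_altdef sum_divide_distrib)
    from filterlim_compose[OF this ln_at_top]
    have "((\<lambda>x. poly p (ln x) / exp (ln x)) \<longlongrightarrow> 0) at_top" .
    then show ?thesis
      by (rule Lim_transform_eventually)
         (auto intro: eventually_mono[OF eventually_gt_at_top[of 0]])
  qed
  from filterlim_compose[OF this y] show ?thesis
    by (intro smalloI_tendsto) auto
qed

text \<open>One spare factor 1/y already tends to 0 against any polynomial in ln y, and the
  remaining factors are bounded. Hence every term beyond order N is negligible at order N, whatever
  its degree.\<close>

lemma poly_ln_term:
  assumes "N < n"
  shows "(\<lambda>u. poly p (ln (y u)) / y u ^ n) \<in> o[F](\<lambda>u. 1 / y u ^ N)"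
proof -
  define k where "k = n - Suc N"
  have "(\<lambda>u. (1 / y u) ^ k) \<in> O[F](\<lambda>_. 1)"
  proof (rule bigoI[of _ 1])
    show "\<forall>\<^sub>F u in F. norm ((1 / y u) ^ k) \<le> 1 * norm (1::real)"
      using eventually_y_gt[of 1] by eventually_elim (simp add: power_le_one)
  qed
  from landau_o.small_big_mult[OF poly_ln_over_y this]
  have "(\<lambda>u. poly p (ln (y u)) / y u * (1 / y u) ^ k * (1 / y u ^ N)) \<in> o[F](\<lambda>u. 1 * 1 * (1 / y u ^ N))"
    by (rule landau_o.small.mult_right)
  moreover have "n = Suc (N + k)" using assms by (simp add: k_def)
  ultimately show ?thesis
    by (simp add: power_add power_one_over divide_simps mult_ac)
qed

lemma expands_mono:
  assumes "expands F y M g A" and "N \<le> M"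
  shows "expands F y N g A"
proof -
  let ?a = "\<lambda>n u. poly (fps_nth A n) (ln (y u)) / y u ^ n"
  have "(\<lambda>u. 1 / y u ^ M) \<in> O[F](\<lambda>u. 1 / y u ^ N)"
  proof (rule bigoI[of _ 1])
    show "\<forall>\<^sub>F u in F. norm (1 / y u ^ M) \<le> 1 * norm (1 / y u ^ N)"
      using eventually_y_gt[of 1]
      by eventually_elim (use assms(2) in \<open>auto simp: divide_simps intro!: power_increasing\<close>)
  qed
  then have "(\<lambda>u. g u - (\<Sum>n\<le>M. ?a n u)) \<in> o[F](\<lambda>u. 1 / y u ^ N)"
    using assms(1) unfolding expands_def by (rule landau_o.small_big_trans[rotated])
  moreover have "(\<lambda>u. \<Sum>n\<in>{N<..M}. ?a n u) \<in> o[F](\<lambda>u. 1 / y u ^ N)"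
    by (intro big_sum_in_smallo poly_ln_term) auto
  ultimately have "(\<lambda>u. g u - (\<Sum>n\<le>M. ?a n u) + (\<Sum>n\<in>{N<..M}. ?a n u)) \<in> o[F](\<lambda>u. 1 / y u ^ N)"
    by (rule sum_in_smallo)
  moreover have "(\<Sum>n\<le>M. ?a n u) = (\<Sum>n\<le>N. ?a n u) + (\<Sum>n\<in>{N<..M}. ?a n u)" for u
    using assms(2) by (subst sum.union_disjoint[symmetric]) (auto intro!: sum.cong)
  ultimately show ?thesis
    by (simp add: expands_def)
qed

lemma bigo_1_partial_sum:
  assumes "fps_nth A 0 = [:c:]"
  shows "(\<lambda>u. \<Sum>n\<le>N. poly (fps_nth A n) (ln (y u)) / y u ^ n) \<in> O[F](\<lambda>_. 1)"
proof (rule big_sum_in_bigo)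
  fix n
  show "(\<lambda>u. poly (fps_nth A n) (ln (y u)) / y u ^ n) \<in> O[F](\<lambda>_. 1)"
    using assms poly_ln_term[of 0 n "fps_nth A n"] by (cases "n = 0") (auto intro: landau_o.small_imp_big)
qed

lemma expands_bigo_1:
  assumes "expands F y N g A" and "fps_nth A 0 = [:c:]"
  shows "g \<in> O[F](\<lambda>_. 1)"
proof -
  have "expands F y 0 g A"
    using assms(1) by (rule expands_mono) simp
  then have "(\<lambda>u. g u - (\<Sum>n\<le>0. poly (fps_nth A n) (ln (y u)) / y u ^ n)) \<in> O[F](\<lambda>_. 1)"
    unfolding expands_def by (intro landau_o.small_imp_big) simp
  from sum_in_bigo(1)[OF this bigo_1_partial_sum[OF assms(2), of 0]] show ?thesis by simp
qed

text \<open>The coefficients at order 0 are required to be constant so that the factors are bounded.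
  A polynomial in ln y in that place could amplify the error of the other factor beyond
  o(1/y^N).\<close>

lemma expands_mult:
  assumes f: "expands F y N f A" and A: "fps_nth A 0 = [:a:]"
    and g: "expands F y N g B" and B: "fps_nth B 0 = [:b:]"
  shows "expands F y N (\<lambda>u. f u * g u) (A * B)"
proof -
  define SA where "SA = (\<lambda>u. \<Sum>n\<le>N. poly (fps_nth A n) (ln (y u)) / y u ^ n)"
  define SB where "SB = (\<lambda>u. \<Sum>n\<le>N. poly (fps_nth B n) (ln (y u)) / y u ^ n)"
  define T where "T = (\<lambda>i j u. poly (fps_nth A i * fps_nth B j) (ln (y u)) / y u ^ (i + j))"
  have fA: "(\<lambda>u. f u - SA u) \<in> o[F](\<lambda>u. 1 / y u ^ N)" and gB: "(\<lambda>u. g u - SB u) \<in> o[F](\<lambda>u. 1 / y u ^ N)"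
    using f g by (simp_all add: expands_def SA_def SB_def)
  have SB1: "SB \<in> O[F](\<lambda>_. 1)"
    unfolding SB_def by (rule bigo_1_partial_sum[OF B])
  have "(\<lambda>u. f u * (g u - SB u)) \<in> o[F](\<lambda>u. 1 * (1 / y u ^ N))"
    using expands_bigo_1[OF f A] gB by (rule landau_o.big_small_mult)
  moreover have "(\<lambda>u. (f u - SA u) * SB u) \<in> o[F](\<lambda>u. (1 / y u ^ N) * 1)"
    using fA SB1 by (rule landau_o.small_big_mult)
  ultimately have 1: "(\<lambda>u. f u * g u - SA u * SB u) \<in> o[F](\<lambda>u. 1 / y u ^ N)"
    using sum_in_smallo(1)[of "\<lambda>u. f u * (g u - SB u)" F "\<lambda>u. 1 / y u ^ N" "\<lambda>u. (f u - SA u) * SB u"]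
    by (simp add: algebra_simps)
  \<comment> \<open>The product of the partial sums is the Cauchy product up to order N plus
    finitely many terms with i + j > N, which \<open>poly_ln_term\<close> discards.\<close>
  have split: "SA u * SB u = (\<Sum>n\<le>N. poly (fps_nth (A * B) n) (ln (y u)) / y u ^ n)
      + (\<Sum>(i,j)\<in>{(i,j). i \<le> N \<and> j \<le> N \<and> N < i + j}. T i j u)" for u
  proof -
    have "SA u * SB u = (\<Sum>(i,j)\<in>{..N}\<times>{..N}. T i j u)"
      by (simp add: SA_def SB_def sum_product sum.cartesian_product T_def power_add)
    also have "{..N}\<times>{..N} = {(i,j). i + j \<le> N} \<union> {(i,j). i \<le> N \<and> j \<le> N \<and> N < i + j}"
      by auto
    also have "(\<Sum>(i,j)\<in>\<dots>. T i j u) = (\<Sum>(i,j)\<in>{(i,j). i + j \<le> N}. T i j u)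
        + (\<Sum>(i,j)\<in>{(i,j). i \<le> N \<and> j \<le> N \<and> N < i + j}. T i j u)"
    proof (rule sum.union_disjoint)
      show "finite {(i,j). i + j \<le> N}"
        by (rule finite_subset[of _ "{..N}\<times>{..N}"]) auto
      show "finite {(i,j). i \<le> N \<and> j \<le> N \<and> N < i + j}"
        by (rule finite_subset[of _ "{..N}\<times>{..N}"]) auto
    qed auto
    also have "(\<Sum>(i,j)\<in>{(i,j). i + j \<le> N}. T i j u) = (\<Sum>n\<le>N. \<Sum>i\<le>n. T i (n - i) u)"
      by (rule sum.triangle_reindex_eq)
    also have "\<dots> = (\<Sum>n\<le>N. poly (fps_nth (A * B) n) (ln (y u)) / y u ^ n)"
      by (simp add: T_def fps_mult_nth poly_sum sum_divide_distrib atLeast0AtMost)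
    finally show ?thesis .
  qed
  have "(\<lambda>u. \<Sum>x\<in>{(i,j). i \<le> N \<and> j \<le> N \<and> N < i + j}. T (fst x) (snd x) u) \<in> o[F](\<lambda>u. 1 / y u ^ N)"
    unfolding T_def by (intro big_sum_in_smallo poly_ln_term) auto
  from sum_in_smallo(1)[OF 1 this] show ?thesis
    by (simp add: expands_def split case_prod_unfold)
qed

lemma expands_power:
  assumes "expands F y N f A" and "fps_nth A 0 = [:a:]"
  shows "expands F y N (\<lambda>u. f u ^ k) (A ^ k)"
proof (induction k)
  case 0
  then show ?case using expands_const[of F y N 1] by (simp add: one_pCons[symmetric])
next
  case (Suc k)
  have "fps_nth (A ^ k) 0 = [:a ^ k:]"
    by (induction k) (auto simp: assms(2) one_pCons mult.commute)
  from expands_mult[OF assms Suc this] show ?case by simp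
qed

text \<open>Multiplication by t shifts the series and raises the order; this supplies the gain of
  one order in each round of the inversion.\<close>

lemma expands_divide_y:
  assumes "expands F y N f A"
  shows "expands F y (Suc N) (\<lambda>u. f u / y u) (fps_X * A)"
proof -
  have "(\<lambda>u. (f u - (\<Sum>n\<le>N. poly (fps_nth A n) (ln (y u)) / y u ^ n)) * (1 / y u)) \<in> o[F](\<lambda>u. 1 / y u ^ N * (1 / y u))"
    using assms unfolding expands_def by (rule landau_o.small.mult_right)
  then show ?thesis
    unfolding expands_def
    by (subst sum.atMost_Suc_shift) (simp add: diff_divide_distrib sum_divide_distrib mult.commute)
qed

text \<open>The bound on \<open>q\<close> makes the Taylor remainder of order N + 1 an O((ln y /
  y)^(N+1)), hence o(1/y^N). The powers of \<open>q\<close> up to N are expanded as products, and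
  since \<open>A\<close> has no constant term, powers beyond n do not contribute at order n.\<close>

lemma expands_compose:
  assumes q: "q \<in> O[F](\<lambda>u. ln (y u) / y u)" and A: "expands F y N q A" "fps_nth A 0 = 0"
    and g: "(\<lambda>u. g u - (\<Sum>k\<le>N. fps_nth f k * q u ^ k)) \<in> O[F](\<lambda>u. q u ^ Suc N)"
  shows "expands F y N g (coeff_lift f oo A)"
proof -
  have "(\<lambda>u. q u ^ Suc N) \<in> O[F](\<lambda>u. (ln (y u) / y u) ^ Suc N)"
    using q by (rule landau_o.big_power)
  moreover have "(\<lambda>u. (ln (y u) / y u) ^ Suc N) \<in> o[F](\<lambda>u. 1 / y u ^ N)"
    using poly_ln_term[of N "Suc N" "monom 1 (Suc N)"] by (simp add: poly_monom power_divide)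
  ultimately have err: "(\<lambda>u. g u - (\<Sum>k\<le>N. fps_nth f k * q u ^ k)) \<in> o[F](\<lambda>u. 1 / y u ^ N)"
    using g by (meson landau_o.big_trans landau_o.big_small_trans)
  define C where "C = (\<Sum>k\<le>N. fps_const [:fps_nth f k:] * A ^ k)"
  have "expands F y N (\<lambda>u. \<Sum>k\<le>N. fps_nth f k * q u ^ k) C"
    unfolding C_def
    by (intro expands_sum expands_cmult expands_power[of _ _ _ 0]) (use A in auto)
  from sum_in_smallo(1)[OF err this[unfolded expands_def]]
  have "expands F y N g C" by (simp add: expands_def)
  moreover have "fps_agree N C (coeff_lift f oo A)"
    unfolding fps_agree_def
  proof (intro allI impI)
    fix n assume "n \<le> N"
    have "fps_nth C n = (\<Sum>k\<le>N. [:fps_nth f k:] * fps_nth (A ^ k) n)"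
      by (simp add: C_def fps_sum_nth)
    also have "\<dots> = (\<Sum>k=0..n. [:fps_nth f k:] * fps_nth (A ^ k) n)"
      using \<open>n \<le> N\<close> startsby_zero_power_prefix[OF A(2)]
      by (intro sum.mono_neutral_right) auto
    finally show "fps_nth C n = fps_nth (coeff_lift f oo A) n"
      by (simp add: fps_compose_nth)
  qed
  ultimately show ?thesis by (simp add: expands_agree)
qed

text \<open>At order 0, with vanishing constant coefficient, the claim is only that \<open>q\<close>
  tends to 0. It starts the induction on the order.\<close>

lemma expands_0_0:
  assumes "q \<in> O[F](\<lambda>u. ln (y u) / y u)" and "fps_nth A 0 = 0"
  shows "expands F y 0 q A"
proof -
  have "(\<lambda>u. ln (y u) / y u) \<in> o[F](\<lambda>_. 1)"
    using poly_ln_over_y[of "[:0, 1:]"] by simp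
  with assms show ?thesis
    by (auto simp: expands_def intro: landau_o.big_small_trans)
qed

end

section \<open>Taylor bounds for 1 / (1 + z) and ln (1 + z)\<close>

lemma geo_nth: "fps_nth geo k = (- 1) ^ k"
  by (simp add: fps_inverse_fps_X_plus1)

lemma geo_taylor:
  fixes z :: real
  assumes "\<bar>z\<bar> \<le> 1/2"
  shows "\<bar>1 / (1 + z) - (\<Sum>k\<le>N. fps_nth geo k * z ^ k)\<bar> \<le> 2 * \<bar>z\<bar> ^ Suc N"
proof -
  have z: "1 + z \<ge> 1/2" using assms by (auto simp: abs_if split: if_splits)
  have "(\<Sum>k\<le>N. fps_nth geo k * z ^ k) = (\<Sum>k<Suc N. (- z) ^ k)"
    unfolding lessThan_Suc_atMost by (intro sum.cong refl) (simp add: geo_nth power_minus[of z])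
  also have "\<dots> = (1 - (- z) ^ Suc N) / (1 + z)"
    using z by (subst sum_gp_strict) auto
  finally have "1 / (1 + z) - (\<Sum>k\<le>N. fps_nth geo k * z ^ k) = (- z) ^ Suc N / (1 + z)"
    by (metis diff_diff_eq2 diff_divide_distrib add_diff_cancel_left' diff_add_cancel)
  then have "\<bar>1 / (1 + z) - (\<Sum>k\<le>N. fps_nth geo k * z ^ k)\<bar> = \<bar>z\<bar> ^ Suc N * (1 / (1 + z))"
    using z by (simp add: abs_mult power_abs del: power_Suc)
  also have "\<dots> \<le> \<bar>z\<bar> ^ Suc N * 2"
    using z by (intro mult_left_mono) (auto simp: field_simps)
  finally show ?thesis by simp
qed

text \<open>The remainder vanishes at 0 and has derivative (-t)^N / (1 + t) by the finite geometric
  sum. On the ball of radius |z| \<le> 1/2 this is at most 2 |z|^N, and the mean value inequality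
  adds the last factor |z|.\<close>

lemma ln_taylor:
  fixes z :: real
  assumes z: "\<bar>z\<bar> \<le> 1/2"
  shows "\<bar>ln (1 + z) - (\<Sum>k\<le>N. fps_nth (fps_ln 1) k * z ^ k)\<bar> \<le> 2 * \<bar>z\<bar> ^ Suc N"
proof -
  let ?f = "\<lambda>z::real. ln (1 + z) - (\<Sum>k\<le>N. fps_nth (fps_ln 1) k * z ^ k)"
  let ?f' = "\<lambda>z::real. (- z) ^ N / (1 + z)"
  have pos: "1 + t \<ge> 1/2" if "t \<in> cball 0 \<bar>z\<bar>" for t :: real
    using that z by (auto simp: dist_real_def abs_if split: if_splits)
  have "norm (?f z - ?f 0) \<le> (2 * \<bar>z\<bar> ^ N) * norm (z - 0)"
  proof (rule field_differentiable_bound[where S = "cball 0 \<bar>z\<bar>" and f' = ?f'])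
    fix t :: real assume t: "t \<in> cball 0 \<bar>z\<bar>"
    have "(\<Sum>k\<le>N. fps_nth (fps_ln 1) k * (real k * t ^ (k - 1))) = (\<Sum>k<N. (- t) ^ k)"
    proof (cases N)
      case (Suc M)
      show ?thesis
        unfolding Suc by (subst sum.atMost_Suc_shift)
          (auto simp: fps_ln_nth lessThan_Suc_atMost power_minus[of t] simp del: of_nat_Suc intro!: sum.cong)
    qed (simp add: fps_ln_nth)
    also have "\<dots> = (1 - (- t) ^ N) / (1 + t)"
      using pos[OF t] by (subst sum_gp_strict) auto
    finally have "1 / (1 + t) - (\<Sum>k\<le>N. fps_nth (fps_ln 1) k * (real k * t ^ (k - 1))) = ?f' t"
      by (simp add: diff_divide_distrib)
    moreover have "(?f has_field_derivative 1 / (1 + t)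
        - (\<Sum>k\<le>N. fps_nth (fps_ln 1) k * (real k * t ^ (k - 1)))) (at t within cball 0 \<bar>z\<bar>)"
      using pos[OF t] by (auto intro!: derivative_eq_intros sum.cong)
    ultimately show "(?f has_field_derivative ?f' t) (at t within cball 0 \<bar>z\<bar>)"
      by simp
    have "norm (?f' t) = \<bar>t\<bar> ^ N * (1 / (1 + t))"
      using pos[OF t] by (simp add: abs_mult power_abs)
    also have "\<dots> \<le> \<bar>z\<bar> ^ N * 2"
      using pos[OF t] t by (intro mult_mono power_mono) (auto simp: field_simps)
    finally show "norm (?f' t) \<le> 2 * \<bar>z\<bar> ^ N" by simp
  qed auto
  moreover have "?f 0 = 0"
    by (simp add: sum.remove[of _ 0])
  ultimately show ?thesis by (simp add: mult_ac)
qed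

lemma bigo_of_taylor:
  fixes q :: "'a \<Rightarrow> real"
  assumes q: "(q \<longlongrightarrow> 0) F"
    and f: "\<And>z. \<bar>z\<bar> \<le> 1/2 \<Longrightarrow> \<bar>f z\<bar> \<le> 2 * \<bar>z\<bar> ^ n"
  shows "(\<lambda>u. f (q u)) \<in> O[F](\<lambda>u. q u ^ n)"
proof (rule bigoI[of _ 2])
  have "eventually (\<lambda>u. dist (q u) 0 < 1/2) F"
    using q by (rule tendstoD) simp
  then show "\<forall>\<^sub>F u in F. norm (f (q u)) \<le> 2 * norm (q u ^ n)"
    by eventually_elim (use f in \<open>auto simp: power_abs\<close>)
qed

text \<open>Writing \<open>x = y (1 + q)\<close>, the equation for \<open>x - y\<close> expresses it through \<open>q = (x - y) / y\<close>, so
  each expansion of \<open>x - y\<close> to order \<open>N\<close> yields one of \<open>q\<close> to order \<open>N + 1\<close> and vice versa.\<close>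
lemma inverse_expansion:
  fixes \<psi> y :: "real \<Rightarrow> real" and \<phi> :: "real fps"
  assumes \<psi>: "\<And>N. (\<lambda>x. \<psi> x - (\<Sum>k\<le>N. fps_nth \<phi> k * (1 / x) ^ k)) \<in> O[at_top](\<lambda>x. (1 / x) ^ Suc N)"
    and y_def: "\<And>x. y x = x - m * ln x - \<psi> x"
    and W: "fix_map m \<phi> W = W"
  shows "filterlim y at_top at_top" and "expands at_top y N (\<lambda>x. x - y x) W"
proof -
  have "(\<lambda>x. \<psi> x - fps_nth \<phi> 0) \<in> O[at_top](\<lambda>_. 1)"
  proof (rule landau_o.big_trans)
    show "(\<lambda>x. \<psi> x - fps_nth \<phi> 0) \<in> O[at_top](\<lambda>x. 1 / x)"
      using \<psi>[of 0] by simp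
    show "(\<lambda>x::real. 1 / x) \<in> O[at_top](\<lambda>_. 1)" by real_asymp
  qed
  from sum_in_bigo(1)[OF this, of "\<lambda>_. fps_nth \<phi> 0"]
  have \<psi>1: "\<psi> \<in> O[at_top](\<lambda>_. 1)" by simp
  have "(\<lambda>_. 1) \<in> O[at_top](\<lambda>x::real. ln x)" by real_asymp
  with \<psi>1 have \<psi>ln: "\<psi> \<in> O[at_top](\<lambda>x. ln x)" by (rule landau_o.big_trans)
  have w: "(\<lambda>x. x - y x) \<in> O[at_top](\<lambda>x. ln x)"
  proof -
    have "(\<lambda>x. m * ln x + \<psi> x) \<in> O[at_top](\<lambda>x. ln x)"
      by (intro sum_in_bigo \<psi>ln) simp
    then show ?thesis by (simp add: y_def)
  qed
  have "(\<lambda>x::real. ln x) \<in> o[at_top](\<lambda>x. x)" by real_asymp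
  with w have "(\<lambda>x. x - y x) \<in> o[at_top](\<lambda>x. x)" by (rule landau_o.big_small_trans)
  from landau_o.smallD[OF this, of "1/2"]
  have "eventually (\<lambda>x. \<bar>x - y x\<bar> \<le> 1/2 * \<bar>x\<bar>) at_top"
    by simp
  then have ev: "eventually (\<lambda>x. y x \<ge> x / 2 \<and> y x \<le> 2 * x \<and> x \<ge> 4) at_top"
    using eventually_ge_at_top[of 4] by eventually_elim linarith
  have "filterlim (\<lambda>x::real. x / 2) at_top at_top" by real_asymp
  then show Y: "filterlim y at_top at_top"
    by (rule filterlim_at_top_mono) (use ev in \<open>auto elim: eventually_mono\<close>)
  \<comment> \<open>Here x \<ge> 4 is used: it gives ln 4 \<le> ln x, hence ln x \<le> 2 ln (x / 2).
    Thus an error O(ln x) is also O(ln y).\<close>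
  have ln_le: "eventually (\<lambda>x. ln x \<le> 2 * ln (y x)) at_top"
    using ev
  proof eventually_elim
    case (elim x)
    have "ln x + ln 4 \<le> 2 * ln x" using elim by simp
    also have "\<dots> = 2 * ln (x / 2) + ln 4"
      using elim ln_realpow[of 2 2] by (simp add: ln_div)
    finally have "ln x \<le> 2 * ln (x / 2)" by simp
    also have "\<dots> \<le> 2 * ln (y x)" using elim by simp
    finally show ?case .
  qed
  have "(\<lambda>x. ln x) \<in> O[at_top](\<lambda>x. ln (y x))"
  proof (rule bigoI[of _ 2])
    show "\<forall>\<^sub>F x in at_top. norm (ln x) \<le> 2 * norm (ln (y x))"
      using ln_le ev by eventually_elim auto
  qed
  with w have wy: "(\<lambda>x. x - y x) \<in> O[at_top](\<lambda>x. ln (y x))" by (rule landau_o.big_trans)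
  define q where "q = (\<lambda>x. (x - y x) / y x)"
  have q: "q \<in> O[at_top](\<lambda>x. ln (y x) / y x)"
    using landau_o.big.mult_right[OF wy, of "\<lambda>x. 1 / y x"] by (simp add: q_def)
  have "(\<lambda>x. ln (y x) / y x) \<in> o[at_top](\<lambda>_. 1)"
    using poly_ln_over_y[OF Y, of "[:0, 1:]"] by simp
  with q have "q \<in> o[at_top](\<lambda>_. 1)" by (rule landau_o.big_small_trans)
  then have q0: "(q \<longlongrightarrow> 0) at_top"
    using smalloD_tendsto by fastforce
  let ?A = "fps_X * W"
  \<comment> \<open>To substitute 1/x into \<phi>, composition asks for a bound in terms of y
    besides the expansion; y \<le> 2 x and a large ln y provide it.\<close>
  have s: "(\<lambda>x. 1 / x) \<in> O[at_top](\<lambda>x. ln (y x) / y x)"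
  proof (rule bigoI[of _ 1])
    have "eventually (\<lambda>x. ln (y x) > 4) at_top"
      using filterlim_compose[OF ln_at_top Y] by (simp add: filterlim_at_top_dense)
    then show "\<forall>\<^sub>F x in at_top. norm (1 / x) \<le> 1 * norm (ln (y x) / y x)"
      using ev
    proof eventually_elim
      case (elim x)
      then have "y x > 0" "x > 0" by linarith+
      moreover have "y x \<le> x * ln (y x)"
        using elim \<open>x > 0\<close> mult_left_mono[of 2 "ln (y x)" x] by linarith
      ultimately show ?case
        using elim by (simp add: field_simps)
    qed
  qed
  have step: "expands at_top y N (\<lambda>x. x - y x) W" if N: "expands at_top y N q ?A" for N
  proof -
    have L: "expands at_top y N (\<lambda>x. ln (1 + q x)) (coeff_lift (fps_ln 1) oo ?A)"
      by (rule expands_compose[OF Y q N]) (simp, rule bigo_of_taylor[OF q0 ln_taylor])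
    \<comment> \<open>Since x = y (1 + q), division of 1 / (1 + q) by y yields 1/x, and formally t /
      (1 + t W). The order gained by the division is given up again.\<close>
    have "expands at_top y N (\<lambda>x. 1 / (1 + q x)) (coeff_lift geo oo ?A)"
      by (rule expands_compose[OF Y q N]) (simp, rule bigo_of_taylor[OF q0 geo_taylor])
    from expands_mono[OF Y expands_divide_y[OF Y this], of N]
    have "expands at_top y N (\<lambda>x. 1 / (1 + q x) / y x) (fps_X * (coeff_lift geo oo ?A))"
      by simp
    moreover have "eventually (\<lambda>x. 1 / (1 + q x) / y x = 1 / x) at_top"
      using ev by eventually_elim (auto simp: q_def field_simps)
    ultimately have "expands at_top y N (\<lambda>x. 1 / x) (fps_X * (coeff_lift geo oo ?A))"
      unfolding expands_def by (subst (asm) landau_o.small.in_cong) (auto elim: eventually_mono)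
    from expands_compose[OF Y s this _ \<psi>[of N]]
    have P: "expands at_top y N \<psi> (coeff_lift \<phi> oo (fps_X * (coeff_lift geo oo ?A)))"
      by simp
    have "expands at_top y N (\<lambda>x. poly [:0, m:] (ln (y x)) + m * ln (1 + q x) + \<psi> x) (fix_map m \<phi> W)"
      unfolding fix_map_def by (intro expands_add expands_cmult expands_poly_ln L P)
    moreover have "eventually (\<lambda>x. poly [:0, m:] (ln (y x)) + m * ln (1 + q x) + \<psi> x = x - y x) at_top"
      using ev
    proof eventually_elim
      case (elim x)
      then have "y x > 0" "x > 0" by linarith+
      then have "ln x = ln (y x) + ln (1 + q x)"
        by (subst ln_mult_pos[symmetric]) (auto simp: q_def field_simps)
      then have "m * ln x = ln (y x) * m + m * ln (1 + q x)"
        by (simp add: distrib_left)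
      then show ?case using y_def[of x] by simp
    qed
    ultimately show ?thesis
      unfolding expands_def W by (subst (asm) landau_o.small.in_cong) (auto elim: eventually_mono)
  qed
  have "expands at_top y N q ?A"
  proof (induction N)
    case 0
    show ?case using q by (rule expands_0_0[OF Y]) simp
  next
    case (Suc N)
    from expands_divide_y[OF Y step[OF this]] show ?case by (simp add: q_def)
  qed
  then show "expands at_top y N (\<lambda>x. x - y x) W" by (rule step)
qed

section \<open>The density as a Laplace integral\<close>

lemma borel_measurable_cosh [measurable]: "(cosh :: real \<Rightarrow> real) \<in> borel_measurable borel"
  by (intro borel_measurable_continuous_onI continuous_intros)

text \<open>Substitution on [0, n] followed by monotone convergence. For nonnegative integrals no
  integrability has to be known beforehand.\<close>

lemma nn_integral_substitution_half_line:
  fixes f g g' :: "real \<Rightarrow> real"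
  assumes f [measurable]: "f \<in> borel_measurable borel"
    and g: "\<And>x. x \<ge> 0 \<Longrightarrow> (g has_real_derivative g' x) (at x)"
    and cont: "continuous_on {0..} g'" and nonneg: "\<And>x. x \<ge> 0 \<Longrightarrow> g' x \<ge> 0"
    and g0: "g 0 = 0" and lim: "filterlim g at_top at_top"
  shows "(\<integral>\<^sup>+x. ennreal (f x) * indicator {0..} x \<partial>lborel)
    = (\<integral>\<^sup>+x. ennreal (f (g x) * g' x) * indicator {0..} x \<partial>lborel)"
proof -
  have mono: "g a \<le> g b" if "0 \<le> a" "a \<le> b" for a b
  proof (rule DERIV_nonneg_imp_nondecreasing[of a b g])
    fix x assume "a \<le> x" "x \<le> b"
    with that have "x \<ge> 0" by simp
    then show "\<exists>y. (g has_real_derivative y) (at x) \<and> 0 \<le> y"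
      using g nonneg by blast
  qed (use that in simp)
  \<comment> \<open>Nothing is assumed about \<open>g\<close> and \<open>g'\<close> at negative
    arguments, so measurability comes from continuity on [0, b] after cutting off with the
    indicator.\<close>
  have [measurable]: "(\<lambda>x. f (g x) * g' x * indicator {0..b} x) \<in> borel_measurable borel" for b
  proof -
    have [measurable]: "(\<lambda>x. g' x * indicator {0..b} x) \<in> borel_measurable borel"
      using borel_measurable_continuous_on_indicator[of "{0..b}" g'] continuous_on_subset[OF cont, of "{0..b}"]
      by (simp add: mult.commute)
    have "continuous_on {0..b} g"
      using g by (meson DERIV_isCont atLeastAtMost_iff continuous_at_imp_continuous_on)
    then have [measurable]: "(\<lambda>x. g x * indicator {0..b} x) \<in> borel_measurable borel"
      using borel_measurable_continuous_on_indicator[of "{0..b}" g] by (simp add: mult.commute)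
    have "(\<lambda>x. f (g x) * g' x * indicator {0..b} x)
        = (\<lambda>x. f (g x * indicator {0..b} x) * (g' x * indicator {0..b} x))"
      by (auto simp: fun_eq_iff indicator_def)
    also have "\<dots> \<in> borel_measurable borel" by measurable
    finally show ?thesis .
  qed
  have [measurable]: "(\<lambda>x. ennreal (f (g x) * g' x) * indicator {0..b} x) \<in> borel_measurable borel" for b
  proof -
    have "(\<lambda>x. ennreal (f (g x) * g' x) * indicator {0..b} x)
        = (\<lambda>x. ennreal (f (g x) * g' x * indicator {0..b} x))"
      by (auto simp: fun_eq_iff indicator_def)
    then show ?thesis by simp
  qed
  have L1: "(\<lambda>n. \<integral>\<^sup>+x. ennreal (f x) * indicator {0..g (real n)} x \<partial>lborel)
      \<longlonglongrightarrow> (\<integral>\<^sup>+x. ennreal (f x) * indicator {0..} x \<partial>lborel)"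
  proof (rule nn_integral_LIMSEQ)
    show "incseq (\<lambda>n x. ennreal (f x) * indicator {0..g (real n)} x)"
    proof (intro monoI le_funI mult_left_mono)
      fix m n :: nat and x assume "m \<le> n"
      then have "g (real m) \<le> g (real n)" by (intro mono) auto
      then show "indicator {0..g (real m)} x \<le> (indicator {0..g (real n)} x :: ennreal)"
        by (auto simp: indicator_def)
    qed simp
    fix x
    have "filterlim (\<lambda>n. g (real n)) at_top sequentially"
      using lim filterlim_real_sequentially by (rule filterlim_compose)
    then have "eventually (\<lambda>n. g (real n) \<ge> x) sequentially"
      by (simp add: filterlim_at_top)
    then have "eventually (\<lambda>n. ennreal (f x) * indicator {0..g (real n)} x
        = ennreal (f x) * indicator {0..} x) sequentially"
      by eventually_elim (auto simp: indicator_def)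
    then show "(\<lambda>n. ennreal (f x) * indicator {0..g (real n)} x) \<longlonglongrightarrow> ennreal (f x) * indicator {0..} x"
      by (rule tendsto_eventually)
  qed measurable
  have L2: "(\<lambda>n. \<integral>\<^sup>+x. ennreal (f (g x) * g' x) * indicator {0..real n} x \<partial>lborel)
      \<longlonglongrightarrow> (\<integral>\<^sup>+x. ennreal (f (g x) * g' x) * indicator {0..} x \<partial>lborel)"
  proof (rule nn_integral_LIMSEQ)
    show "incseq (\<lambda>n x. ennreal (f (g x) * g' x) * indicator {0..real n} x)"
      by (intro monoI le_funI mult_left_mono) (auto simp: indicator_def)
    fix x
    have "eventually (\<lambda>n. real n \<ge> x) sequentially"
      using filterlim_real_sequentially by (simp add: filterlim_at_top)
    then have "eventually (\<lambda>n. ennreal (f (g x) * g' x) * indicator {0..real n} x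
        = ennreal (f (g x) * g' x) * indicator {0..} x) sequentially"
      by eventually_elim (auto simp: indicator_def)
    then show "(\<lambda>n. ennreal (f (g x) * g' x) * indicator {0..real n} x)
        \<longlonglongrightarrow> ennreal (f (g x) * g' x) * indicator {0..} x"
      by (rule tendsto_eventually)
  qed measurable
  have eq: "(\<integral>\<^sup>+x. ennreal (f x) * indicator {0..g (real n)} x \<partial>lborel)
      = (\<integral>\<^sup>+x. ennreal (f (g x) * g' x) * indicator {0..real n} x \<partial>lborel)" for n
  proof -
    have "(\<integral>\<^sup>+x. ennreal (f x * indicator {g 0..g (real n)} x) \<partial>lborel)
      = (\<integral>\<^sup>+x. ennreal (f (g x) * g' x * indicator {0..real n} x) \<partial>lborel)"
    proof (rule nn_integral_substitution)
      show "set_borel_measurable borel {g 0..g (real n)} f"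
        unfolding set_borel_measurable_def by measurable
      show "continuous_on {0..real n} g'"
        by (rule continuous_on_subset[OF cont]) auto
    qed (use g nonneg in auto)
    moreover have "ennreal (a * indicator S x) = ennreal a * indicator S x" for a x :: real and S
      by (simp add: indicator_def)
    ultimately show ?thesis by (simp only: g0)
  qed
  show ?thesis
    by (rule LIMSEQ_unique[OF L1]) (unfold eq, rule L2)
qed

lemma nn_integral_fold:
  fixes f :: "real \<Rightarrow> ennreal"
  assumes [measurable]: "f \<in> borel_measurable borel"
  shows "(\<integral>\<^sup>+x. f x \<partial>lborel) = (\<integral>\<^sup>+x. (f x + f (- x)) * indicator {0..} x \<partial>lborel)"
proof -
  have "(\<integral>\<^sup>+x. f x \<partial>lborel) = (\<integral>\<^sup>+x. f x * indicator {0..} x + f x * indicator {..<0} x \<partial>lborel)"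
    by (intro nn_integral_cong) (auto simp: indicator_def)
  also have "\<dots> = (\<integral>\<^sup>+x. f x * indicator {0..} x \<partial>lborel) + (\<integral>\<^sup>+x. f x * indicator {..<0} x \<partial>lborel)"
    by (rule nn_integral_add) auto
  also have "(\<integral>\<^sup>+x. f x * indicator {..<0} x \<partial>lborel)
      = (\<integral>\<^sup>+x. f (- x) * indicator {..<0} (- x) \<partial>lborel)"
    by (subst nn_integral_real_affine[where c = "-1" and t = 0]) auto
  also have "\<dots> = (\<integral>\<^sup>+x. f (- x) * indicator {0..} x \<partial>lborel)"
  proof (rule nn_integral_cong_AE)
    show "AE x in lborel. f (- x) * indicator {..<0} (- x) = f (- x) * indicator {0..} x"
      using AE_lborel_singleton[of 0] by eventually_elim (auto simp: indicator_def)
  qed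
  also have "(\<integral>\<^sup>+x. f x * indicator {0..} x \<partial>lborel) + \<dots>
      = (\<integral>\<^sup>+x. f x * indicator {0..} x + f (- x) * indicator {0..} x \<partial>lborel)"
    by (rule nn_integral_add[symmetric]) auto
  finally show ?thesis by (simp add: distrib_right)
qed

lemma nn_integral_gamma_kernel:
  assumes "c > 0" and "k > 0"
  shows "(\<integral>\<^sup>+q. ennreal (q powr (k - 1) * exp (- c * q)) * indicator {0..} q \<partial>lborel)
    = ennreal (Gamma k / c powr k)"
proof -
  have "ennreal (Gamma k) = (\<integral>\<^sup>+t. ennreal (indicator {0..} t * t powr (k - 1) / exp t) \<partial>lborel)"
    using assms by (simp add: Gamma_conv_nn_integral_real)
  also have "\<dots> = ennreal c * (\<integral>\<^sup>+q. ennreal (indicator {0..} (c * q) * (c * q) powr (k - 1) / exp (c * q)) \<partial>lborel)"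
    using assms by (subst nn_integral_real_affine[where c = c and t = 0]) auto
  also have "\<dots> = (\<integral>\<^sup>+q. ennreal c * ennreal (indicator {0..} (c * q) * (c * q) powr (k - 1) / exp (c * q)) \<partial>lborel)"
    by (rule nn_integral_cmult[symmetric]) measurable
  also have "\<dots> = (\<integral>\<^sup>+q. ennreal (c powr k) * (ennreal (q powr (k - 1) * exp (- c * q)) * indicator {0..} q) \<partial>lborel)"
  proof (intro nn_integral_cong)
    fix q :: real
    have "c * (c powr (k - 1)) = c powr k" using assms by (simp add: powr_mult_base)
    then show "ennreal c * ennreal (indicator {0..} (c * q) * (c * q) powr (k - 1) / exp (c * q))
        = ennreal (c powr k) * (ennreal (q powr (k - 1) * exp (- c * q)) * indicator {0..} q)"
      using assms
      by (auto simp: indicator_def zero_le_mult_iff ennreal_mult'[symmetric] powr_mult exp_minus field_simps)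
  qed
  also have "\<dots> = ennreal (c powr k) * (\<integral>\<^sup>+q. ennreal (q powr (k - 1) * exp (- c * q)) * indicator {0..} q \<partial>lborel)"
    by (rule nn_integral_cmult) measurable
  finally have "ennreal (1 / c powr k) * ennreal (Gamma k) = ennreal (1 / c powr k) * (ennreal (c powr k) *
      (\<integral>\<^sup>+q. ennreal (q powr (k - 1) * exp (- c * q)) * indicator {0..} q \<partial>lborel))"
    by simp
  then show ?thesis
    using assms by (simp add: ennreal_mult'[symmetric] mult.assoc[symmetric])
qed

lemma nn_integral_gaussian_half_line:
  assumes "c > 0"
  shows "(\<integral>\<^sup>+p. ennreal (exp (- c * p\<^sup>2)) * indicator {0..} p \<partial>lborel) = ennreal (sqrt (pi / c) / 2)"
proof -
  define d where "d = sqrt c"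
  have d: "d > 0" "d\<^sup>2 = c" using assms by (auto simp: d_def)
  have "ennreal (sqrt pi / 2) = (\<integral>\<^sup>+x. ennreal (indicator {0..} x *\<^sub>R exp (- x\<^sup>2)) \<partial>lborel)"
    using gaussian_moment_0 by (subst nn_integral_eq_integral) (auto simp: has_bochner_integral_iff)
  also have "\<dots> = ennreal d * (\<integral>\<^sup>+p. ennreal (indicator {0..} (d * p) *\<^sub>R exp (- (d * p)\<^sup>2)) \<partial>lborel)"
    using d by (subst nn_integral_real_affine[where c = d and t = 0]) auto
  also have "(\<integral>\<^sup>+p. ennreal (indicator {0..} (d * p) *\<^sub>R exp (- (d * p)\<^sup>2)) \<partial>lborel)
      = (\<integral>\<^sup>+p. ennreal (exp (- c * p\<^sup>2)) * indicator {0..} p \<partial>lborel)"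
    using d by (intro nn_integral_cong) (auto simp: indicator_def zero_le_mult_iff power_mult_distrib)
  finally have "ennreal (1 / d) * ennreal (sqrt pi / 2)
      = ennreal (1 / d) * (ennreal d * (\<integral>\<^sup>+p. ennreal (exp (- c * p\<^sup>2)) * indicator {0..} p \<partial>lborel))"
    by simp
  then show ?thesis
    using d by (simp add: ennreal_mult'[symmetric] mult.assoc[symmetric] real_sqrt_divide d_def)
qed

text \<open>The Bessel integral of order \<open>1/2\<close> is elementary, by \<open>p = sinh (r / 2)\<close>.\<close>
lemma nn_integral_bessel_half:
  assumes "c > 0"
  shows "(\<integral>\<^sup>+r. ennreal (exp (- c * cosh r) * cosh (r / 2)) * indicator {0..} r \<partial>lborel)
    = ennreal (exp (- c) * sqrt (pi / (2 * c)))"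
proof -
  have "(\<integral>\<^sup>+p. ennreal (exp (- (2 * c) * p\<^sup>2)) * indicator {0..} p \<partial>lborel)
      = (\<integral>\<^sup>+r. ennreal (exp (- (2 * c) * (sinh (r / 2))\<^sup>2) * (cosh (r / 2) / 2)) * indicator {0..} r \<partial>lborel)"
  proof (rule nn_integral_substitution_half_line)
    show "filterlim (\<lambda>r::real. sinh (r / 2)) at_top at_top" by real_asymp
    show "((\<lambda>r::real. sinh (r / 2)) has_real_derivative cosh (x / 2) / 2) (at x)" for x
      by (auto intro!: derivative_eq_intros)
    show "continuous_on {0..} (\<lambda>r::real. cosh (r / 2) / 2)"
      by (intro continuous_intros) auto
  qed (auto simp: cosh_real_nonneg)
  also have "\<dots> = (\<integral>\<^sup>+r. ennreal (exp c / 2) * (ennreal (exp (- c * cosh r) * cosh (r / 2)) * indicator {0..} r) \<partial>lborel)"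
  proof (intro nn_integral_cong)
    fix r :: real
    have "cosh r = cosh (2 * (r / 2))" by simp
    also have "\<dots> = 1 + 2 * (sinh (r / 2))\<^sup>2"
      by (subst cosh_double) (simp add: cosh_square_eq)
    finally have "- (2 * c) * (sinh (r / 2))\<^sup>2 = c + - c * cosh r"
      by (simp add: algebra_simps)
    then have "exp (- (2 * c) * (sinh (r / 2))\<^sup>2) = exp c * exp (- c * cosh r)"
      by (simp only: exp_add)
    then have "exp (- (2 * c) * (sinh (r / 2))\<^sup>2) * (cosh (r / 2) / 2)
        = exp c / 2 * (exp (- c * cosh r) * cosh (r / 2))"
      by simp
    then show "ennreal (exp (- (2 * c) * (sinh (r / 2))\<^sup>2) * (cosh (r / 2) / 2)) * indicator {0..} r
        = ennreal (exp c / 2) * (ennreal (exp (- c * cosh r) * cosh (r / 2)) * indicator {0..} r)"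
      by (simp only: ennreal_mult' mult.assoc) (simp add: ennreal_mult'[symmetric] mult.assoc[symmetric])
  qed
  also have "\<dots> = ennreal (exp c / 2) * (\<integral>\<^sup>+r. ennreal (exp (- c * cosh r) * cosh (r / 2)) * indicator {0..} r \<partial>lborel)"
    by (rule nn_integral_cmult) measurable
  finally have "ennreal (2 * exp (- c)) * ennreal (sqrt (pi / (2 * c)) / 2)
      = ennreal (2 * exp (- c)) * (ennreal (exp c / 2) * (\<integral>\<^sup>+r. ennreal (exp (- c * cosh r) * cosh (r / 2)) * indicator {0..} r \<partial>lborel))"
    using assms nn_integral_gaussian_half_line[of "2 * c"] by simp
  then show ?thesis
    by (simp add: ennreal_mult'[symmetric] mult.assoc[symmetric] exp_minus)
qed

text \<open>Folding at 0 merges exp (\<mu> t) and exp (-\<mu> t) into 2 cosh (\<mu> t). The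
  two-sided form is wanted because it allows translations of t.\<close>

lemma nn_integral_bessel_fold:
  "(\<integral>\<^sup>+t. ennreal (exp (- c * cosh t + \<mu> * t)) \<partial>lborel)
    = 2 * (\<integral>\<^sup>+t. ennreal (exp (- c * cosh t) * cosh (\<mu> * t)) * indicator {0..} t \<partial>lborel)"
proof -
  have "(\<integral>\<^sup>+t. ennreal (exp (- c * cosh t + \<mu> * t)) \<partial>lborel)
      = (\<integral>\<^sup>+t. (ennreal (exp (- c * cosh t + \<mu> * t)) + ennreal (exp (- c * cosh (- t) + \<mu> * (- t)))) * indicator {0..} t \<partial>lborel)"
    by (rule nn_integral_fold) measurable
  also have "\<dots> = (\<integral>\<^sup>+t. 2 * (ennreal (exp (- c * cosh t) * cosh (\<mu> * t)) * indicator {0..} t) \<partial>lborel)"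
  proof (intro nn_integral_cong)
    fix t :: real
    have "exp (- c * cosh t + \<mu> * t) + exp (- c * cosh (- t) + \<mu> * (- t)) = 2 * (exp (- c * cosh t) * cosh (\<mu> * t))"
    proof -
      have "exp (- c * cosh (- t) + \<mu> * (- t)) = exp (- c * cosh t) * exp (- (\<mu> * t))"
        by (simp add: mult_exp_exp)
      moreover have "exp (- c * cosh t + \<mu> * t) = exp (- c * cosh t) * exp (\<mu> * t)"
        by (rule exp_add)
      moreover have "cosh (\<mu> * t) = (exp (\<mu> * t) + exp (- (\<mu> * t))) / 2"
        by (simp add: cosh_field_def)
      ultimately show ?thesis by (simp only:) (simp add: distrib_left)
    qed
    then have "ennreal (exp (- c * cosh t + \<mu> * t)) + ennreal (exp (- c * cosh (- t) + \<mu> * (- t)))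
        = 2 * ennreal (exp (- c * cosh t) * cosh (\<mu> * t))"
      by (subst ennreal_plus[symmetric]) (auto simp: ennreal_mult' cosh_real_nonneg)
    then show "(ennreal (exp (- c * cosh t + \<mu> * t)) + ennreal (exp (- c * cosh (- t) + \<mu> * (- t)))) * indicator {0..} t
        = 2 * (ennreal (exp (- c * cosh t) * cosh (\<mu> * t)) * indicator {0..} t)"
      by (simp add: mult.assoc)
  qed
  also have "\<dots> = 2 * (\<integral>\<^sup>+t. ennreal (exp (- c * cosh t) * cosh (\<mu> * t)) * indicator {0..} t \<partial>lborel)"
    by (rule nn_integral_cmult) measurable
  finally show ?thesis .
qed

text \<open>Displays exp (-z \<tau>) / \<tau> as a mixture of Gaussians in \<tau>. The translation t
  = r - ln \<tau> symmetrises \<tau>^2 exp t + exp (-t) into 2 \<tau> cosh r, which leaves the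
  elementary Bessel integral of order 1/2.\<close>

lemma nn_integral_exp_representation:
  assumes "z > 0" and "\<tau> > 0"
  shows "(\<integral>\<^sup>+t. ennreal (exp (- (z / 2) * (\<tau>\<^sup>2 * exp t + exp (- t)) + t / 2)) \<partial>lborel)
    = ennreal (sqrt (2 * pi / z) * exp (- z * \<tau>) / \<tau>)"
proof -
  have "(\<integral>\<^sup>+t. ennreal (exp (- (z / 2) * (\<tau>\<^sup>2 * exp t + exp (- t)) + t / 2)) \<partial>lborel)
      = (\<integral>\<^sup>+r. ennreal (exp (- (z / 2) * (\<tau>\<^sup>2 * exp (- ln \<tau> + 1 * r) + exp (- (- ln \<tau> + 1 * r))) + (- ln \<tau> + 1 * r) / 2)) \<partial>lborel)"
    by (subst nn_integral_real_affine[where c = 1 and t = "- ln \<tau>"]) auto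
  also have "\<dots> = (\<integral>\<^sup>+r. ennreal (\<tau> powr (- 1 / 2)) * ennreal (exp (- (z * \<tau>) * cosh r + 1 / 2 * r)) \<partial>lborel)"
  proof (intro nn_integral_cong)
    fix r
    have "\<tau>\<^sup>2 * exp (- ln \<tau> + 1 * r) + exp (- (- ln \<tau> + 1 * r)) = 2 * \<tau> * cosh r"
      using assms by (simp add: exp_add exp_diff exp_minus cosh_field_def field_simps power2_eq_square)
    then have "- (z / 2) * (\<tau>\<^sup>2 * exp (- ln \<tau> + 1 * r) + exp (- (- ln \<tau> + 1 * r))) + (- ln \<tau> + 1 * r) / 2
        = - ln \<tau> / 2 + (- (z * \<tau>) * cosh r + 1 / 2 * r)"
      by (simp only:) (simp add: field_simps)
    then show "ennreal (exp (- (z / 2) * (\<tau>\<^sup>2 * exp (- ln \<tau> + 1 * r) + exp (- (- ln \<tau> + 1 * r))) + (- ln \<tau> + 1 * r) / 2))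
        = ennreal (\<tau> powr (- 1 / 2)) * ennreal (exp (- (z * \<tau>) * cosh r + 1 / 2 * r))"
      using assms by (simp only: exp_add[of "- ln \<tau> / 2"]) (simp add: ennreal_mult' powr_def)
  qed
  also have "\<dots> = ennreal (\<tau> powr (- 1 / 2)) * (\<integral>\<^sup>+r. ennreal (exp (- (z * \<tau>) * cosh r + 1 / 2 * r)) \<partial>lborel)"
    by (rule nn_integral_cmult) measurable
  also have "(\<integral>\<^sup>+r. ennreal (exp (- (z * \<tau>) * cosh r + 1 / 2 * r)) \<partial>lborel)
      = 2 * ennreal (exp (- (z * \<tau>)) * sqrt (pi / (2 * (z * \<tau>))))"
    using assms nn_integral_bessel_half[of "z * \<tau>"] by (subst nn_integral_bessel_fold) simp
  also have "ennreal (\<tau> powr (- 1 / 2)) * \<dots> = ennreal (sqrt (2 * pi / z) * exp (- z * \<tau>) / \<tau>)"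
  proof -
    have "sqrt (2 * pi / z) = 2 * sqrt (pi / (2 * z))"
      using assms by (subst real_sqrt_four[symmetric], subst real_sqrt_mult[symmetric]) simp
    then have "\<tau> powr (- 1 / 2) * (2 * (exp (- (z * \<tau>)) * sqrt (pi / (2 * (z * \<tau>)))))
        = sqrt (2 * pi / z) * exp (- z * \<tau>) * (\<tau> powr (- 1 / 2) * (1 / sqrt \<tau>))"
      by (simp add: real_sqrt_divide real_sqrt_mult mult_ac)
    also have "\<tau> powr (- 1 / 2) * (1 / sqrt \<tau>) = 1 / \<tau>"
      using assms by (simp add: powr_minus_divide powr_half_sqrt)
    finally have "\<tau> powr (- 1 / 2) * (2 * (exp (- (z * \<tau>)) * sqrt (pi / (2 * (z * \<tau>)))))
        = sqrt (2 * pi / z) * exp (- z * \<tau>) / \<tau>" by simp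
    moreover have "ennreal (\<tau> powr (- 1 / 2)) * (2 * ennreal (exp (- (z * \<tau>)) * sqrt (pi / (2 * (z * \<tau>)))))
        = ennreal (\<tau> powr (- 1 / 2) * (2 * (exp (- (z * \<tau>)) * sqrt (pi / (2 * (z * \<tau>))))))"
      by (simp add: ennreal_mult')
    ultimately show ?thesis by simp
  qed
  finally show ?thesis .
qed

text \<open>Substitute q = s (x + s), so that dq = (x + 2 s) ds, in the Gamma integral.\<close>

lemma nn_integral_quadratic_gamma:
  assumes "c > 0" "k > 0" "x > 0"
  shows "(\<integral>\<^sup>+s. ennreal ((s * (x + s)) powr (k - 1) * exp (- c * (s * (x + s))) * (x + 2 * s)) * indicator {0..} s \<partial>lborel)
    = ennreal (Gamma k / c powr k)"
proof -
  have "(\<integral>\<^sup>+q. ennreal (q powr (k - 1) * exp (- c * q)) * indicator {0..} q \<partial>lborel)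
    = (\<integral>\<^sup>+s. ennreal ((s * (x + s)) powr (k - 1) * exp (- c * (s * (x + s))) * (x + 2 * s)) * indicator {0..} s \<partial>lborel)"
  proof (rule nn_integral_substitution_half_line)
    show "filterlim (\<lambda>s. s * (x + s)) at_top at_top" by real_asymp
    show "((\<lambda>s. s * (x + s)) has_real_derivative x + 2 * s) (at s)" for s
      by (auto intro!: derivative_eq_intros)
    show "continuous_on {0..} (\<lambda>s. x + 2 * s)" by (intro continuous_intros)
  qed (use assms in auto)
  then show ?thesis using nn_integral_gamma_kernel[OF assms(1,2)] by simp
qed

text \<open>Up to the factor exp (-(\<alpha> - \<beta>) x), the correlation of two Gamma kernels
  with rates \<alpha> - \<beta> and \<alpha> + \<beta>, for x > 0.\<close>

definition vg_J :: "real \<Rightarrow> real \<Rightarrow> real \<Rightarrow> ennreal" where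
  "vg_J lam \<alpha> x = (\<integral>\<^sup>+s. ennreal ((s * (x + s)) powr (lam - 1) * exp (- 2 * \<alpha> * s)) * indicator {0..} s \<partial>lborel)"

text \<open>Insert the Gaussian representation of \<open>exp (-z \<tau>) / \<tau>\<close> with \<open>\<tau> = 1 + 2 s / x\<close> into the
  Laplace integral and exchange the integrals: the inner integral in \<open>s\<close> becomes a Gamma integral.\<close>
lemma vg_J_bessel:
  assumes lam: "lam > 0" and \<alpha>: "\<alpha> > 0" and x: "x > 0"
  shows "ennreal (sqrt (2 * pi / (\<alpha> * x)) * exp (- \<alpha> * x)) * vg_J lam \<alpha> x
    = ennreal (2 * Gamma lam * (x / (2 * \<alpha>)) powr lam / x)
      * (\<integral>\<^sup>+t. ennreal (exp (- (\<alpha> * x) * cosh t) * cosh ((lam - 1/2) * t)) * indicator {0..} t \<partial>lborel)"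
proof -
  define z where "z = \<alpha> * x"
  have z: "z > 0" using \<alpha> x by (simp add: z_def)
  define \<tau> where "\<tau> = (\<lambda>s. 1 + 2 * s / x)"
  have [measurable]: "\<tau> \<in> borel_measurable borel" by (simp add: \<tau>_def)
  define E where "E = (\<lambda>s t. exp (- (z / 2) * ((\<tau> s)\<^sup>2 * exp t + exp (- t)) + t / 2))"
  \<comment> \<open>The factor \<open>\<tau> s\<close> does double duty: in one order of integration
    it cancels the 1/\<tau> of the Gaussian representation, in the other it is the Jacobian (x + 2
    s) / x.\<close>
  define B where "B = (\<lambda>s. (s * (x + s)) powr (lam - 1) * \<tau> s)"
  have B0: "B s \<ge> 0" if "s \<ge> 0" for s
    using that x by (simp add: B_def \<tau>_def)
  have [measurable]: "B \<in> borel_measurable borel" by (simp add: B_def)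
  have [measurable]: "(\<lambda>(s, t). E s t) \<in> borel_measurable (lborel \<Otimes>\<^sub>M lborel)"
    unfolding E_def by measurable
  have "(\<integral>\<^sup>+s. \<integral>\<^sup>+t. ennreal (B s) * indicator {0..} s * ennreal (E s t) \<partial>lborel \<partial>lborel)
      = (\<integral>\<^sup>+s. ennreal (sqrt (2 * pi / z) * exp (- z)) *
          (ennreal ((s * (x + s)) powr (lam - 1) * exp (- 2 * \<alpha> * s)) * indicator {0..} s) \<partial>lborel)"
  proof (intro nn_integral_cong)
    fix s :: real
    show "(\<integral>\<^sup>+t. ennreal (B s) * indicator {0..} s * ennreal (E s t) \<partial>lborel)
      = ennreal (sqrt (2 * pi / z) * exp (- z)) *
          (ennreal ((s * (x + s)) powr (lam - 1) * exp (- 2 * \<alpha> * s)) * indicator {0..} s)"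
    proof (cases "s \<ge> 0")
      case True
      have \<tau>: "\<tau> s > 0" using True x by (simp add: \<tau>_def add_pos_nonneg)
      have "(\<integral>\<^sup>+t. ennreal (B s) * indicator {0..} s * ennreal (E s t) \<partial>lborel)
          = ennreal (B s) * (\<integral>\<^sup>+t. ennreal (E s t) \<partial>lborel)"
        using True by (subst nn_integral_cmult) (auto simp: E_def)
      also have "\<dots> = ennreal (B s) * ennreal (sqrt (2 * pi / z) * exp (- z * \<tau> s) / \<tau> s)"
        unfolding E_def using nn_integral_exp_representation[OF z \<tau>] by simp
      also have "\<dots> = ennreal (B s * (sqrt (2 * pi / z) * exp (- z * \<tau> s) / \<tau> s))"
        using B0[OF True] by (rule ennreal_mult'[symmetric])
      also have "B s * (sqrt (2 * pi / z) * exp (- z * \<tau> s) / \<tau> s)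
          = (sqrt (2 * pi / z) * exp (- z)) * ((s * (x + s)) powr (lam - 1) * exp (- 2 * \<alpha> * s))"
      proof -
        have "exp (- z * \<tau> s) = exp (- z) * exp (- 2 * \<alpha> * s)"
          using x by (simp add: exp_add[symmetric] \<tau>_def z_def field_simps)
        then show ?thesis using \<tau> by (simp add: B_def)
      qed
      finally show ?thesis using True z by (simp add: ennreal_mult')
    qed simp
  qed
  also have "\<dots> = ennreal (sqrt (2 * pi / z) * exp (- z)) * vg_J lam \<alpha> x"
    unfolding vg_J_def by (rule nn_integral_cmult) measurable
  finally have 1: "(\<integral>\<^sup>+s. \<integral>\<^sup>+t. ennreal (B s) * indicator {0..} s * ennreal (E s t) \<partial>lborel \<partial>lborel)
    = ennreal (sqrt (2 * pi / z) * exp (- z)) * vg_J lam \<alpha> x" .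
  have "(\<integral>\<^sup>+s. \<integral>\<^sup>+t. ennreal (B s) * indicator {0..} s * ennreal (E s t) \<partial>lborel \<partial>lborel)
      = (\<integral>\<^sup>+t. \<integral>\<^sup>+s. ennreal (B s) * indicator {0..} s * ennreal (E s t) \<partial>lborel \<partial>lborel)"
    by (rule lborel_pair.Fubini') measurable
  also have "\<dots> = (\<integral>\<^sup>+t. ennreal (Gamma lam * (x / (2 * \<alpha>)) powr lam / x) *
      ennreal (exp (- z * cosh t + (1/2 - lam) * t)) \<partial>lborel)"
  proof (intro nn_integral_cong)
    fix t :: real
    \<comment> \<open>From \<tau>^2 = 1 + 4 s (x + s) / x^2 and z = \<alpha> x, this is the
      coefficient of -s (x + s) in the exponent of \<open>E\<close>.\<close>
    define c where "c = 2 * \<alpha> / x * exp t"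
    have c: "c > 0" using \<alpha> x by (simp add: c_def)
    have "(\<integral>\<^sup>+s. ennreal (B s) * indicator {0..} s * ennreal (E s t) \<partial>lborel)
      = (\<integral>\<^sup>+s. ennreal (exp (- z * cosh t + t / 2) / x) *
          (ennreal ((s * (x + s)) powr (lam - 1) * exp (- c * (s * (x + s))) * (x + 2 * s)) * indicator {0..} s) \<partial>lborel)"
    proof (intro nn_integral_cong)
      fix s :: real
      have "E s t = exp (- z * cosh t + t / 2) * exp (- c * (s * (x + s)))"
        unfolding exp_add[symmetric] E_def exp_inj_iff
        using x by (simp add: c_def z_def \<tau>_def cosh_field_def exp_minus field_simps power2_eq_square)
      moreover have "\<tau> s = (x + 2 * s) / x" using x by (simp add: \<tau>_def field_simps)
      ultimately have "B s * E s t = exp (- z * cosh t + t / 2) / x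
          * ((s * (x + s)) powr (lam - 1) * exp (- c * (s * (x + s))) * (x + 2 * s))"
        by (simp add: B_def)
      then show "ennreal (B s) * indicator {0..} s * ennreal (E s t)
        = ennreal (exp (- z * cosh t + t / 2) / x) *
          (ennreal ((s * (x + s)) powr (lam - 1) * exp (- c * (s * (x + s))) * (x + 2 * s)) * indicator {0..} s)"
        using B0[of s] x by (cases "s \<ge> 0") (auto simp: ennreal_mult'[symmetric] E_def)
    qed
    also have "\<dots> = ennreal (exp (- z * cosh t + t / 2) / x) * ennreal (Gamma lam / c powr lam)"
      using nn_integral_quadratic_gamma[OF c lam x] by (subst nn_integral_cmult) auto
    also have "\<dots> = ennreal (exp (- z * cosh t + t / 2) / x * (Gamma lam / c powr lam))"
      using x by (intro ennreal_mult'[symmetric]) simp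
    also have "exp (- z * cosh t + t / 2) / x * (Gamma lam / c powr lam)
        = Gamma lam * (x / (2 * \<alpha>)) powr lam / x * exp (- z * cosh t + (1/2 - lam) * t)"
    proof -
      have "c powr lam = (2 * \<alpha> / x) powr lam * exp t powr lam"
        unfolding c_def by (rule powr_mult)
      then have c0: "c powr lam = (2 * \<alpha> / x) powr lam * exp (lam * t)"
        by (simp add: powr_def[of "exp t"])
      have c1: "1 / c powr lam = (x / (2 * \<alpha>)) powr lam * exp (- (lam * t))"
        unfolding c0 using \<alpha> x by (simp add: powr_divide exp_minus field_simps)
      have e1: "exp (- z * cosh t + (1/2 - lam) * t) = exp (- z * cosh t + t / 2) * exp (- (lam * t))"
        by (simp add: mult_exp_exp algebra_simps)
      have "exp (- z * cosh t + t / 2) / x * (Gamma lam / c powr lam)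
          = exp (- z * cosh t + t / 2) / x * Gamma lam * (1 / c powr lam)"
        by simp
      then show ?thesis
        unfolding c1 e1 by (simp add: mult_ac)
    qed
    finally show "(\<integral>\<^sup>+s. ennreal (B s) * indicator {0..} s * ennreal (E s t) \<partial>lborel)
      = ennreal (Gamma lam * (x / (2 * \<alpha>)) powr lam / x) * ennreal (exp (- z * cosh t + (1/2 - lam) * t))"
      using lam x ennreal_mult'[of "Gamma lam * (x / (2 * \<alpha>)) powr lam / x"] by simp
  qed
  also have "\<dots> = ennreal (Gamma lam * (x / (2 * \<alpha>)) powr lam / x) *
      (\<integral>\<^sup>+t. ennreal (exp (- z * cosh t + (1/2 - lam) * t)) \<partial>lborel)"
    by (rule nn_integral_cmult) measurable
  also have "(\<integral>\<^sup>+t. ennreal (exp (- z * cosh t + (1/2 - lam) * t)) \<partial>lborel)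
      = 2 * (\<integral>\<^sup>+t. ennreal (exp (- z * cosh t) * cosh ((lam - 1/2) * t)) * indicator {0..} t \<partial>lborel)"
  proof -
    have "cosh ((1/2 - lam) * t) = cosh ((lam - 1/2) * t)" for t
      using cosh_minus[of "(lam - 1/2) * t"] by (simp add: algebra_simps)
    then show ?thesis by (simp only: nn_integral_bessel_fold)
  qed
  finally have "ennreal (sqrt (2 * pi / z) * exp (- z)) * vg_J lam \<alpha> x
      = ennreal (Gamma lam * (x / (2 * \<alpha>)) powr lam / x) *
        (2 * (\<integral>\<^sup>+t. ennreal (exp (- z * cosh t) * cosh ((lam - 1/2) * t)) * indicator {0..} t \<partial>lborel))"
    by (simp only: 1)
  moreover have "ennreal (2 * Gamma lam * (x / (2 * \<alpha>)) powr lam / x)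
      = ennreal (Gamma lam * (x / (2 * \<alpha>)) powr lam / x) * 2"
  proof -
    have "2 * Gamma lam * (x / (2 * \<alpha>)) powr lam / x = Gamma lam * (x / (2 * \<alpha>)) powr lam / x * 2"
      by simp
    then show ?thesis
      using lam x by (simp only:) (subst ennreal_mult', auto)
  qed
  ultimately show ?thesis
    unfolding z_def by (simp only: mult.assoc mult_minus_left)
qed

section \<open>Watson's lemma with an explicit remainder\<close>

lemma gamma_kernel_bochner:
  fixes c k :: real
  assumes "c > 0" and "k > 0"
  shows "has_bochner_integral lborel (\<lambda>s. indicator {0..} s * (s powr (k - 1) * exp (- c * s))) (Gamma k / c powr k)"
proof (rule has_bochner_integral_nn_integral)
  have "(\<integral>\<^sup>+s. ennreal (indicator {0..} s * (s powr (k - 1) * exp (- c * s))) \<partial>lborel)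
      = (\<integral>\<^sup>+s. ennreal (s powr (k - 1) * exp (- c * s)) * indicator {0..} s \<partial>lborel)"
    by (intro nn_integral_cong) (auto simp: indicator_def)
  then show "(\<integral>\<^sup>+s. ennreal (indicator {0..} s * (s powr (k - 1) * exp (- c * s))) \<partial>lborel)
      = ennreal (Gamma k / c powr k)"
    using nn_integral_gamma_kernel[OF assms] by simp
qed (use assms in auto)

text \<open>In the Lagrange remainder the power (1 + t)^(a - N - 1) is at most 1 because a \<le> N +
  1. The bound is therefore uniform in u \<ge> 0, and the Laplace integral need not be split into a
  part near 0 and a rest.\<close>

lemma binomial_taylor:
  fixes a u :: real
  assumes u: "u \<ge> 0" and a: "a \<le> real (Suc N)"
  shows "\<bar>(1 + u) powr a - (\<Sum>k\<le>N. (a gchoose k) * u ^ k)\<bar> \<le> \<bar>a gchoose Suc N\<bar> * u ^ Suc N"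
proof (cases "u = 0")
  case True
  have "(\<Sum>k\<le>N. (a gchoose k) * 0 ^ k) = 1"
    by (subst sum.remove[of _ 0]) (auto intro: sum.neutral)
  then show ?thesis using True by simp
next
  case False
  define diff where "diff = (\<lambda>n t. (\<Prod>i=0..<n. a - real i) * (1 + t) powr (a - real n))"
  have gch: "(\<Prod>i=0..<n. a - real i) / fact n = a gchoose n" for n
    by (simp add: gbinomial_prod_rev)
  have "\<exists>t>0. t \<le> u \<and> (1 + u) powr a = (\<Sum>m<Suc N. diff m 0 / fact m * u ^ m) + diff (Suc N) t / fact (Suc N) * u ^ Suc N"
  proof (rule Maclaurin2)
    show "diff 0 = (\<lambda>u. (1 + u) powr a)" by (simp add: diff_def)
    show "\<forall>m t. m < Suc N \<and> 0 \<le> t \<and> t \<le> u \<longrightarrow> (diff m has_real_derivative diff (Suc m) t) (at t)"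
      unfolding diff_def
      by (auto intro!: derivative_eq_intros simp: algebra_simps)
  qed (use u False in auto)
  then obtain t where t: "t > 0"
    and eq: "(1 + u) powr a = (\<Sum>m<Suc N. diff m 0 / fact m * u ^ m) + diff (Suc N) t / fact (Suc N) * u ^ Suc N"
    by blast
  have "(\<Sum>m<Suc N. diff m 0 / fact m * u ^ m) = (\<Sum>k\<le>N. (a gchoose k) * u ^ k)"
    unfolding lessThan_Suc_atMost by (simp add: diff_def gch)
  moreover have "diff (Suc N) t / fact (Suc N) = (a gchoose Suc N) * (1 + t) powr (a - real (Suc N))"
    unfolding diff_def gch[symmetric] by simp
  ultimately have "(1 + u) powr a - (\<Sum>k\<le>N. (a gchoose k) * u ^ k)
      = (a gchoose Suc N) * (1 + t) powr (a - real (Suc N)) * u ^ Suc N"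
    using eq by simp
  then have "\<bar>(1 + u) powr a - (\<Sum>k\<le>N. (a gchoose k) * u ^ k)\<bar>
      = \<bar>a gchoose Suc N\<bar> * u ^ Suc N * (1 + t) powr (a - real (Suc N))"
    using u by (simp add: abs_mult)
  also have "(1 + t) powr (a - real (Suc N)) \<le> (1 + t) powr 0"
    using t a by (intro powr_mono) auto
  then have "\<bar>a gchoose Suc N\<bar> * u ^ Suc N * (1 + t) powr (a - real (Suc N)) \<le> \<bar>a gchoose Suc N\<bar> * u ^ Suc N * 1"
    using u t by (intro mult_left_mono) auto
  finally show ?thesis by simp
qed

definition watson_integrand :: "real \<Rightarrow> real \<Rightarrow> real \<Rightarrow> real \<Rightarrow> real" where
  "watson_integrand lam c x s = indicator {0..} s * (s powr (lam - 1) * (1 + s / x) powr (lam - 1) * exp (- c * s))"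

text \<open>The uniform binomial bound at u = s / x is integrated against s^(lam - 1) exp (-c s);
  every term is a Gamma integral. Integrability follows on the way, as the difference from the
  Taylor polynomial is dominated.\<close>

lemma watson:
  assumes lam: "lam > 0" and c: "c > 0" and x: "x > 0" and N: "lam - 1 \<le> real (Suc N)"
  shows "integrable lborel (watson_integrand lam c x)" (is ?int)
    and "\<bar>(\<integral>s. watson_integrand lam c x s \<partial>lborel)
        - (\<Sum>k\<le>N. (lam - 1 gchoose k) * Gamma (lam + real k) / c powr (lam + real k) / x ^ k)\<bar>
      \<le> \<bar>lam - 1 gchoose Suc N\<bar> * Gamma (lam + real (Suc N)) / c powr (lam + real (Suc N)) / x ^ Suc N" (is ?bound)
proof -
  let ?g = "\<lambda>k s. indicator {0..} s * (s powr (lam + real k - 1) * exp (- c * s)) :: real"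
  let ?G = "\<lambda>k. Gamma (lam + real k) / c powr (lam + real k)"
  have g: "has_bochner_integral lborel (?g k) (?G k)" for k
    using lam c by (intro gamma_kernel_bochner) auto
  define T where "T = (\<lambda>s. \<Sum>k\<le>N. (lam - 1 gchoose k) / x ^ k * ?g k s)"
  have T: "has_bochner_integral lborel T (\<Sum>k\<le>N. (lam - 1 gchoose k) / x ^ k * ?G k)"
    unfolding T_def by (intro has_bochner_integral_sum has_bochner_integral_mult_right g)
  define E where "E = (\<lambda>s. \<bar>lam - 1 gchoose Suc N\<bar> / x ^ Suc N * ?g (Suc N) s)"
  have E: "has_bochner_integral lborel E (\<bar>lam - 1 gchoose Suc N\<bar> / x ^ Suc N * ?G (Suc N))"
    unfolding E_def by (intro has_bochner_integral_mult_right g)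
  have [measurable]: "watson_integrand lam c x \<in> borel_measurable borel"
    unfolding watson_integrand_def by measurable
  have bound: "\<bar>watson_integrand lam c x s - T s\<bar> \<le> E s" for s
  proof (cases "s \<ge> 0")
    case True
    have pow: "s powr (lam + real k - 1) = s powr (lam - 1) * s ^ k" for k
      \<comment> \<open>At s = 0 both sides are 0, because \<open>0 powr a\<close> is 0 for every
        exponent.\<close>
      using True by (cases "s = 0"; cases k) (auto simp: powr_add[symmetric] powr_realpow[symmetric] algebra_simps simp del: of_nat_Suc power_Suc)
    have "T s = s powr (lam - 1) * exp (- c * s) * (\<Sum>k\<le>N. (lam - 1 gchoose k) * (s / x) ^ k)"
      using True by (simp add: T_def sum_distrib_left pow power_divide mult_ac)
    then have "watson_integrand lam c x s - T s = s powr (lam - 1) * exp (- c * s) *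
        ((1 + s / x) powr (lam - 1) - (\<Sum>k\<le>N. (lam - 1 gchoose k) * (s / x) ^ k))"
      using True by (simp add: watson_integrand_def right_diff_distrib mult_ac)
    then have "\<bar>watson_integrand lam c x s - T s\<bar> = s powr (lam - 1) * exp (- c * s) *
        \<bar>(1 + s / x) powr (lam - 1) - (\<Sum>k\<le>N. (lam - 1 gchoose k) * (s / x) ^ k)\<bar>"
      by (simp add: abs_mult)
    also have "\<dots> \<le> s powr (lam - 1) * exp (- c * s) * (\<bar>lam - 1 gchoose Suc N\<bar> * (s / x) ^ Suc N)"
      using True x N by (intro mult_left_mono binomial_taylor) auto
    also have "\<dots> = E s"
      using True by (simp add: E_def pow power_divide mult_ac del: power_Suc of_nat_Suc)
    finally show ?thesis .
  qed (simp add: watson_integrand_def T_def E_def)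
  have D: "integrable lborel (\<lambda>s. watson_integrand lam c x s - T s)"
  proof (rule Bochner_Integration.integrable_bound[of _ E])
    show "integrable lborel E" using E by (simp add: has_bochner_integral_iff)
    show "AE s in lborel. norm (watson_integrand lam c x s - T s) \<le> norm (E s)"
      using order.trans[OF bound abs_ge_self] by simp
  qed (use T in \<open>auto simp: has_bochner_integral_iff\<close>)
  have "integrable lborel (\<lambda>s. (watson_integrand lam c x s - T s) + T s)"
    using T by (intro Bochner_Integration.integrable_add D) (auto simp: has_bochner_integral_iff)
  then show int: ?int by simp
  have "norm (\<integral>s. watson_integrand lam c x s - T s \<partial>lborel) \<le> (\<integral>s. E s \<partial>lborel)"
    using E D bound by (intro Bochner_Integration.integral_norm_bound_integral) (auto simp: has_bochner_integral_iff)
  moreover have "(\<integral>s. watson_integrand lam c x s - T s \<partial>lborel)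
      = (\<integral>s. watson_integrand lam c x s \<partial>lborel) - (\<Sum>k\<le>N. (lam - 1 gchoose k) / x ^ k * ?G k)"
    using int T by (simp add: has_bochner_integral_iff)
  ultimately show ?bound
    using E by (simp add: has_bochner_integral_iff mult_ac)
qed

definition vg_W :: "real \<Rightarrow> real \<Rightarrow> real \<Rightarrow> real" where
  "vg_W lam \<alpha> x = (\<integral>s. watson_integrand lam (2 * \<alpha>) x s \<partial>lborel)"

lemma vg_W_nonneg: "vg_W lam \<alpha> x \<ge> 0"
  unfolding vg_W_def by (rule Bochner_Integration.integral_nonneg) (simp add: watson_integrand_def)

lemma nn_integral_interval_nonzero:
  fixes f :: "real \<Rightarrow> ennreal"
  assumes [measurable]: "f \<in> borel_measurable borel" and "a < b" and pos: "\<And>x. a < x \<Longrightarrow> x < b \<Longrightarrow> f x \<noteq> 0"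
  shows "(\<integral>\<^sup>+x. f x \<partial>lborel) \<noteq> 0"
proof
  assume "(\<integral>\<^sup>+x. f x \<partial>lborel) = 0"
  then have "AE x in lborel. f x = 0"
    by (simp add: nn_integral_0_iff_AE)
  then have "AE x in lborel. x \<notin> {a<..<b}"
    by eventually_elim (use pos in auto)
  then have "emeasure lborel {a<..<b} = 0"
    by (subst (asm) AE_iff_measurable[of "{a<..<b}"]) auto
  then show False using \<open>a < b\<close> by simp
qed

lemma watson_integrable:
  assumes "lam > 0" "c > 0" "x > 0"
  shows "integrable lborel (watson_integrand lam c x)"
proof -
  obtain N where "lam \<le> real N" using real_arch_simple by blast
  then show ?thesis using watson(1)[OF assms, of N] by simp
qed

lemma vg_W_pos:
  assumes "lam > 0" "\<alpha> > 0" "x > 0"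
  shows "vg_W lam \<alpha> x > 0"
proof -
  have "(\<integral>\<^sup>+s. ennreal (watson_integrand lam (2 * \<alpha>) x s) \<partial>lborel) \<noteq> 0"
  proof (rule nn_integral_interval_nonzero[of _ 0 1])
    fix s :: real assume "0 < s"
    then have "1 + s / x > 0" using assms by (simp add: add_pos_pos)
    then have "watson_integrand lam (2 * \<alpha>) x s > 0"
      using \<open>0 < s\<close> by (simp add: watson_integrand_def)
    then show "ennreal (watson_integrand lam (2 * \<alpha>) x s) \<noteq> 0" by simp
  qed (simp_all add: watson_integrand_def)
  moreover have "(\<integral>\<^sup>+s. ennreal (watson_integrand lam (2 * \<alpha>) x s) \<partial>lborel) = ennreal (vg_W lam \<alpha> x)"
    unfolding vg_W_def using assms
    by (intro nn_integral_eq_integral watson_integrable) (auto simp: watson_integrand_def)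
  ultimately show ?thesis by (simp add: ennreal_eq_0_iff not_le)
qed

lemma vg_J_eq:
  assumes "lam > 0" "\<alpha> > 0" "x > 0"
  shows "vg_J lam \<alpha> x = ennreal (x powr (lam - 1) * vg_W lam \<alpha> x)"
proof -
  have "vg_J lam \<alpha> x = (\<integral>\<^sup>+s. ennreal (x powr (lam - 1)) * ennreal (watson_integrand lam (2 * \<alpha>) x s) \<partial>lborel)"
    unfolding vg_J_def
  proof (intro nn_integral_cong)
    fix s :: real
    have "(s * (x + s)) powr (lam - 1) = x powr (lam - 1) * (s powr (lam - 1) * (1 + s / x) powr (lam - 1))" if "s \<ge> 0"
    proof -
      have "s * (x + s) = x * (s * (1 + s / x))" using assms by (simp add: field_simps)
      then show ?thesis by (simp only: powr_mult)
    qed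
    then show "ennreal ((s * (x + s)) powr (lam - 1) * exp (- 2 * \<alpha> * s)) * indicator {0..} s
        = ennreal (x powr (lam - 1)) * ennreal (watson_integrand lam (2 * \<alpha>) x s)"
      by (auto simp: watson_integrand_def indicator_def ennreal_mult'[symmetric] mult.assoc)
  qed
  also have "\<dots> = ennreal (x powr (lam - 1)) * (\<integral>\<^sup>+s. ennreal (watson_integrand lam (2 * \<alpha>) x s) \<partial>lborel)"
    by (rule nn_integral_cmult) (simp add: watson_integrand_def)
  also have "(\<integral>\<^sup>+s. ennreal (watson_integrand lam (2 * \<alpha>) x s) \<partial>lborel) = ennreal (vg_W lam \<alpha> x)"
    unfolding vg_W_def using assms
    by (intro nn_integral_eq_integral watson_integrable) (auto simp: watson_integrand_def)
  finally show ?thesis by (simp add: ennreal_mult')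
qed

text \<open>\<open>vg_J_bessel\<close> solved for the Bessel integral. The Bochner integral is
  \<open>enn2real\<close> of the nonnegative one, whose finiteness comes from the finite value of
  \<open>vg_J\<close> in terms of \<open>vg_W\<close>.\<close>

lemma bessel_K_eq:
  assumes lam: "lam > 0" and \<alpha>: "\<alpha> > 0" and x: "x > 0"
  shows "bessel_K (lam - 1/2) (\<alpha> * x) = sqrt (2 * pi / (\<alpha> * x)) * exp (- \<alpha> * x) * (x powr (lam - 1) * vg_W lam \<alpha> x)
    / (2 * Gamma lam * (x / (2 * \<alpha>)) powr lam / x)"
proof -
  let ?A = "sqrt (2 * pi / (\<alpha> * x)) * exp (- \<alpha> * x)" and ?B = "2 * Gamma lam * (x / (2 * \<alpha>)) powr lam / x"
  let ?j = "x powr (lam - 1) * vg_W lam \<alpha> x"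
  define NN where "NN = (\<integral>\<^sup>+t. ennreal (exp (- (\<alpha> * x) * cosh t) * cosh ((lam - 1/2) * t)) * indicator {0..} t \<partial>lborel)"
  have B: "?B > 0" using lam x \<alpha> by simp
  have A: "?A \<ge> 0" using x \<alpha> by simp
  have "ennreal ?A * ennreal ?j = ennreal ?B * NN"
    using vg_J_bessel[OF assms] vg_J_eq[OF assms] by (simp only: NN_def)
  then have "ennreal (1 / ?B) * (ennreal ?A * ennreal ?j) = ennreal (1 / ?B) * (ennreal ?B * NN)"
    by simp
  also have "\<dots> = ennreal (1 / ?B * ?B) * NN"
    using B by (simp only: ennreal_mult' mult.assoc less_imp_le zero_le_divide_1_iff)
  also have "1 / ?B * ?B = 1"
  proof -
    have "1 / b * b = 1" if "b > 0" for b :: real using that by simp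
    then show ?thesis using B .
  qed
  finally have NN: "NN = ennreal (?A * ?j / ?B)"
    using A B by (simp only: ennreal_mult'[symmetric] less_imp_le zero_le_divide_1_iff) (simp add: mult_ac)
  have "bessel_K (lam - 1/2) (\<alpha> * x)
      = enn2real (\<integral>\<^sup>+t. ennreal (indicator {0..} t *\<^sub>R (exp (- (\<alpha> * x) * cosh t) * cosh ((lam - 1/2) * t))) \<partial>lborel)"
    unfolding bessel_K_def set_lebesgue_integral_def
    by (rule integral_eq_nn_integral) (auto simp: cosh_real_nonneg)
  also have "(\<integral>\<^sup>+t. ennreal (indicator {0..} t *\<^sub>R (exp (- (\<alpha> * x) * cosh t) * cosh ((lam - 1/2) * t))) \<partial>lborel) = NN"
    unfolding NN_def by (intro nn_integral_cong) (auto simp: indicator_def)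
  also have "enn2real NN = ?A * ?j / ?B"
    unfolding NN using lam x \<alpha> vg_W_nonneg[of lam \<alpha> x] by (intro enn2real_ennreal divide_nonneg_nonneg mult_nonneg_nonneg) auto
  finally show ?thesis .
qed

lemma vg_density_pos_eq:
  assumes lam: "lam > 0" and \<alpha>: "\<alpha> > 0" and x: "x > 0"
  shows "vg_density lam \<alpha> \<beta> x = vg_gamma \<alpha> \<beta> powr (2 * lam) / (Gamma lam)\<^sup>2
    * (exp (- (\<alpha> - \<beta>) * x) * (x powr (lam - 1) * vg_W lam \<alpha> x))"
proof -
  define j where "j = x powr (lam - 1) * vg_W lam \<alpha> x"
  \<comment> \<open>With the square roots of x and 2 \<alpha> as new letters, the half-integer
    powers become rational and \<open>calc\<close> is an identity of rational expressions.\<close>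
  define r where "r = sqrt x"
  define a where "a = sqrt (2 * \<alpha>)"
  have r: "r > 0" "x = r * r" and a: "a > 0" "2 * \<alpha> = a * a"
    using x \<alpha> by (auto simp: r_def a_def)
  have G: "Gamma lam > 0" using lam by simp
  have 1: "x powr (lam - 1/2) = x powr lam / r" "(2 * \<alpha>) powr (lam - 1/2) = (2 * \<alpha>) powr lam / a"
    using x \<alpha> by (simp_all add: powr_diff powr_half_sqrt r_def a_def)
  have 2: "(x / (2 * \<alpha>)) powr lam = x powr lam / (2 * \<alpha>) powr lam"
    using x \<alpha> by (simp add: powr_divide)
  have 3: "sqrt (2 * pi / (\<alpha> * x)) = 2 * sqrt pi / (a * r)"
  proof -
    have "2 * pi / (\<alpha> * x) = (2 * sqrt pi / (a * r))\<^sup>2"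
    proof -
      have "(2 * sqrt pi / (a * r))\<^sup>2 = 4 * pi / ((a * a) * (r * r))"
        by (simp add: power2_eq_square)
      also have "\<dots> = 4 * pi / (2 * \<alpha> * x)" by (simp only: a r)
      finally show ?thesis by simp
    qed
    then show ?thesis using a r by (simp only: real_sqrt_abs) simp
  qed
  have e: "exp (- \<alpha> * x) * exp (\<beta> * x) = exp (- (\<alpha> - \<beta>) * x)"
    by (simp add: mult_exp_exp algebra_simps)
  have calc: "g / (A / a * p * G) * (X / r) * (2 * p / (a * r) * E * j / (2 * G * (X / A) / (r * r))) * E'
      = g / G\<^sup>2 * (E * E' * j)"
    if "A > 0" "X > 0" "G > 0" "p > 0" for g A p G X E E' :: real
    using that a r by (simp add: field_simps power2_eq_square)
  have rr: "r * r = x" using r by simp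
  have bK: "bessel_K (lam - 1/2) (\<alpha> * x) = 2 * sqrt pi / (a * r) * exp (- \<alpha> * x) * j
      / (2 * Gamma lam * (x powr lam / (2 * \<alpha>) powr lam) / x)"
    by (simp only: bessel_K_eq[OF assms] 2 3 j_def)
  have "\<bar>x\<bar> = x" using x by simp
  then have "vg_density lam \<alpha> \<beta> x = vg_gamma \<alpha> \<beta> powr (2 * lam) / ((2 * \<alpha>) powr lam / a * sqrt pi * Gamma lam)
     * (x powr lam / r) * (2 * sqrt pi / (a * r) * exp (- \<alpha> * x) * j
        / (2 * Gamma lam * (x powr lam / (2 * \<alpha>) powr lam) / x)) * exp (\<beta> * x)"
    by (simp only: vg_density_def 1 bK)
  also have "\<dots> = vg_gamma \<alpha> \<beta> powr (2 * lam) / (Gamma lam)\<^sup>2 * (exp (- \<alpha> * x) * exp (\<beta> * x) * j)"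
    by (rule calc[unfolded rr]) (use x \<alpha> G in auto)
  finally show ?thesis by (simp only: e j_def mult.assoc)
qed

section \<open>Reflection, convolution form and total mass of the density\<close>

lemma vg_density_minus: "vg_density lam \<alpha> \<beta> (- x) = vg_density lam \<alpha> (- \<beta>) x"
  by (simp add: vg_density_def vg_gamma_def)

lemma vg_density_measurable [measurable]: "vg_density lam \<alpha> \<beta> \<in> borel_measurable borel"
proof -
  have [measurable]: "(\<lambda>x. bessel_K \<nu> x) \<in> borel_measurable borel" for \<nu>
    unfolding bessel_K_def set_lebesgue_integral_def by measurable
  show ?thesis unfolding vg_density_def by measurable
qed

definition gamma_kernel :: "real \<Rightarrow> real \<Rightarrow> real \<Rightarrow> ennreal" where
  "gamma_kernel lam d s = ennreal (s powr (lam - 1) * exp (- d * s)) * indicator {0..} s"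

lemma gamma_kernel_measurable [measurable]: "gamma_kernel lam d \<in> borel_measurable borel"
  unfolding gamma_kernel_def by measurable

lemma nn_integral_gamma_kernel':
  "lam > 0 \<Longrightarrow> d > 0 \<Longrightarrow> (\<integral>\<^sup>+s. gamma_kernel lam d s \<partial>lborel) = ennreal (Gamma lam / d powr lam)"
  unfolding gamma_kernel_def by (rule nn_integral_gamma_kernel)

text \<open>The exponents add up to -(\<alpha> - \<beta>) x - 2 \<alpha> s, which leaves
  \<open>vg_J\<close>; for x > 0 the indicator of the first kernel is 1 wherever that of the second
  is.\<close>

lemma vg_density_convolution_pos:
  assumes "lam > 0" "\<alpha> > 0" "x > 0"
  shows "ennreal (vg_density lam \<alpha> \<beta> x) = ennreal (vg_gamma \<alpha> \<beta> powr (2 * lam) / (Gamma lam)\<^sup>2)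
    * (\<integral>\<^sup>+s. gamma_kernel lam (\<alpha> - \<beta>) (x + s) * gamma_kernel lam (\<alpha> + \<beta>) s \<partial>lborel)"
proof -
  have "(\<integral>\<^sup>+s. gamma_kernel lam (\<alpha> - \<beta>) (x + s) * gamma_kernel lam (\<alpha> + \<beta>) s \<partial>lborel)
      = (\<integral>\<^sup>+s. ennreal (exp (- (\<alpha> - \<beta>) * x)) * (ennreal ((s * (x + s)) powr (lam - 1) * exp (- 2 * \<alpha> * s)) * indicator {0..} s) \<partial>lborel)"
  proof (intro nn_integral_cong)
    fix s :: real
    have "((x + s) powr (lam - 1) * exp (- (\<alpha> - \<beta>) * (x + s))) * (s powr (lam - 1) * exp (- (\<alpha> + \<beta>) * s))
        = exp (- (\<alpha> - \<beta>) * x) * ((s * (x + s)) powr (lam - 1) * exp (- 2 * \<alpha> * s))"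
    proof -
      have "exp (- (\<alpha> - \<beta>) * (x + s)) * exp (- (\<alpha> + \<beta>) * s) = exp (- (\<alpha> - \<beta>) * x) * exp (- 2 * \<alpha> * s)"
        by (simp add: mult_exp_exp algebra_simps)
      then show ?thesis by (simp add: powr_mult mult_ac)
    qed
    then show "gamma_kernel lam (\<alpha> - \<beta>) (x + s) * gamma_kernel lam (\<alpha> + \<beta>) s
        = ennreal (exp (- (\<alpha> - \<beta>) * x)) * (ennreal ((s * (x + s)) powr (lam - 1) * exp (- 2 * \<alpha> * s)) * indicator {0..} s)"
      using assms by (cases "s \<ge> 0") (auto simp: gamma_kernel_def ennreal_mult'[symmetric])
  qed
  also have "\<dots> = ennreal (exp (- (\<alpha> - \<beta>) * x)) * vg_J lam \<alpha> x"
    unfolding vg_J_def by (rule nn_integral_cmult) measurable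
  also have "\<dots> = ennreal (exp (- (\<alpha> - \<beta>) * x) * (x powr (lam - 1) * vg_W lam \<alpha> x))"
    using assms by (simp add: vg_J_eq ennreal_mult')
  finally show ?thesis
    using assms by (simp add: vg_density_pos_eq ennreal_mult'[symmetric])
qed

text \<open>For x < 0, reflection exchanges \<beta> and -\<beta>, and the translation of s by x
  exchanges the two kernels. At x = 0 the density is 0 by the convention for
  \<open>0 powr a\<close>, hence the exclusion.\<close>

lemma vg_density_convolution:
  assumes "lam > 0" "\<alpha> > 0" "x \<noteq> 0"
  shows "ennreal (vg_density lam \<alpha> \<beta> x) = ennreal (vg_gamma \<alpha> \<beta> powr (2 * lam) / (Gamma lam)\<^sup>2)
    * (\<integral>\<^sup>+s. gamma_kernel lam (\<alpha> - \<beta>) (x + s) * gamma_kernel lam (\<alpha> + \<beta>) s \<partial>lborel)"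
proof (cases "x > 0")
  case False
  with assms have "- x > 0" by simp
  have "ennreal (vg_density lam \<alpha> \<beta> x) = ennreal (vg_density lam \<alpha> (- \<beta>) (- x))"
    using vg_density_minus[of lam \<alpha> \<beta> "-x"] by simp
  also have "\<dots> = ennreal (vg_gamma \<alpha> \<beta> powr (2 * lam) / (Gamma lam)\<^sup>2)
    * (\<integral>\<^sup>+s. gamma_kernel lam (\<alpha> + \<beta>) (- x + s) * gamma_kernel lam (\<alpha> - \<beta>) s \<partial>lborel)"
    using vg_density_convolution_pos[OF assms(1,2) \<open>- x > 0\<close>, of "- \<beta>"] by (simp add: vg_gamma_def)
  also have "(\<integral>\<^sup>+s. gamma_kernel lam (\<alpha> + \<beta>) (- x + s) * gamma_kernel lam (\<alpha> - \<beta>) s \<partial>lborel)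
      = (\<integral>\<^sup>+s. gamma_kernel lam (\<alpha> - \<beta>) (x + s) * gamma_kernel lam (\<alpha> + \<beta>) s \<partial>lborel)"
    by (subst nn_integral_real_affine[where c = 1 and t = x]) (auto simp: mult.commute)
  finally show ?thesis .
qed (use vg_density_convolution_pos assms in simp)

lemma vg_density_nonneg:
  assumes "lam > 0" "\<alpha> > 0"
  shows "vg_density lam \<alpha> \<beta> x \<ge> 0"
proof -
  have "bessel_K \<nu> t \<ge> 0" for \<nu> t
    unfolding bessel_K_def set_lebesgue_integral_def
    by (rule Bochner_Integration.integral_nonneg) (auto simp: cosh_real_nonneg)
  then show ?thesis using assms by (simp add: vg_density_def)
qed

lemma vg_gamma_powr:
  assumes "\<bar>\<beta>\<bar> < \<alpha>"
  shows "vg_gamma \<alpha> \<beta> powr (2 * lam) = (\<alpha> - \<beta>) powr lam * (\<alpha> + \<beta>) powr lam"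
proof -
  have *: "\<alpha>\<^sup>2 - \<beta>\<^sup>2 = (\<alpha> - \<beta>) * (\<alpha> + \<beta>)" by (simp add: power2_eq_square algebra_simps)
  have nonneg: "0 \<le> (\<alpha> - \<beta>) * (\<alpha> + \<beta>)"
    using assms by (intro mult_nonneg_nonneg) auto
  have "vg_gamma \<alpha> \<beta> powr (2 * lam) = ((vg_gamma \<alpha> \<beta>)\<^sup>2) powr lam"
    by (simp add: powr_powr[symmetric] powr_numeral vg_gamma_def * nonneg)
  also have "(vg_gamma \<alpha> \<beta>)\<^sup>2 = (\<alpha> - \<beta>) * (\<alpha> + \<beta>)"
    using assms by (simp add: vg_gamma_def *)
  finally show ?thesis by (simp add: powr_mult)
qed

text \<open>The distribution is that of the difference of two independent Gamma variables.\<close>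
lemma vg_density_total:
  assumes lam: "lam > 0" and \<alpha>: "\<alpha> > 0" and \<beta>: "\<bar>\<beta>\<bar> < \<alpha>"
  shows "(\<integral>\<^sup>+x. ennreal (vg_density lam \<alpha> \<beta> x) \<partial>lborel) = 1"
proof -
  let ?g1 = "gamma_kernel lam (\<alpha> - \<beta>)" and ?g2 = "gamma_kernel lam (\<alpha> + \<beta>)"
  let ?C = "vg_gamma \<alpha> \<beta> powr (2 * lam) / (Gamma lam)\<^sup>2"
  have "(\<integral>\<^sup>+x. ennreal (vg_density lam \<alpha> \<beta> x) \<partial>lborel) = (\<integral>\<^sup>+x. ennreal ?C * (\<integral>\<^sup>+s. ?g1 (x + s) * ?g2 s \<partial>lborel) \<partial>lborel)"
  proof (rule nn_integral_cong_AE)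
    show "AE x in lborel. ennreal (vg_density lam \<alpha> \<beta> x) = ennreal ?C * (\<integral>\<^sup>+s. ?g1 (x + s) * ?g2 s \<partial>lborel)"
      using AE_lborel_singleton[of 0] by eventually_elim (rule vg_density_convolution[OF lam \<alpha>])
  qed
  also have "\<dots> = ennreal ?C * (\<integral>\<^sup>+x. \<integral>\<^sup>+s. ?g1 (x + s) * ?g2 s \<partial>lborel \<partial>lborel)"
    by (rule nn_integral_cmult) measurable
  also have "(\<integral>\<^sup>+x. \<integral>\<^sup>+s. ?g1 (x + s) * ?g2 s \<partial>lborel \<partial>lborel) = (\<integral>\<^sup>+s. \<integral>\<^sup>+x. ?g1 (x + s) * ?g2 s \<partial>lborel \<partial>lborel)"
    by (rule lborel_pair.Fubini') measurable
  also have "\<dots> = (\<integral>\<^sup>+s. ennreal (Gamma lam / (\<alpha> - \<beta>) powr lam) * ?g2 s \<partial>lborel)"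
  proof (intro nn_integral_cong)
    fix s :: real
    have "(\<integral>\<^sup>+x. ?g1 (x + s) * ?g2 s \<partial>lborel) = (\<integral>\<^sup>+x. ?g1 (x + s) \<partial>lborel) * ?g2 s"
      by (rule nn_integral_multc) measurable
    also have "(\<integral>\<^sup>+x. ?g1 (x + s) \<partial>lborel) = (\<integral>\<^sup>+x. ?g1 x \<partial>lborel)"
      by (subst (2) nn_integral_real_affine[where c = 1 and t = s]) (auto simp: add.commute)
    also have "\<dots> = ennreal (Gamma lam / (\<alpha> - \<beta>) powr lam)"
      using lam \<beta> by (intro nn_integral_gamma_kernel') auto
    finally show "(\<integral>\<^sup>+x. ?g1 (x + s) * ?g2 s \<partial>lborel) = ennreal (Gamma lam / (\<alpha> - \<beta>) powr lam) * ?g2 s" .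
  qed
  also have "\<dots> = ennreal (Gamma lam / (\<alpha> - \<beta>) powr lam) * (\<integral>\<^sup>+s. ?g2 s \<partial>lborel)"
    by (rule nn_integral_cmult) measurable
  also have "(\<integral>\<^sup>+s. ?g2 s \<partial>lborel) = ennreal (Gamma lam / (\<alpha> + \<beta>) powr lam)"
    using lam \<beta> by (intro nn_integral_gamma_kernel') auto
  also have "ennreal ?C * (ennreal (Gamma lam / (\<alpha> - \<beta>) powr lam) * ennreal (Gamma lam / (\<alpha> + \<beta>) powr lam))
      = ennreal (?C * (Gamma lam / (\<alpha> - \<beta>) powr lam * (Gamma lam / (\<alpha> + \<beta>) powr lam)))"
  proof -
    have "ennreal c * (ennreal u * ennreal v) = ennreal (c * (u * v))" if "c \<ge> 0" "u \<ge> 0" for c u v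
      using that by (simp add: ennreal_mult')
    then show ?thesis using lam by simp
  qed
  also have "?C * (Gamma lam / (\<alpha> - \<beta>) powr lam * (Gamma lam / (\<alpha> + \<beta>) powr lam)) = 1"
  proof -
    have "Gamma lam > 0" "(\<alpha> - \<beta>) powr lam > 0" "(\<alpha> + \<beta>) powr lam > 0" using lam \<beta> by auto
    then show ?thesis unfolding vg_gamma_powr[OF \<beta>] by (simp add: power2_eq_square)
  qed
  finally show ?thesis by simp
qed

section \<open>Distribution function, tail and quantiles\<close>

text \<open>Both sides have the same ratio of consecutive terms. This identifies the coefficients
  produced by Watson's lemma with the Hankel coefficients of the statement.\<close>

lemma hankel_a_gbinomial:
  assumes "lam > 0"
  shows "hankel_a k (lam - 1/2) = (lam - 1 gchoose k) * Gamma (lam + real k) / (Gamma lam * 2 ^ k)"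
proof (induction k)
  case 0
  then show ?case using Gamma_real_pos[OF assms] by (simp add: hankel_a_def)
next
  case (Suc k)
  have "(lam - 1 gchoose Suc k) = (lam - 1 gchoose k) * (lam - 1 - real k) / real (Suc k)"
    by (simp add: gbinomial_prod_rev field_simps del: of_nat_Suc)
  moreover have "Gamma (lam + real (Suc k)) = (lam + real k) * Gamma (lam + real k)"
    using assms Gamma_plus1[of "lam + real k"] nonpos_Ints_nonpos[of "lam + real k"] by (auto simp: add_ac)
  ultimately show ?case
    by (simp only: hankel_a_Suc Suc) (simp add: mult_ac del: of_nat_Suc)
qed

text \<open>The factor of 1 - u in \<open>vg_v\<close>. It scales the density so that its expansion
  at infinity has leading coefficient 1.\<close>

definition vg_const :: "real \<Rightarrow> real \<Rightarrow> real \<Rightarrow> real" where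
  "vg_const lam \<alpha> \<beta> = (2 * \<alpha>) powr lam * Gamma lam / vg_gamma \<alpha> \<beta> powr (2 * lam)"

section \<open>Positivity and expansion of the density\<close>

locale variance_gamma =
  fixes lam \<alpha> \<beta> :: real
  assumes lam: "lam > 0" and \<alpha>: "\<alpha> > 0" and \<beta>: "\<bar>\<beta>\<bar> < \<alpha>"
begin

abbreviation \<delta> :: real where "\<delta> \<equiv> \<alpha> - \<beta>"

lemma \<delta>_pos: "\<delta> > 0" and \<beta>_less: "\<beta> < \<alpha>"
  using \<beta> by auto

lemma vg_gamma_pos: "vg_gamma \<alpha> \<beta> > 0"
  using abs_square_less_1[of "\<beta> / \<alpha>"] \<beta> \<alpha> by (simp add: vg_gamma_def power_divide divide_simps)

lemma vg_const_pos: "vg_const lam \<alpha> \<beta> > 0"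
  using lam \<alpha> vg_gamma_pos by (simp add: vg_const_def)

abbreviation "f \<equiv> vg_density lam \<alpha> \<beta>"
abbreviation "h x \<equiv> vg_const lam \<alpha> \<beta> * f x"
abbreviation "b \<equiv> vg_b lam \<alpha> \<beta>"

lemma f_pos: "x \<noteq> 0 \<Longrightarrow> f x > 0"
proof -
  have *: "vg_density lam \<alpha> \<beta>' x > 0" if "x > 0" "\<bar>\<beta>'\<bar> < \<alpha>" for \<beta>' x
  proof -
    interpret v: variance_gamma lam \<alpha> \<beta>' using lam \<alpha> that by unfold_locales
    show ?thesis
      unfolding vg_density_pos_eq[OF lam \<alpha> that(1)]
      using vg_W_pos[OF lam \<alpha> that(1)] v.vg_gamma_pos Gamma_real_pos[OF lam] that
      by (intro mult_pos_pos divide_pos_pos) auto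
  qed
  assume "x \<noteq> 0"
  then show ?thesis
    using *[of x \<beta>] *[of "-x" "-\<beta>"] \<beta> vg_density_minus[of lam \<alpha> \<beta> "-x"] by (cases "x > 0") auto
qed

lemma f_nonneg: "f x \<ge> 0"
  using lam \<alpha> by (rule vg_density_nonneg)

text \<open>Watson's lemma times its prefactor. The error has the shape x^p exp (-\<delta> x) and is
  bounded for every x > 0, so it can be integrated over a half line; lam \<le> N ensures that p is
  negative.\<close>

lemma h_asymptotics:
  assumes N: "lam \<le> real N"
  obtains C where "C \<ge> 0" and "\<And>x. x > 0 \<Longrightarrow>
    \<bar>h x - exp (- \<delta> * x) * (\<Sum>k\<le>N. hankel_a k (lam - 1/2) / \<alpha> ^ k * x powr (lam - 1 - real k))\<bar>
      \<le> C * (x powr (lam - 2 - real N) * exp (- \<delta> * x))"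
proof -
  define K where "K = (2 * \<alpha>) powr lam / Gamma lam"
  have K: "K > 0" using lam \<alpha> by (simp add: K_def)
  define B where "B = \<bar>lam - 1 gchoose Suc N\<bar> * Gamma (lam + real (Suc N)) / (2 * \<alpha>) powr (lam + real (Suc N))"
  have B: "B \<ge> 0" using lam by (simp add: B_def)
  have "\<bar>h x - exp (- \<delta> * x) * (\<Sum>k\<le>N. hankel_a k (lam - 1/2) / \<alpha> ^ k * x powr (lam - 1 - real k))\<bar>
      \<le> K * B * (x powr (lam - 2 - real N) * exp (- \<delta> * x))" if x: "x > 0" for x
  proof -
    let ?S = "\<Sum>k\<le>N. (lam - 1 gchoose k) * Gamma (lam + real k) / (2 * \<alpha>) powr (lam + real k) / x ^ k"
    have pow: "x powr (lam - 1 - real k) = x powr (lam - 1) / x ^ k" for k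
      using x by (simp add: powr_diff powr_realpow)
    have "h x = K * (exp (- \<delta> * x) * (x powr (lam - 1) * vg_W lam \<alpha> x))"
      using vg_gamma_pos lam
      by (simp add: vg_density_pos_eq[OF lam \<alpha> x] vg_const_def K_def power2_eq_square)
    moreover have "exp (- \<delta> * x) * (\<Sum>k\<le>N. hankel_a k (lam - 1/2) / \<alpha> ^ k * x powr (lam - 1 - real k))
        = K * (exp (- \<delta> * x) * (x powr (lam - 1) * ?S))"
      unfolding sum_distrib_left
    proof (intro sum.cong refl)
      fix k
      have "(2 * \<alpha>) powr (lam + real k) = (2 * \<alpha>) powr lam * (2 * \<alpha>) ^ k"
        using \<alpha> by (simp add: powr_add powr_realpow)
      then show "exp (- \<delta> * x) * (hankel_a k (lam - 1/2) / \<alpha> ^ k * x powr (lam - 1 - real k))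
        = K * (exp (- \<delta> * x) * (x powr (lam - 1) *
            ((lam - 1 gchoose k) * Gamma (lam + real k) / (2 * \<alpha>) powr (lam + real k) / x ^ k)))"
        using \<alpha> by (simp add: pow hankel_a_gbinomial[OF lam] K_def power_mult_distrib mult_ac)
    qed
    ultimately have "h x - exp (- \<delta> * x) * (\<Sum>k\<le>N. hankel_a k (lam - 1/2) / \<alpha> ^ k * x powr (lam - 1 - real k))
        = K * exp (- \<delta> * x) * x powr (lam - 1) * (vg_W lam \<alpha> x - ?S)"
      by (simp add: right_diff_distrib mult.assoc)
    then have "\<bar>h x - exp (- \<delta> * x) * (\<Sum>k\<le>N. hankel_a k (lam - 1/2) / \<alpha> ^ k * x powr (lam - 1 - real k))\<bar>
        = K * exp (- \<delta> * x) * x powr (lam - 1) * \<bar>vg_W lam \<alpha> x - ?S\<bar>"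
      using K by (simp add: abs_mult)
    also have "\<dots> \<le> K * exp (- \<delta> * x) * x powr (lam - 1) * (B / x ^ Suc N)"
      unfolding vg_W_def B_def using watson(2)[OF lam _ x, of "2 * \<alpha>" N] \<alpha> N K
      by (intro mult_left_mono) auto
    also have "\<dots> = K * B * (x powr (lam - 1 - real (Suc N)) * exp (- \<delta> * x))"
      by (simp add: pow mult_ac del: power_Suc of_nat_Suc)
    also have "lam - 1 - real (Suc N) = lam - 2 - real N" by simp
    finally show ?thesis .
  qed
  then show ?thesis using that[of "K * B"] K B by auto
qed

section \<open>The candidate for the tail and its derivative\<close>

lemma powr_exp_deriv:
  assumes "x > 0"
  shows "((\<lambda>x. x powr p * exp (- d * x)) has_real_derivative (p * x powr (p - 1) - d * x powr p) * exp (- d * x)) (at x)"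
  using assms by (auto intro!: derivative_eq_intros simp: algebra_simps)

lemma powr_exp_tendsto: "d > 0 \<Longrightarrow> ((\<lambda>x::real. x powr p * exp (- d * x)) \<longlongrightarrow> 0) at_top"
  by real_asymp

definition main_term :: "nat \<Rightarrow> real \<Rightarrow> real" where
  "main_term N x = (\<Sum>k\<le>N. b k * (x powr (lam - 1 - real k) * exp (- \<delta> * x)))"

definition main_deriv :: "nat \<Rightarrow> real \<Rightarrow> real" where
  "main_deriv N x = (\<Sum>k\<le>N. b k * (((lam - 1 - real k) * x powr (lam - 1 - real k - 1)
     - \<delta> * x powr (lam - 1 - real k)) * exp (- \<delta> * x)))"

lemma main_term_deriv: "x > 0 \<Longrightarrow> (main_term N has_real_derivative main_deriv N x) (at x)"
  unfolding main_term_def main_deriv_def by (intro DERIV_sum DERIV_cmult powr_exp_deriv)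

lemma main_term_tendsto: "(main_term N \<longlongrightarrow> 0) at_top"
proof -
  have "((\<lambda>x. \<Sum>k\<le>N. b k * (x powr (lam - 1 - real k) * exp (- \<delta> * x))) \<longlongrightarrow> (\<Sum>k\<le>N. b k * 0)) at_top"
    by (intro tendsto_sum tendsto_mult tendsto_const powr_exp_tendsto \<delta>_pos)
  then show ?thesis by (simp add: main_term_def[abs_def])
qed

text \<open>The recurrence of the \<open>b\<^sub>k\<close> makes the sum telescope.\<close>
lemma main_deriv_eq:
  "main_deriv N x = - exp (- \<delta> * x) * (\<Sum>k\<le>N. hankel_a k (lam - 1/2) / \<alpha> ^ k * x powr (lam - 1 - real k))
     + (lam - 1 - real N) * b N * (x powr (lam - 2 - real N) * exp (- \<delta> * x))"
proof (induction N)
  case 0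
  have "1 / d * ((c * Y - d * X) * E) = - E * X + c * (1 / d) * (Y * E)" if "d \<noteq> 0" for c d E X Y :: real
    using that by (simp add: field_simps)
  from this[of \<delta> "lam - 1" "x powr (lam - 2)" "x powr (lam - 1)" "exp (- \<delta> * x)"] show ?case
    using \<delta>_pos by (simp add: main_deriv_def vg_b_0 hankel_a_def)
next
  case (Suc N)
  have "main_deriv (Suc N) x = main_deriv N x + b (Suc N) * (((lam - 1 - real (Suc N)) * x powr (lam - 1 - real (Suc N) - 1)
     - \<delta> * x powr (lam - 1 - real (Suc N))) * exp (- \<delta> * x))"
    by (simp add: main_deriv_def)
  also have "\<dots> = main_deriv N x + ((lam - 1 - real (Suc N)) * b (Suc N) * (x powr (lam - 2 - real (Suc N)) * exp (- \<delta> * x))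
      - (\<delta> * b (Suc N)) * (x powr (lam - 2 - real N) * exp (- \<delta> * x)))"
  proof -
    have "lam - 1 - real (Suc N) - 1 = lam - 2 - real (Suc N)" "lam - 1 - real (Suc N) = lam - 2 - real N"
      by simp_all
    then show ?thesis by (simp only: right_diff_distrib left_diff_distrib mult_ac)
  qed
  \<comment> \<open>The part of this containing \<open>b N\<close> cancels the boundary term left
    over from order N; the part containing \<open>hankel_a\<close> is the next term of the
    density.\<close>
  also have "\<delta> * b (Suc N) = hankel_a (Suc N) (lam - 1/2) / \<alpha> ^ Suc N + (lam - 1 - real N) * b N"
    using vg_b_Suc[OF \<beta>_less, of lam N] by simp
  finally have *: "main_deriv (Suc N) x = main_deriv N x
      + ((lam - 1 - real (Suc N)) * b (Suc N) * (x powr (lam - 2 - real (Suc N)) * exp (- \<delta> * x))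
      - (hankel_a (Suc N) (lam - 1/2) / \<alpha> ^ Suc N + (lam - 1 - real N) * b N) * (x powr (lam - 2 - real N) * exp (- \<delta> * x)))" .
  have "lam - 1 - real (Suc N) = lam - 2 - real N" by simp
  then have "(\<Sum>k\<le>Suc N. hankel_a k (lam - 1/2) / \<alpha> ^ k * x powr (lam - 1 - real k))
      = (\<Sum>k\<le>N. hankel_a k (lam - 1/2) / \<alpha> ^ k * x powr (lam - 1 - real k))
        + hankel_a (Suc N) (lam - 1/2) / \<alpha> ^ Suc N * x powr (lam - 2 - real N)"
    by (simp only: sum.atMost_Suc)
  then show ?case
    unfolding * Suc by (simp only: distrib_left distrib_right mult_minus_left mult_ac)
qed

section \<open>The distribution function and its tail\<close>

definition V :: "real \<Rightarrow> real" where
  "V x = vg_const lam \<alpha> \<beta> * (1 - vg_cdf lam \<alpha> \<beta> x)"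

text \<open>Seen as a measure, the law inherits limits, bounds and continuity from
  \<open>cdf\<close>.\<close>

definition M :: "real measure" where "M = density lborel (\<lambda>x. ennreal (f x))"

lemma space_M [simp]: "space M = UNIV" and sets_M [simp, measurable_cong]: "sets M = sets borel"
  by (simp_all add: M_def)

sublocale M: real_distribution M
proof -
  have "emeasure M UNIV = 1"
    using vg_density_total[OF lam \<alpha> \<beta>] by (simp add: M_def emeasure_density)
  then show "real_distribution M"
    by (intro real_distribution.intro prob_spaceI real_distribution_axioms.intro) (simp_all)
qed

lemma emeasure_M: "A \<in> sets borel \<Longrightarrow> emeasure M A = (\<integral>\<^sup>+x. ennreal (f x) * indicator A x \<partial>lborel)"
  by (simp add: M_def emeasure_density)

lemma vg_cdf_eq: "vg_cdf lam \<alpha> \<beta> = cdf M"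
proof
  fix x
  have "vg_cdf lam \<alpha> \<beta> x = enn2real (\<integral>\<^sup>+t. ennreal (indicator {..x} t *\<^sub>R f t) \<partial>lborel)"
    unfolding vg_cdf_def set_lebesgue_integral_def
    by (rule integral_eq_nn_integral) (auto simp: f_nonneg)
  also have "(\<integral>\<^sup>+t. ennreal (indicator {..x} t *\<^sub>R f t) \<partial>lborel) = emeasure M {..x}"
    by (subst emeasure_M) (auto intro!: nn_integral_cong simp: indicator_def)
  finally show "vg_cdf lam \<alpha> \<beta> x = cdf M x"
    by (simp add: cdf_def measure_def)
qed

lemma M_singleton: "measure M {x} = 0"
proof -
  have "emeasure M {x} = 0"
    by (simp add: emeasure_M nn_integral_0_iff_AE)
  then show ?thesis by (simp add: measure_def)
qed

lemma cdf_isCont: "isCont (vg_cdf lam \<alpha> \<beta>) x"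
  by (simp add: vg_cdf_eq M.isCont_cdf M_singleton)

lemma cdf_strict_mono: "strict_mono (vg_cdf lam \<alpha> \<beta>)"
proof (rule strict_monoI)
  fix x y :: real assume xy: "x < y"
  \<comment> \<open>Positivity of \<open>f\<close> is known only away from 0, so (x, y] is shrunk to
    an interval (x, d) that avoids 0.\<close>
  define d where "d = (if x < 0 then min y 0 else y)"
  have "x < d" "d \<le> y" and nz: "\<And>t. x < t \<Longrightarrow> t < d \<Longrightarrow> t \<noteq> 0"
    using xy by (auto simp: d_def)
  have "(\<integral>\<^sup>+t. ennreal (f t) * indicator {x<..y} t \<partial>lborel) \<noteq> 0"
    using \<open>x < d\<close> \<open>d \<le> y\<close> nz f_pos
    by (intro nn_integral_interval_nonzero[of _ x d]) (auto simp: indicator_def ennreal_eq_0_iff not_le)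
  then have "emeasure M {x<..y} \<noteq> 0" by (simp add: emeasure_M)
  then have "measure M {x<..y} \<noteq> 0" by (simp add: M.emeasure_eq_measure)
  then have "measure M {x<..y} > 0" by (simp add: zero_less_measure_iff)
  then show "vg_cdf lam \<alpha> \<beta> x < vg_cdf lam \<alpha> \<beta> y"
    using M.cdf_diff_eq[OF xy] by (simp add: vg_cdf_eq)
qed

lemma cdf_bounds: "0 < vg_cdf lam \<alpha> \<beta> x" "vg_cdf lam \<alpha> \<beta> x < 1"
proof -
  have "vg_cdf lam \<alpha> \<beta> (x - 1) < vg_cdf lam \<alpha> \<beta> x" "vg_cdf lam \<alpha> \<beta> x < vg_cdf lam \<alpha> \<beta> (x + 1)"
    using cdf_strict_mono by (simp_all add: strict_mono_def)
  moreover have "vg_cdf lam \<alpha> \<beta> (x - 1) \<ge> 0" "vg_cdf lam \<alpha> \<beta> (x + 1) \<le> 1"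
    by (simp_all add: vg_cdf_eq M.cdf_nonneg M.cdf_bounded_prob)
  ultimately show "0 < vg_cdf lam \<alpha> \<beta> x" "vg_cdf lam \<alpha> \<beta> x < 1" by linarith+
qed

lemma V_pos: "V x > 0"
  using vg_const_pos cdf_bounds(2)[of x] by (simp add: V_def)

lemma V_nn_integral: "(\<integral>\<^sup>+t. ennreal (h t) * indicator {x..} t \<partial>lborel) = ennreal (V x)"
proof -
  have "(\<integral>\<^sup>+t. ennreal (h t) * indicator {x..} t \<partial>lborel)
      = (\<integral>\<^sup>+t. ennreal (vg_const lam \<alpha> \<beta>) * (ennreal (f t) * indicator {x..} t) \<partial>lborel)"
    using vg_const_pos by (intro nn_integral_cong) (simp add: ennreal_mult' mult.assoc)
  also have "\<dots> = ennreal (vg_const lam \<alpha> \<beta>) * emeasure M {x..}"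
    by (subst nn_integral_cmult) (auto simp: emeasure_M)
  also have "emeasure M {x..} = ennreal (measure M {x..})"
    by (rule M.emeasure_eq_measure)
  also have "measure M {x..} = measure M (space M - {..x}) + measure M {x}"
    by (subst M.finite_measure_Union[symmetric]) (auto intro!: arg_cong[of _ _ "measure M"])
  also have "\<dots> = 1 - vg_cdf lam \<alpha> \<beta> x"
    by (subst M.prob_compl) (auto simp: M_singleton vg_cdf_eq cdf_def)
  finally show ?thesis
    using vg_const_pos by (simp add: V_def ennreal_mult')
qed

text \<open>Comparing derivatives: \<open>main_term \<plusminus> K x\<^sup>p exp (-\<delta> x)\<close> with \<open>p \<le> 0\<close> are super- and subsolutions.\<close>
lemma V_main_term:
  assumes N: "lam \<le> real N"
  obtains K where "\<And>x. x > 0 \<Longrightarrow> \<bar>V x - main_term N x\<bar> \<le> K * (x powr (lam - 2 - real N) * exp (- \<delta> * x))"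
proof -
  obtain C where C: "C \<ge> 0" and hC: "\<And>x. x > 0 \<Longrightarrow>
    \<bar>h x - exp (- \<delta> * x) * (\<Sum>k\<le>N. hankel_a k (lam - 1/2) / \<alpha> ^ k * x powr (lam - 1 - real k))\<bar>
      \<le> C * (x powr (lam - 2 - real N) * exp (- \<delta> * x))"
    using h_asymptotics[OF N] by blast
  define p where "p = lam - 2 - real N"
  have p: "p \<le> 0" using N by (simp add: p_def)
  let ?e = "\<lambda>x. x powr p * exp (- \<delta> * x)"
  let ?e' = "\<lambda>x. (p * x powr (p - 1) - \<delta> * x powr p) * exp (- \<delta> * x)"
  define C' where "C' = C + \<bar>(lam - 1 - real N) * b N\<bar>"
  \<comment> \<open>For p \<le> 0 the derivative of -K x^p exp (-\<delta> x) is at least K \<delta>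
    x^p exp (-\<delta> x), so this choice of \<open>K\<close> dominates the error
    \<open>C'\<close>.\<close>
  define K where "K = C' / \<delta>"
  have C': "C' \<ge> 0" using C by (simp add: C'_def)
  have K: "K \<ge> 0" using C' \<delta>_pos by (simp add: K_def)
  have hm: "\<bar>h x + main_deriv N x\<bar> \<le> C' * ?e x" if "x > 0" for x
  proof -
    have "h x + main_deriv N x = (h x - exp (- \<delta> * x) * (\<Sum>k\<le>N. hankel_a k (lam - 1/2) / \<alpha> ^ k * x powr (lam - 1 - real k)))
        + (lam - 1 - real N) * b N * ?e x"
      by (simp add: main_deriv_eq p_def)
    also have "\<bar>\<dots>\<bar> \<le> C * ?e x + \<bar>(lam - 1 - real N) * b N\<bar> * ?e x"
      using hC[OF that] by (intro order.trans[OF abs_triangle_ineq] add_mono) (auto simp: p_def abs_mult)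
    finally show ?thesis by (simp add: C'_def algebra_simps)
  qed
  have e': "C' * ?e x \<le> - (K * ?e' x)" if "x > 0" for x
  proof -
    have "- (K * ?e' x) - C' * ?e x = K * (- p) * (x powr (p - 1) * exp (- \<delta> * x))"
      using \<delta>_pos by (simp add: K_def field_simps)
    also have "\<dots> \<ge> 0" using K p by (intro mult_nonneg_nonneg) auto
    finally show ?thesis by linarith
  qed
  have [measurable]: "main_deriv N \<in> borel_measurable borel"
    unfolding main_deriv_def by measurable
  \<comment> \<open>The lower comparison is -main' + K e' \<le> h, whose left side may be negative.
    Adding -2 K e' on both sides keeps all integrands nonnegative, as \<open>nn_integral\<close>
    demands.\<close>
  have upper: "h x \<le> - main_deriv N x - K * ?e' x" and lower: "- main_deriv N x - K * ?e' x \<le> h x + 2 * (- (K * ?e' x))"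
    if "x > 0" for x
    using hm[OF that] e'[OF that] by linarith+
  have h0: "h x \<ge> 0" for x using vg_const_pos f_nonneg by simp
  have int_G: "(\<integral>\<^sup>+t. ennreal (- main_deriv N t - K * ?e' t) * indicator {x..} t \<partial>lborel)
      = ennreal (main_term N x + K * ?e x)" if x: "x > 0" for x
  proof -
    have "(\<integral>\<^sup>+t. ennreal (- main_deriv N t - K * ?e' t) * indicator {x..} t \<partial>lborel)
        = ennreal (0 - (- main_term N x - K * ?e x))"
    proof (rule nn_integral_FTC_atLeast)
      show "((\<lambda>t. - main_term N t - K * ?e t) \<longlongrightarrow> 0) at_top"
        using tendsto_diff[OF tendsto_minus[OF main_term_tendsto] tendsto_mult[OF tendsto_const powr_exp_tendsto[OF \<delta>_pos]], of N K p]
        by simp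
      fix t assume "x \<le> t"
      then have t: "t > 0" using x by simp
      show "((\<lambda>t. - main_term N t - K * ?e t) has_real_derivative - main_deriv N t - K * ?e' t) (at t)"
        using t by (intro DERIV_diff DERIV_minus DERIV_cmult main_term_deriv powr_exp_deriv)
      show "0 \<le> - main_deriv N t - K * ?e' t" using upper[OF t] h0[of t] by linarith
    qed measurable
    then show ?thesis by (simp add: add.commute)
  qed
  have int_e: "(\<integral>\<^sup>+t. ennreal (2 * (- (K * ?e' t))) * indicator {x..} t \<partial>lborel)
      = ennreal (2 * (K * ?e x))" if x: "x > 0" for x
  proof -
    have "(\<integral>\<^sup>+t. ennreal (2 * (- (K * ?e' t))) * indicator {x..} t \<partial>lborel)
        = ennreal (0 - 2 * (- (K * ?e x)))"
    proof (rule nn_integral_FTC_atLeast)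
      show "((\<lambda>t. 2 * (- (K * ?e t))) \<longlongrightarrow> 0) at_top"
        using tendsto_mult[OF tendsto_const[of "2::real"] tendsto_minus[OF tendsto_mult[OF tendsto_const powr_exp_tendsto[OF \<delta>_pos]]], of K p]
        by simp
      fix t assume "x \<le> t"
      then have t: "t > 0" using x by simp
      show "((\<lambda>t. 2 * (- (K * ?e t))) has_real_derivative 2 * (- (K * ?e' t))) (at t)"
        using t by (intro DERIV_minus DERIV_cmult powr_exp_deriv)
      have "C' * ?e t \<ge> 0" using C' by simp
      then show "0 \<le> 2 * (- (K * ?e' t))" using e'[OF t] by linarith
    qed measurable
    also have "0 - 2 * (- (K * ?e x)) = 2 * (K * ?e x)" by simp
    finally show ?thesis .
  qed
  have "\<bar>V x - main_term N x\<bar> \<le> K * ?e x" if x: "x > 0" for x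
  proof -
    have "ennreal (V x) \<le> ennreal (main_term N x + K * ?e x)"
      unfolding V_nn_integral[symmetric] int_G[OF x, symmetric]
      using upper x by (intro nn_integral_mono) (auto simp: indicator_def intro!: ennreal_leI)
    then have 1: "V x \<le> main_term N x + K * ?e x"
      using V_pos[of x] by (simp add: ennreal_le_iff2)
    have "ennreal (main_term N x + K * ?e x) \<le> (\<integral>\<^sup>+t. ennreal (h t) * indicator {x..} t
        + ennreal (2 * (- (K * ?e' t))) * indicator {x..} t \<partial>lborel)"
      unfolding int_G[OF x, symmetric]
    proof (rule nn_integral_mono)
      fix t
      show "ennreal (- main_deriv N t - K * ?e' t) * indicator {x..} t
        \<le> ennreal (h t) * indicator {x..} t + ennreal (2 * (- (K * ?e' t))) * indicator {x..} t"
      proof (cases "x \<le> t")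
        case True
        then have t: "t > 0" using x by simp
        have "C' * ?e t \<ge> 0" using C' by simp
        then have "2 * (- (K * ?e' t)) \<ge> 0" using e'[OF t] by linarith
        then show ?thesis
          using True lower[OF t] h0[of t] ennreal_leI[OF lower[OF t]]
          by (simp add: ennreal_plus[symmetric] del: ennreal_plus)
      qed simp
    qed
    also have "\<dots> = ennreal (V x) + ennreal (2 * (K * ?e x))"
      unfolding V_nn_integral[symmetric] int_e[OF x, symmetric] by (rule nn_integral_add) measurable
    also have "\<dots> = ennreal (V x + 2 * (K * ?e x))"
      using V_pos[of x] K by (subst ennreal_plus) auto
    finally have "main_term N x + K * ?e x \<le> V x + 2 * (K * ?e x)"
      using V_pos[of x] K by (subst (asm) ennreal_le_iff) auto
    then show ?thesis using 1 by linarith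
  qed
  then show ?thesis using that[of K] by (simp add: p_def)
qed

section \<open>Logarithm of the tail and expansion of x - y\<close>

definition G :: "real \<Rightarrow> real" where
  "G x = V x / (x powr (lam - 1) * exp (- \<delta> * x))"

lemma expands_G: "expands at_top (\<lambda>x. x) N G (coeff_lift (vg_D lam \<alpha> \<beta>))"
proof -
  obtain N0 where "lam \<le> real N0" using real_arch_simple by blast
  \<comment> \<open>The tail estimate requires an order of at least lam; smaller orders are
    recovered by truncation.\<close>
  define L where "L = max N N0"
  have L: "lam \<le> real L" "N \<le> L" using \<open>lam \<le> real N0\<close> by (auto simp: L_def)
  obtain K where K: "\<And>x. x > 0 \<Longrightarrow> \<bar>V x - main_term L x\<bar> \<le> K * (x powr (lam - 2 - real L) * exp (- \<delta> * x))"
    using V_main_term[OF L(1)] by blast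
  have "(\<lambda>x. G x - (\<Sum>n\<le>L. b n / x ^ n)) \<in> O[at_top](\<lambda>x. 1 / x ^ Suc L)"
  proof (rule bigoI[of _ K])
    show "\<forall>\<^sub>F x in at_top. norm (G x - (\<Sum>n\<le>L. b n / x ^ n)) \<le> K * norm (1 / x ^ Suc L)"
      using eventually_gt_at_top[of 0]
    proof eventually_elim
      case (elim x)
      define E where "E = x powr (lam - 1) * exp (- \<delta> * x)"
      have E: "E > 0" using elim by (simp add: E_def)
      have pow: "x powr (lam - 1 - real k) = x powr (lam - 1) / x ^ k" for k
        using elim by (simp add: powr_diff powr_realpow)
      have "main_term L x = E * (\<Sum>n\<le>L. b n / x ^ n)"
        by (simp add: main_term_def E_def pow sum_distrib_left mult_ac)
      then have "G x - (\<Sum>n\<le>L. b n / x ^ n) = (V x - main_term L x) / E"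
        using E unfolding G_def E_def[symmetric] by (simp add: diff_divide_distrib)
      then have "\<bar>G x - (\<Sum>n\<le>L. b n / x ^ n)\<bar> = \<bar>V x - main_term L x\<bar> / E"
        using E by simp
      also have "\<dots> \<le> K * (x powr (lam - 2 - real L) * exp (- \<delta> * x)) / E"
        using K[OF elim] E by (intro divide_right_mono) auto
      also have "lam - 2 - real L = lam - 1 - real (Suc L)" by simp
      also have "K * (x powr (lam - 1 - real (Suc L)) * exp (- \<delta> * x)) / E = K * (1 / x ^ Suc L)"
        using E by (simp only: pow) (simp add: E_def)
      finally show ?case using elim by simp
    qed
  qed
  also have "(\<lambda>x::real. 1 / x ^ Suc L) \<in> o[at_top](\<lambda>x. 1 / x ^ L)"
    using poly_ln_term[OF filterlim_ident, of L "Suc L" 1] by simp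
  finally have "expands at_top (\<lambda>x. x) L G (coeff_lift (vg_D lam \<alpha> \<beta>))"
    by (simp add: expands_def vg_D_def)
  then show ?thesis by (rule expands_mono[OF filterlim_ident]) (rule L)
qed

definition \<psi> :: "real \<Rightarrow> real" where "\<psi> x = ln (G x) / \<delta>"

lemma b0: "b 0 = 1 / \<delta>"
  by (rule vg_b_0)

lemma G_pos: "x > 0 \<Longrightarrow> G x > 0"
  using V_pos[of x] by (simp add: G_def)

text \<open>\<open>G\<close> tends to b_0 = 1 / \<delta>. The logarithm is expanded after division
  by this limit, which is the normalisation used in \<open>fps_log\<close>, so the formal logarithm
  matches term by term.\<close>

lemma expands_psi: "expands at_top (\<lambda>x. x) N \<psi> (coeff_lift (vg_phi lam \<alpha> \<beta>))"
proof -
  define q where "q = (\<lambda>x. \<delta> * G x - 1)"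
  define A where "A = fps_const \<delta> * vg_D lam \<alpha> \<beta> - 1"
  have A0: "fps_nth A 0 = 0"
    using \<delta>_pos by (simp add: A_def vg_D_def b0)
  have qe: "expands at_top (\<lambda>x. x) N q (coeff_lift A)" for N
  proof -
    have "expands at_top (\<lambda>x. x) N (\<lambda>x. \<delta> * G x + (- 1))
        (fps_const [:\<delta>:] * coeff_lift (vg_D lam \<alpha> \<beta>) + fps_const [:- 1:])"
      by (intro expands_add expands_cmult expands_G expands_const)
    moreover have "fps_const [:\<delta>:] * coeff_lift (vg_D lam \<alpha> \<beta>) + fps_const [:- 1:] = coeff_lift A"
      by (rule fps_ext) (auto simp: A_def one_pCons)
    ultimately show ?thesis by (simp add: q_def)
  qed
  have "(\<lambda>x. q x - fps_nth A 1 / x) \<in> o[at_top](\<lambda>x. 1 / x)"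
    using qe[of 1] A0 by (simp add: expands_def)
  moreover have "(\<lambda>x. fps_nth A 1 / x) \<in> O[at_top](\<lambda>x. 1 / x)"
    by (rule bigoI[of _ "\<bar>fps_nth A 1\<bar>"]) simp
  ultimately have "(\<lambda>x. (q x - fps_nth A 1 / x) + fps_nth A 1 / x) \<in> O[at_top](\<lambda>x. 1 / x)"
    by (intro sum_in_bigo(1)[OF landau_o.small_imp_big])
  then have q1: "q \<in> O[at_top](\<lambda>x. 1 / x)" by simp
  moreover have "(\<lambda>x::real. 1 / x) \<in> O[at_top](\<lambda>x. ln x / x)" by real_asymp
  ultimately have q2: "q \<in> O[at_top](\<lambda>x. ln x / x)" by (rule landau_o.big_trans)
  have "(\<lambda>x::real. 1 / x) \<in> o[at_top](\<lambda>_. 1)" by real_asymp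
  with q1 have "q \<in> o[at_top](\<lambda>_. 1)" by (rule landau_o.big_small_trans)
  then have q0: "(q \<longlongrightarrow> 0) at_top"
    using smalloD_tendsto by fastforce
  have "expands at_top (\<lambda>x. x) N (\<lambda>x. ln (1 + q x)) (coeff_lift (fps_ln 1) oo coeff_lift A)"
    by (rule expands_compose[OF filterlim_ident q2 qe]) (simp add: A0, rule bigo_of_taylor[OF q0 ln_taylor])
  then have "expands at_top (\<lambda>x. x) N (\<lambda>x. 1 / \<delta> * (ln (b 0) + ln (1 + q x)))
      (fps_const [:1 / \<delta>:] * (fps_const [:ln (b 0):] + coeff_lift (fps_ln 1 oo A)))"
    by (intro expands_cmult expands_add expands_const) (simp add: lift.fps_map_compose)
  moreover have "fps_const [:1 / \<delta>:] * (fps_const [:ln (b 0):] + coeff_lift (fps_ln 1 oo A)) = coeff_lift (vg_phi lam \<alpha> \<beta>)"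
    using \<delta>_pos
    by (simp add: vg_phi_def fps_log_def lift.fps_map_mult lift.fps_map_add lift.fps_map_const vg_D_def[of lam \<alpha> \<beta>] b0 A_def)
  moreover have "eventually (\<lambda>x. 1 / \<delta> * (ln (b 0) + ln (1 + q x)) = \<psi> x) at_top"
    using eventually_gt_at_top[of 0]
  proof eventually_elim
    case (elim x)
    then show ?case
      using \<delta>_pos G_pos[OF elim] by (simp add: \<psi>_def q_def b0 ln_div ln_mult)
  qed
  ultimately show ?thesis
    unfolding expands_def by (subst (asm) landau_o.small.in_cong) (auto elim: eventually_mono)
qed

text \<open>Taking one more term turns the little-o remainder into the big-O remainder of the next
  order, the form that the inversion needs.\<close>

lemma psi_series:
  "(\<lambda>x. \<psi> x - (\<Sum>k\<le>N. fps_nth (vg_phi lam \<alpha> \<beta>) k * (1 / x) ^ k)) \<in> O[at_top](\<lambda>x. (1 / x) ^ Suc N)"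
proof -
  let ?c = "fps_nth (vg_phi lam \<alpha> \<beta>)"
  have "(\<lambda>x. \<psi> x - (\<Sum>n\<le>Suc N. ?c n / x ^ n)) \<in> O[at_top](\<lambda>x. 1 / x ^ Suc N)"
    using expands_psi[of "Suc N"] by (intro landau_o.small_imp_big) (simp add: expands_def)
  moreover have "(\<lambda>x. ?c (Suc N) / x ^ Suc N) \<in> O[at_top](\<lambda>x. 1 / x ^ Suc N)"
    by (rule bigoI[of _ "\<bar>?c (Suc N)\<bar>"]) simp
  ultimately have "(\<lambda>x. (\<psi> x - (\<Sum>n\<le>Suc N. ?c n / x ^ n)) + ?c (Suc N) / x ^ Suc N) \<in> O[at_top](\<lambda>x. 1 / x ^ Suc N)"
    by (rule sum_in_bigo(1))
  then show ?thesis
    by (simp add: power_one_over)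
qed

definition Y :: "real \<Rightarrow> real" where
  "Y x = x - (lam - 1) / \<delta> * ln x - \<psi> x"

text \<open>An exact identity, because \<open>G\<close> is by definition the quotient of
  \<open>V\<close> by its leading factor. \<open>V\<close> at x is the v of the statement for u =
  F(x), so \<open>Y\<close> at x is the corresponding y.\<close>

lemma Y_V: "x > 0 \<Longrightarrow> Y x = - ln (V x) / \<delta>"
proof -
  assume x: "x > 0"
  then have "V x = x powr (lam - 1) * exp (- \<delta> * x) * G x" by (simp add: G_def)
  then have "ln (V x) = (lam - 1) * ln x + - \<delta> * x + ln (G x)"
    using x G_pos[OF x] by (simp add: ln_mult)
  then have "- ln (V x) = \<delta> * x - (lam - 1) * ln x - ln (G x)"
    by (simp add: algebra_simps)
  then have "- ln (V x) / \<delta> = (\<delta> * x - (lam - 1) * ln x - ln (G x)) / \<delta>"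
    by (rule arg_cong)
  moreover have "(d * x - m * l - g) / d = x - m / d * l - g / d" if "d \<noteq> 0" for d m l g :: real
    using that by (simp add: diff_divide_distrib)
  ultimately show ?thesis
    using \<delta>_pos by (simp only: Y_def \<psi>_def)
qed

abbreviation "W \<equiv> Abs_fps (vg_poly lam \<alpha> \<beta>)"

lemma Y_at_top: "filterlim Y at_top at_top"
  and Y_expansion: "expands at_top Y N (\<lambda>x. x - Y x) W"
  by (rule inverse_expansion[OF psi_series Y_def vg_poly_fixed_point[OF \<beta>_less]])+

section \<open>The quantile function\<close>

abbreviation "Q \<equiv> vg_quantile lam \<alpha> \<beta>"

lemma cdf_inj: "inj (vg_cdf lam \<alpha> \<beta>)"
  using cdf_strict_mono by (rule strict_mono_imp_inj_on)

lemma Q_cdf: "Q (vg_cdf lam \<alpha> \<beta> x) = x"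
  unfolding vg_quantile_def by (rule inv_f_f[OF cdf_inj])

text \<open>\<open>inv\<close> is a right inverse only on the range; the intermediate value theorem
  with the limits 0 and 1 shows that the range contains the open unit interval.\<close>

lemma cdf_Q:
  assumes "0 < u" "u < 1"
  shows "vg_cdf lam \<alpha> \<beta> (Q u) = u"
proof -
  have "eventually (\<lambda>x. vg_cdf lam \<alpha> \<beta> x < u) at_bot"
    using M.cdf_lim_at_bot assms(1) unfolding vg_cdf_eq by (rule order_tendstoD(2))
  then obtain a where a: "vg_cdf lam \<alpha> \<beta> a < u"
    by (auto dest: eventually_happens)
  have "eventually (\<lambda>x. vg_cdf lam \<alpha> \<beta> x > u) at_top"
    using M.cdf_lim_at_top_prob assms(2) unfolding vg_cdf_eq by (rule order_tendstoD(1))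
  then obtain c where c: "vg_cdf lam \<alpha> \<beta> c > u"
    by (auto dest: eventually_happens)
  from a c have "vg_cdf lam \<alpha> \<beta> a < vg_cdf lam \<alpha> \<beta> c" by linarith
  then have "a \<le> c"
    using cdf_strict_mono by (simp add: strict_mono_less)
  then obtain x where "vg_cdf lam \<alpha> \<beta> x = u"
    using IVT[of "vg_cdf lam \<alpha> \<beta>" a u c] a c cdf_isCont by auto
  then show ?thesis using Q_cdf by auto
qed

lemma eventually_unit: "eventually (\<lambda>u::real. 0 < u \<and> u < 1) (at_left 1)"
  using eventually_at_left_real[of 0 1] by (auto elim: eventually_mono)

lemma Q_at_top: "filterlim Q at_top (at_left 1)"
  unfolding filterlim_at_top_dense
proof
  fix z
  have "eventually (\<lambda>u. vg_cdf lam \<alpha> \<beta> z < u) (at_left 1)"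
    using eventually_at_left_real[OF cdf_bounds(2)[of z]] by (auto elim: eventually_mono)
  with eventually_unit show "eventually (\<lambda>u. z < Q u) (at_left 1)"
  proof eventually_elim
    case (elim u)
    then have "vg_cdf lam \<alpha> \<beta> z < vg_cdf lam \<alpha> \<beta> (Q u)" by (simp add: cdf_Q)
    then show ?case using cdf_strict_mono by (simp add: strict_mono_less)
  qed
qed

lemma vg_y_eq: "eventually (\<lambda>u. Y (Q u) = vg_y lam \<alpha> \<beta> u) (at_left 1)"
proof -
  have "eventually (\<lambda>u. Q u > 0) (at_left 1)"
    using Q_at_top by (simp add: filterlim_at_top_dense)
  with eventually_unit show ?thesis
    by eventually_elim (simp add: Y_V V_def cdf_Q vg_y_def vg_v_def vg_const_def)
qed

lemma vg_y_at_top: "filterlim (vg_y lam \<alpha> \<beta>) at_top (at_left 1)"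
  using filterlim_compose[OF Y_at_top Q_at_top] filterlim_cong[OF refl refl vg_y_eq] by simp

text \<open>The expansion in x at infinity is pulled back along \<open>Q\<close>, which tends to
  infinity as u tends to 1; there \<open>Y\<close> composed with \<open>Q\<close> is y.\<close>

lemma quantile_expansion:
  "(\<lambda>u. Q u - vg_y lam \<alpha> \<beta> u - (\<Sum>n\<le>N. vg_P lam \<alpha> \<beta> n (ln (vg_y lam \<alpha> \<beta> u)) / vg_y lam \<alpha> \<beta> u ^ n))
    \<in> o[at_left 1](\<lambda>u. 1 / vg_y lam \<alpha> \<beta> u ^ N)"
proof -
  have "(\<lambda>u. Q u - Y (Q u) - (\<Sum>n\<le>N. vg_P lam \<alpha> \<beta> n (ln (Y (Q u))) / Y (Q u) ^ n))
      \<in> o[at_left 1](\<lambda>u. 1 / Y (Q u) ^ N)"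
    using landau_o.small.compose[OF Y_expansion[of N, unfolded expands_def] Q_at_top]
    by (simp add: vg_P_eq_poly)
  also have "?this \<longleftrightarrow> ?thesis"
    by (rule landau_o.small.cong_ex) (use vg_y_eq in \<open>auto elim: eventually_mono\<close>)
  finally show ?thesis .
qed

text \<open>The law for -\<beta> is the mirror image of the law for \<beta>, and there are no atoms:
  F_(-\<beta>)(-x) = 1 - F_\<beta>(x). Put x = Q(u) and apply the reflected quantile
  function.\<close>

lemma quantile_reflect:
  assumes "0 < u" "u < 1"
  shows "Q u = - vg_quantile lam \<alpha> (- \<beta>) (1 - u)"
proof -
  interpret r: variance_gamma lam \<alpha> "- \<beta>"
    using lam \<alpha> \<beta> by unfold_locales auto
  let ?x = "Q u"
  have "ennreal (measure r.M {..- ?x}) = (\<integral>\<^sup>+t. ennreal (vg_density lam \<alpha> (- \<beta>) t) * indicator {..- ?x} t \<partial>lborel)"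
    by (simp add: r.emeasure_M r.M.emeasure_eq_measure[symmetric])
  also have "\<dots> = (\<integral>\<^sup>+t. ennreal (f t) * indicator {?x..} t \<partial>lborel)"
    by (subst nn_integral_real_affine[where c = "-1" and t = 0])
       (auto intro!: nn_integral_cong simp: vg_density_minus indicator_def)
  also have "\<dots> = ennreal (measure M {?x..})"
    by (simp add: emeasure_M M.emeasure_eq_measure[symmetric])
  finally have "measure r.M {..- ?x} = measure M {?x..}" by simp
  also have "measure M {?x..} = measure M (space M - {..?x}) + measure M {?x}"
    by (subst M.finite_measure_Union[symmetric]) (auto intro!: arg_cong[of _ _ "measure M"])
  also have "\<dots> = 1 - vg_cdf lam \<alpha> \<beta> ?x"
    by (subst M.prob_compl) (auto simp: M_singleton vg_cdf_eq cdf_def)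
  finally have "vg_cdf lam \<alpha> (- \<beta>) (- ?x) = 1 - u"
    using assms by (simp add: cdf_Q r.vg_cdf_eq cdf_def)
  then show ?thesis
    using r.Q_cdf[of "- ?x"] by simp
qed

lemma vg_P_0: "vg_P lam \<alpha> \<beta> 0 \<xi> = ((lam - 1) * \<xi> - ln \<delta>) / \<delta>"
  using diff_divide_distrib[of "(lam - 1) * \<xi>"] by (simp add: vg_c_0[OF \<beta>_less])

text \<open>The integral in the recursion has the factor 0 here, so P_1 is m^2 \<xi> + c_1 with m =
  (lam - 1) / \<delta>.\<close>

lemma vg_P_1: "vg_P lam \<alpha> \<beta> 1 \<xi> = (lam - 1) * (2 * \<alpha> + \<alpha> * lam - \<beta> * lam + 2 * \<alpha> * (lam - 1) * \<xi>
    - 2 * \<alpha> * ln \<delta>) / (2 * \<alpha> * \<delta>\<^sup>2)"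
proof -
  have "m / d * (m / d * \<xi>) + m * (X - Z) / (2 * a * d\<^sup>2) = m * (X + 2 * a * m * \<xi> - Z) / (2 * a * d\<^sup>2)"
    if "a > 0" "d > 0" for m d a X Z :: real
    using that by (simp add: field_simps power2_eq_square)
  from this[OF \<alpha> \<delta>_pos] show ?thesis
    using vg_c_1[OF \<beta>_less \<alpha>, of lam] by simp
qed

end

text \<open>For lam = 1 the factor lam - 1 vanishes and every P_n is the constant c_n, so exact
  degrees are asserted only for lam \<noteq> 1 and upper bounds in general.\<close>

theorem mainTheorem5:
  fixes lam \<alpha> \<beta> :: real
  assumes "lam > 0" and "\<alpha> > 0" and "\<bar>\<beta>\<bar> < \<alpha>"
  defines "Q \<equiv> vg_quantile lam \<alpha> \<beta>"
    and "y \<equiv> vg_y lam \<alpha> \<beta>"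
    and "P \<equiv> vg_P lam \<alpha> \<beta>"
  shows
    "has_asymp_expansion (\<lambda>u. Q u - y u) (\<lambda>n u. P n (ln (y u)) / y u ^ n)
       (\<lambda>n u. 1 / y u ^ n) (at_left 1)
     \<and> (\<exists>p :: nat \<Rightarrow> real poly.
          (\<forall>n \<xi>. P n \<xi> = poly (p n) \<xi>)
          \<and> degree (p 0) \<le> 1 \<and> (\<forall>n\<ge>1. degree (p n) \<le> n)
          \<and> (lam \<noteq> 1 \<longrightarrow> degree (p 0) = 1 \<and> (\<forall>n\<ge>1. degree (p n) = n)))
     \<and> (\<forall>n. \<forall>k\<le>n. fps_nth (vg_u lam \<alpha> \<beta> (n + 1)) k = vg_c lam \<alpha> \<beta> k)
     \<and> (\<forall>z>0. P 0 (ln z) = ((lam - 1) * ln z - ln (\<alpha> - \<beta>)) / (\<alpha> - \<beta>))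
     \<and> (\<forall>z>0. P 1 (ln z) / z =
          (lam - 1) * (2 * \<alpha> + \<alpha> * lam - \<beta> * lam + 2 * \<alpha> * (lam - 1) * ln z
             - 2 * \<alpha> * ln (\<alpha> - \<beta>)) / (2 * z * \<alpha> * (\<alpha> - \<beta>)\<^sup>2))
     \<and> (\<lambda>u. Q u -
          (y u + ((lam - 1) * ln (y u) - ln (\<alpha> - \<beta>)) / (\<alpha> - \<beta>)
           + (lam - 1) * (2 * \<alpha> + \<alpha> * lam - \<beta> * lam + 2 * \<alpha> * (lam - 1) * ln (y u)
               - 2 * \<alpha> * ln (\<alpha> - \<beta>)) / (2 * y u * \<alpha> * (\<alpha> - \<beta>)\<^sup>2)))
        \<in> o[at_left 1](\<lambda>u. 1 / y u)
     \<and> (\<forall>u\<in>{0<..<1}. Q u = - vg_quantile lam \<alpha> (- \<beta>) (1 - u))"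
proof (intro conjI)
  interpret v: variance_gamma lam \<alpha> \<beta> using assms(1-3) by unfold_locales
  have P1: "P 1 (ln z) / z = (lam - 1) * (2 * \<alpha> + \<alpha> * lam - \<beta> * lam + 2 * \<alpha> * (lam - 1) * ln z
             - 2 * \<alpha> * ln (\<alpha> - \<beta>)) / (2 * z * \<alpha> * (\<alpha> - \<beta>)\<^sup>2)" for z
    unfolding P_def v.vg_P_1 by (simp add: mult_ac)
  have P0: "P 0 \<xi> = ((lam - 1) * \<xi> - ln (\<alpha> - \<beta>)) / (\<alpha> - \<beta>)" for \<xi>
    unfolding P_def by (rule v.vg_P_0)
  show "has_asymp_expansion (\<lambda>u. Q u - y u) (\<lambda>n u. P n (ln (y u)) / y u ^ n)
       (\<lambda>n u. 1 / y u ^ n) (at_left 1)"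
    using v.quantile_expansion poly_ln_term[OF v.vg_y_at_top, of _ _ 1]
    by (simp add: has_asymp_expansion_def Q_def y_def P_def del: power_Suc)
  show "\<exists>p :: nat \<Rightarrow> real poly.
          (\<forall>n \<xi>. P n \<xi> = poly (p n) \<xi>)
          \<and> degree (p 0) \<le> 1 \<and> (\<forall>n\<ge>1. degree (p n) \<le> n)
          \<and> (lam \<noteq> 1 \<longrightarrow> degree (p 0) = 1 \<and> (\<forall>n\<ge>1. degree (p n) = n))"
  proof (intro exI[of _ "vg_poly lam \<alpha> \<beta>"] conjI allI impI)
    fix n :: nat assume n: "1 \<le> n"
    show "degree (vg_poly lam \<alpha> \<beta> n) \<le> n"
      using n degree_vg_poly_Suc_le[of lam \<alpha> \<beta> "n - 1"] by simp
    show "degree (vg_poly lam \<alpha> \<beta> n) = n" if "lam \<noteq> 1"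
      using n degree_vg_poly_Suc[OF that v.\<beta>_less, of "n - 1"] by simp
  qed (use v.\<beta>_less in \<open>auto simp: P_def vg_P_eq_poly\<close>)
  show "\<forall>n. \<forall>k\<le>n. fps_nth (vg_u lam \<alpha> \<beta> (n + 1)) k = vg_c lam \<alpha> \<beta> k"
    using vg_u_nth[OF v.\<beta>_less] by (simp del: vg_u.simps)
  show "\<forall>z>0. P 0 (ln z) = ((lam - 1) * ln z - ln (\<alpha> - \<beta>)) / (\<alpha> - \<beta>)"
    using P0 by simp
  show "\<forall>z>0. P 1 (ln z) / z =
          (lam - 1) * (2 * \<alpha> + \<alpha> * lam - \<beta> * lam + 2 * \<alpha> * (lam - 1) * ln z
             - 2 * \<alpha> * ln (\<alpha> - \<beta>)) / (2 * z * \<alpha> * (\<alpha> - \<beta>)\<^sup>2)"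
    using P1 by blast
  have "(\<Sum>n\<le>1. P n (ln (y u)) / y u ^ n) = P 0 (ln (y u)) + P 1 (ln (y u)) / y u" for u
    by simp
  with v.quantile_expansion[of 1, folded Q_def y_def P_def]
  have "(\<lambda>u. Q u - y u - (P 0 (ln (y u)) + P 1 (ln (y u)) / y u)) \<in> o[at_left 1](\<lambda>u. 1 / y u)"
    by (simp only: power_one_right)
  then show "(\<lambda>u. Q u -
          (y u + ((lam - 1) * ln (y u) - ln (\<alpha> - \<beta>)) / (\<alpha> - \<beta>)
           + (lam - 1) * (2 * \<alpha> + \<alpha> * lam - \<beta> * lam + 2 * \<alpha> * (lam - 1) * ln (y u)
               - 2 * \<alpha> * ln (\<alpha> - \<beta>)) / (2 * y u * \<alpha> * (\<alpha> - \<beta>)\<^sup>2)))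
        \<in> o[at_left 1](\<lambda>u. 1 / y u)"
    unfolding P0 P1 by (simp only: diff_diff_add add.assoc)
  show "\<forall>u\<in>{0<..<1}. Q u = - vg_quantile lam \<alpha> (- \<beta>) (1 - u)"
    using v.quantile_reflect by (simp add: Q_def)
qed

end
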